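(* Let $(\mathcal{G},\|\cdot\|)$ be an arithmetical semigroup satisfying Axiom $A$, with set of primes $\mathcal{P}$, and let $S\subseteq\mathcal{P}$ have natural density $\delta(S)$. Let $a\colon\mathcal{G}\to\mathbb{C}$ be an arithmetic function supported on $\mathfrak{D}(\mathcal{G},S)$ with $a(e_{\mathcal{G}})=1$, and assume $$\lim_{x\to\infty}\sum_{\substack{2\le\|g\|\le x\\ g\in\mathfrak{D}(\mathcal{G},S)}}\frac{|a(g)|}{\|g\|}\log\log\|g\|<\infty .$$ Then $$-\lim_{x\to\infty}\sum_{\substack{\|g\|\le x\\ g\in\mathfrak{D}(\mathcal{G},S),\ g\neq e_{\mathcal{G}}}}\frac{(\mu*a)(g)}{\|g\|}=\delta(S).$$ In particular, taking $a$ to be the identity of the Dirichlet convolution ring ($a(e_{\mathcal{G}})=1$, $a(g)=0$ for $g\ne e_{\mathcal{G}}$), $$-\lim_{x\to\infty}\sum_{\substack{\|g\|\le x\\ g\in\mathfrak{D}(\mathcal{G},S),\ g\neq e_{\mathcal{G}}}}\frac{\mu(g)}{\|g\|}=\delta(S).$$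
   Context: An arithmetical semigroup is a commutative monoid $\mathcal{G}$ with identity $e_{\mathcal{G}}$ that is freely generated (as a commutative monoid) by a finite or countable set $\mathcal{P}$ of "primes", equipped with a norm $\|\cdot\|\colon\mathcal{G}\to\mathbb{R}$ such that $\|e_{\mathcal{G}}\|=1$, $\|P\|>1$ for all $P\in\mathcal{P}$, $\|gh\|=\|g\|\|h\|$, and $\mathcal{N}(x):=\#\{g\in\mathcal{G}:\|g\|\le x\}$ is finite for every $x>0$. It satisfies Axiom $A$ if $\mathcal{N}(x)=c_{\mathcal{G}}x+O(x^{\eta})$ for constants $c_{\mathcal{G}}>0$ and $0<\eta<1$. For $S\subseteq\mathcal{P}$, the natural density is $\delta(S):=\lim_{x\to\infty}\pi_{\mathcal{G},S}(x)/\pi_{\mathcal{G}}(x)$ (when the limit exists), where $\pi_{\mathcal{G},S}(x)=\#\{P\in S:\|P\|\le x\}$ and $\pi_{\mathcal{G}}(x)=\pi_{\mathcal{G},\mathcal{P}}(x)$. We write $h\mid g$ if $g=hr$ for some $r\in\mathcal{G}$. For $g\ne e_{\mathcal{G}}$ let $\mathrm{N}_-(g)=\min\{\|P\|:P\in\mathcal{P},P\mid g\}$. An element $g$ is distinguishable if $g\neq e_{\mathcal{G}}$ and there is a unique prime $P_{\min}(g)\mid g$ with $\|P_{\min}(g)\|=\mathrm{N}_-(g)$. Set $\mathfrak{D}(\mathcal{G},S)=\{g: g\text{ distinguishable},\ P_{\min}(g)\in S\}\cup\{e_{\mathcal{G}}\}$. The Möbius function is $\mu(e_{\mathcal{G}})=1$,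 $\mu(P_1\cdots P_k)=(-1)^k$ for distinct primes $P_i$, and $\mu(g)=0$ if $P^2\mid g$ for some prime $P$. A function $a$ is supported on $\mathfrak{D}(\mathcal{G},S)$ if $a(g)=0$ for $g\notin\mathfrak{D}(\mathcal{G},S)$. Dirichlet convolution: $(\mu*a)(g)=\sum_{h\mid g}\mu(h)a(g/h)$. *)

theory Defs
  imports "HOL-Analysis.Analysis" "HOL-Library.Multiset" "HOL-Library.Landau_Symbols"
begin

text \<open>An arithmetical semigroup is modelled as the free commutative monoid on the
  primes, i.e. the finite multisets over the type of primes ''p; the identity is the
  empty multiset, multiplication is multiset sum, and the norm is determined by its
  values N on the primes.\<close>

definition gnorm :: "('p \<Rightarrow> real) \<Rightarrow> 'p multiset \<Rightarrow> real" where
  "gnorm N g = prod_mset (image_mset N g)"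

definition arith_semigroup :: "('p \<Rightarrow> real) \<Rightarrow> bool" where
  "arith_semigroup N \<longleftrightarrow> (\<forall>p. N p > 1) \<and> (\<forall>x. finite {g. gnorm N g \<le> x})"

definition count_G :: "('p \<Rightarrow> real) \<Rightarrow> real \<Rightarrow> real" where
  "count_G N x = real (card {g. gnorm N g \<le> x})"

definition axiom_A :: "('p \<Rightarrow> real) \<Rightarrow> bool" where
  "axiom_A N \<longleftrightarrow> (\<exists>c \<eta>. c > 0 \<and> 0 < \<eta> \<and> \<eta> < 1 \<and>
      (\<lambda>x. count_G N x - c * x) \<in> O(\<lambda>x. x powr \<eta>))"

definition prime_count :: "('p \<Rightarrow> real) \<Rightarrow> 'p set \<Rightarrow> real \<Rightarrow> real" where
  "prime_count N S x = real (card {p \<in> S. N p \<le> x})"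

definition has_natural_density :: "('p \<Rightarrow> real) \<Rightarrow> 'p set \<Rightarrow> real \<Rightarrow> bool" where
  "has_natural_density N S \<delta> \<longleftrightarrow>
     ((\<lambda>x. prime_count N S x / prime_count N UNIV x) \<longlongrightarrow> \<delta>) at_top"

definition N_minus :: "('p \<Rightarrow> real) \<Rightarrow> 'p multiset \<Rightarrow> real" where
  "N_minus N g = Min (N ` set_mset g)"

definition distinguishable :: "('p \<Rightarrow> real) \<Rightarrow> 'p multiset \<Rightarrow> bool" where
  "distinguishable N g \<longleftrightarrow> g \<noteq> {#} \<and> (\<exists>!p. p \<in># g \<and> N p = N_minus N g)"

definition P_min :: "('p \<Rightarrow> real) \<Rightarrow> 'p multiset \<Rightarrow> 'p" where
  "P_min N g = (THE p. p \<in># g \<and> N p = N_minus N g)"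

definition DS :: "('p \<Rightarrow> real) \<Rightarrow> 'p set \<Rightarrow> 'p multiset set" where
  "DS N S = {g. distinguishable N g \<and> P_min N g \<in> S} \<union> {{#}}"

definition moebius :: "'p multiset \<Rightarrow> complex" where
  "moebius h = (if \<forall>p. count h p \<le> 1 then (-1) ^ size h else 0)"

definition dconv :: "('p multiset \<Rightarrow> complex) \<Rightarrow> ('p multiset \<Rightarrow> complex) \<Rightarrow> 'p multiset \<Rightarrow> complex" where
  "dconv f a g = (\<Sum>h \<in> {h. h \<subseteq># g}. f h * a (g - h))"

end

theory Submission
  imports Defs "HOL-Real_Asymp.Real_Asymp"
begin

text \<open>
  Write \<open>M x\<close> for the sum of the Moebius function over norms up to \<open>x\<close>.
  Axiom A continues the zeta function continuously to the closed half plane \<open>Re s \<ge> 1\<close> (apart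
  from its pole), the classical \<open>3 + 4 cos \<theta> + cos 2\<theta>\<close> argument shows that it has no zeros there,
  and a Tauberian theorem (Fejer kernel and Riemann--Lebesgue lemma) gives \<open>M x = o(x)\<close>.
  Since elements without primes of norm at most \<open>y\<close> have arbitrarily small density, the same follows
  for the Moebius function restricted to distinguishable elements with smallest prime in \<open>S\<close>, so
  Axer's theorem applies to it: up to \<open>o(x)\<close>, \<open>c * x\<close> times the sum of \<open>\<mu> g / |g|\<close> is the sum of
  \<open>\<mu> g\<close> times the number of multiples of \<open>g\<close> up to \<open>x\<close>. By Alladi's duality the latter is minus
  the number of elements up to \<open>x\<close> whose largest prime lies in \<open>S\<close>.
  That number is \<open>\<delta> * c * x + o(x)\<close>: writing \<open>g = P m\<close> with \<open>P\<close> the largest prime and summing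
  \<open>\<pi>\<^sub>S (x / |m|) - \<pi>\<^sub>S (N\<^sub>+ m)\<close> over \<open>m\<close>, one may replace \<open>\<pi>\<^sub>S\<close> by \<open>\<delta> * \<pi>\<close>, because the sum of
  \<open>\<pi> (x / |m|)\<close> over \<open>m\<close> with \<open>|m| * N\<^sub>+ m \<le> x\<close> is \<open>O(x)\<close>; this needs only Mertens' upper bound.

  For general \<open>a\<close> the sum splits according to the factor \<open>h\<close> carrying \<open>a h\<close>. The inner sum over
  cofactors is a combination of sums of \<open>\<mu> k / |k|\<close> over \<open>k\<close> without small primes, each uniformly
  bounded and tending to \<open>0\<close>, with weights \<open>1 / |Q|\<close> over primes up to \<open>|h|\<close>; these add up to
  \<open>O(log log |h|)\<close>, and dominated convergence applies.
\<close>

section \<open>Summation and integration\<close>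

text \<open>The density of \<open>S\<close> is only relative to all primes, and no asymptotic
  formula for \<open>\<pi>\<close> is used. So largest primes in \<open>S\<close> are compared with
  largest primes in \<open>UNIV\<close>, whose total is \<open>count_G\<close> up to the identity
  and ties. An error \<open>e * \<pi>\<close> then accumulates over all cofactors, and the O(x)
  bound on that accumulated sum is what makes the comparison succeed.

  Distinct primes may have equal norms. Duality then counts an element once for each prime of
  maximal norm, whereas only the count without ties is injective; their difference has to be shown
  to be o(x), using that few primes share a norm.

  The exponent \<open>\<eta> < 1\<close> is used beyond the density itself: the relative error of
  Axiom A has a Laplace transform that is Lipschitz up to the boundary line, which replaces
  analyticity in the non-vanishing proof; small elements become negligible in Axer's theorem; and
  the number of primes of a given norm \<open>t\<close> is at most a multiple of
  \<open>t powr \<eta>\<close>.\<close>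

lemma tendsto_sum_dominated:
  fixes f :: "'b \<Rightarrow> 'i \<Rightarrow> 'c::banach" and g :: "'i \<Rightarrow> real"
  assumes fin: "\<And>x. finite (A x)"
    and g: "g summable_on UNIV"
    and bound: "\<And>x i. i \<in> A x \<Longrightarrow> norm (f x i) \<le> g i"
    and lim: "\<And>i. ((\<lambda>x. if i \<in> A x then f x i else 0) \<longlongrightarrow> l i) F"
    and l: "\<And>i. norm (l i) \<le> g i"
  shows "((\<lambda>x. \<Sum>i\<in>A x. f x i) \<longlongrightarrow> infsum l UNIV) F"
proof (rule tendstoI)
  fix e :: real assume e: "e > 0"
  have g0: "g i \<ge> 0" for i using l[of i] norm_ge_zero order_trans by blast
  \<comment> \<open>Tannery's argument: \<open>F0\<close> carries all but \<open>e / 4\<close> of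
    the majorant, so outside it both the sums over \<open>A x\<close> and the limit series are
    small, whatever \<open>x\<close> is; on \<open>F0\<close> the limit is taken termwise.\<close>
  obtain F0 where F0: "finite F0" "dist (sum g F0) (infsum g UNIV) \<le> e / 4"
    using infsum_finite_approximation[OF g, of "e/4"] e by auto
  have tail: "sum g B \<le> e / 4" if "finite B" "B \<inter> F0 = {}" for B
  proof -
    have "sum g B + sum g F0 = sum g (B \<union> F0)"
      using that F0 by (subst sum.union_disjoint) auto
    also have "\<dots> \<le> infsum g UNIV"
      by (rule finite_sum_le_infsum) (use that F0 g g0 in auto)
    finally show ?thesis using F0(2) unfolding dist_real_def by linarith
  qed
  have labs: "(\<lambda>i. norm (l i)) summable_on UNIV"
    by (rule summable_on_comparison_test[OF g]) (use l in auto)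
  have lsum: "l summable_on UNIV" by (rule abs_summable_summable[OF labs])
  have ltail: "dist (sum l F0) (infsum l UNIV) \<le> e / 4"
  proof -
    have ls: "l summable_on (UNIV - F0)"
      using summable_on_cofin_subset[OF lsum] F0 by auto
    have "infsum l UNIV = sum l F0 + infsum l (UNIV - F0)"
      using infsum_Un_disjoint[of l F0 "UNIV - F0"] ls F0 by auto
    hence "dist (sum l F0) (infsum l UNIV) = norm (infsum l (UNIV - F0))"
      by (simp add: dist_norm)
    also have "\<dots> \<le> e / 4"
    proof -
      have 1: "(l has_sum infsum l (UNIV - F0)) (UNIV - F0)" using ls by simp
      have gs: "g summable_on (UNIV - F0)"
        using summable_on_cofin_subset[OF g] F0 by auto
      have 2: "(g has_sum infsum g (UNIV - F0)) (UNIV - F0)" using gs by simp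
      have "infsum g (UNIV - F0) \<le> e / 4"
        by (rule infsum_le_finite_sums[OF gs]) (use tail in auto)
      moreover have "norm (infsum l (UNIV - F0)) \<le> infsum g (UNIV - F0)"
        by (rule norm_infsum_le[OF 1 2]) (use l in auto)
      ultimately show ?thesis by linarith
    qed
    finally show ?thesis .
  qed
  have "((\<lambda>x. \<Sum>i\<in>F0. if i \<in> A x then f x i else 0) \<longlongrightarrow> sum l F0) F"
    by (intro tendsto_sum lim)
  hence "eventually (\<lambda>x. dist (\<Sum>i\<in>F0. if i \<in> A x then f x i else 0) (sum l F0) < e / 4) F"
    using e by (intro tendstoD) auto
  thus "eventually (\<lambda>x. dist (\<Sum>i\<in>A x. f x i) (infsum l UNIV) < e) F"
  proof eventually_elim
    case (elim x)
    have "(\<Sum>i\<in>A x. f x i) = (\<Sum>i\<in>A x \<inter> F0. f x i) + (\<Sum>i\<in>A x - F0. f x i)"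
      using fin by (subst sum.union_disjoint [symmetric]) (auto intro!: sum.cong)
    also have "(\<Sum>i\<in>A x \<inter> F0. f x i) = (\<Sum>i\<in>F0. if i \<in> A x then f x i else 0)"
      using F0 by (subst sum.inter_restrict[symmetric]) (auto simp: Int_commute)
    finally have "dist (\<Sum>i\<in>A x. f x i) (\<Sum>i\<in>F0. if i \<in> A x then f x i else 0)
        = norm (\<Sum>i\<in>A x - F0. f x i)" by (simp add: dist_norm)
    also have "\<dots> \<le> (\<Sum>i\<in>A x - F0. g i)"
      by (rule sum_norm_le) (use bound in auto)
    also have "\<dots> \<le> e / 4" using fin by (intro tail) auto
    finally show ?case using elim ltail e
      dist_triangle[of "\<Sum>i\<in>A x. f x i" "infsum l UNIV" "\<Sum>i\<in>F0. if i \<in> A x then f x i else 0"]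
      dist_triangle[of "\<Sum>i\<in>F0. if i \<in> A x then f x i else 0" "infsum l UNIV" "sum l F0"]
      by linarith
  qed
qed

section \<open>Moebius sums over squarefree elements\<close>

lemma gnorm_empty [simp]: "gnorm N {#} = 1"
  by (simp add: gnorm_def)

lemma gnorm_add_mset [simp]: "gnorm N (add_mset p g) = N p * gnorm N g"
  by (simp add: gnorm_def)

lemma gnorm_plus [simp]: "gnorm N (g + h) = gnorm N g * gnorm N h"
  by (simp add: gnorm_def)

lemma norm_moebius_le_1: "norm (moebius g) \<le> 1"
  by (simp add: moebius_def norm_power)

lemma moebius_add_mset:
  "moebius (add_mset p g) = (if p \<in># g then 0 else - moebius g)"
proof (cases "p \<in># g")
  case True
  hence "count (add_mset p g) p > 1" by simp
  thus ?thesis using True by (auto simp: moebius_def not_le intro!: exI[of _ p])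
next
  case False
  hence "count g p = 0" by (simp add: not_in_iff)
  hence "(\<forall>q. count (add_mset p g) q \<le> 1) \<longleftrightarrow> (\<forall>q. count g q \<le> 1)"
    by (simp add: all_conj_distrib) (metis le0)
  thus ?thesis using False by (simp add: moebius_def)
qed

definition squarefree_mset :: "'p multiset \<Rightarrow> bool" where
  "squarefree_mset g \<longleftrightarrow> (\<forall>p. count g p \<le> 1)"

lemma squarefree_mset_over_eq_image:
  assumes "finite Z"
  shows "{g. squarefree_mset g \<and> set_mset g \<subseteq> Z} = mset_set ` Pow Z"
proof (intro equalityI subsetI)
  fix g assume g: "g \<in> {g. squarefree_mset g \<and> set_mset g \<subseteq> Z}"
  have "count g p = count (mset_set (set_mset g)) p" for p
  proof (cases "p \<in># g")
    case True
    hence "count g p > 0" by simp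
    moreover have "count g p \<le> 1" using g by (simp add: squarefree_mset_def)
    ultimately have "count g p = 1" by linarith
    thus ?thesis using True by simp
  qed (simp add: not_in_iff)
  hence "g = mset_set (set_mset g)" by (rule multiset_eqI)
  thus "g \<in> mset_set ` Pow Z" using g by blast
next
  fix g assume "g \<in> mset_set ` Pow Z"
  then obtain B where "B \<subseteq> Z" "g = mset_set B" by auto
  moreover have "finite B" using calculation assms finite_subset by blast
  ultimately show "g \<in> {g. squarefree_mset g \<and> set_mset g \<subseteq> Z}"
    by (auto simp: squarefree_mset_def count_mset_set')
qed

lemma inj_on_mset_set_Pow: "finite Z \<Longrightarrow> inj_on mset_set (Pow Z)"
  by (rule inj_onI) (metis PowD finite_set_mset_mset_set finite_subset)

lemma moebius_mset_set: "finite B \<Longrightarrow> moebius (mset_set B) = (-1) ^ card B"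
  by (auto simp: moebius_def count_mset_set')

lemma moebius_eq_0: "\<not> squarefree_mset g \<Longrightarrow> moebius g = 0"
  by (auto simp: moebius_def squarefree_mset_def)

text \<open>A finite Euler product: expanding the right side over \<open>Pow Z\<close> produces one
  term for each squarefree element. With \<open>\<phi> = 1\<close> it becomes Moebius inversion,
  with Dirichlet terms the Euler product of the inverse zeta function.\<close>

lemma sum_moebius_squarefree_over:
  fixes \<phi> :: "'p \<Rightarrow> complex"
  assumes "finite Z"
  shows "(\<Sum>g | squarefree_mset g \<and> set_mset g \<subseteq> Z. moebius g * prod_mset (image_mset \<phi> g))
         = (\<Prod>p\<in>Z. 1 - \<phi> p)"
proof -
  have "(\<Sum>g | squarefree_mset g \<and> set_mset g \<subseteq> Z. moebius g * prod_mset (image_mset \<phi> g))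
      = (\<Sum>B\<in>Pow Z. moebius (mset_set B) * prod_mset (image_mset \<phi> (mset_set B)))"
    using assms by (simp add: squarefree_mset_over_eq_image sum.reindex inj_on_mset_set_Pow)
  also have "\<dots> = (\<Sum>B\<in>Pow Z. (\<Prod>p\<in>B. - \<phi> p))"
  proof (rule sum.cong[OF refl])
    fix B assume "B \<in> Pow Z"
    hence "finite B" using assms finite_subset by blast
    thus "moebius (mset_set B) * prod_mset (image_mset \<phi> (mset_set B)) = (\<Prod>p\<in>B. - \<phi> p)"
      by (simp add: moebius_mset_set prod_uminus prod_unfold_prod_mset)
  qed
  also have "\<dots> = (\<Prod>p\<in>Z. - \<phi> p + 1)"
    using assms by (subst prod_add) simp_all
  finally show ?thesis by simp
qed

text \<open>Non-squarefree divisors contribute 0, and the squarefree ones correspond to subsets of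
  \<open>set_mset g \<inter> Z\<close>; what remains is a product of factors \<open>1 - 1\<close>,
  empty exactly when \<open>g\<close> has no prime in \<open>Z\<close>.\<close>

lemma sum_moebius_subset_over:
  assumes fin: "finite {h. h \<subseteq># g}"
  shows "(\<Sum>h | h \<subseteq># g \<and> (\<forall>p\<in>#h. p \<in> Z). moebius h) = (if set_mset g \<inter> Z = {} then 1 else 0)"
proof -
  let ?A = "{h. squarefree_mset h \<and> set_mset h \<subseteq> set_mset g \<inter> Z}"
  have sub: "h \<subseteq># g" if "h \<in> ?A" for h
  proof (rule mset_subset_eqI)
    fix p show "count h p \<le> count g p"
    proof (cases "p \<in># h")
      case True
      hence "p \<in># g" using that by auto
      hence "count g p > 0" by simp
      moreover have "count h p \<le> 1" using that by (simp add: squarefree_mset_def)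
      ultimately show ?thesis by linarith
    qed (simp add: not_in_iff)
  qed
  have "(\<Sum>h | h \<subseteq># g \<and> (\<forall>p\<in>#h. p \<in> Z). moebius h) = (\<Sum>h\<in>?A. moebius h)"
  proof (rule sum.mono_neutral_right)
    show "finite {h. h \<subseteq># g \<and> (\<forall>p\<in>#h. p \<in> Z)}"
      by (rule finite_subset[OF _ fin]) auto
    show "?A \<subseteq> {h. h \<subseteq># g \<and> (\<forall>p\<in>#h. p \<in> Z)}" using sub by auto
    show "\<forall>i\<in>{h. h \<subseteq># g \<and> (\<forall>p\<in>#h. p \<in> Z)} - ?A. moebius i = 0"
      using moebius_eq_0 set_mset_mono by blast
  qed
  also have "\<dots> = (\<Sum>h\<in>?A. moebius h * prod_mset (image_mset (\<lambda>_. 1) h))"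
    by simp
  also have "\<dots> = (\<Prod>p\<in>set_mset g \<inter> Z. 1 - 1)"
    by (rule sum_moebius_squarefree_over) auto
  also have "\<dots> = (if set_mset g \<inter> Z = {} then 1 else 0)" by auto
  finally show ?thesis .
qed

lemma filterlim_divide_const_at_top:
  "a > 0 \<Longrightarrow> filterlim (\<lambda>x::real. x / a) at_top at_top"
  by real_asymp

text \<open>Inverts one Euler factor: \<open>n\<close> iterations write \<open>G x\<close> as the
  sum of \<open>F (x / P ^ j)\<close> for \<open>j < n\<close> plus \<open>G (x / P ^ n)\<close>,
  and the linear bound makes the last term at most \<open>K * x / P ^ n\<close>. The later use is
  with \<open>P\<close> the norm of a prime that is removed from, or added to, the admissible
  primes.\<close>

lemma tendsto_0_of_shift_equation:
  fixes F G :: "real \<Rightarrow> complex"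
  assumes P: "P > 1" and bound: "\<And>x. x > 0 \<Longrightarrow> norm (G x) \<le> K * x"
    and eq: "\<And>x. G x = F x + G (x / P)"
    and F: "((\<lambda>x. F x / of_real x) \<longlongrightarrow> 0) at_top"
  shows "((\<lambda>x. G x / of_real x) \<longlongrightarrow> 0) at_top"
proof (rule tendstoI)
  fix e :: real assume e: "e > 0"
  define a where "a = 1 / P"
  have a: "0 < a" "a < 1" using P by (auto simp: a_def)
  \<comment> \<open>The geometric series with ratio \<open>a\<close> sums to at most
    \<open>1 / (1 - a)\<close>, so errors of size \<open>e' * x\<close> add up to at most
    \<open>e / 4 * x\<close>.\<close>
  define e' where "e' = e * (1 - a) / 4"
  have e': "e' > 0" using e a by (simp add: e'_def)
  have K: "K \<ge> 0" using order_trans[OF norm_ge_zero bound[of 1]] by simp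
  have "eventually (\<lambda>x. norm (F x) \<le> e' * x) at_top"
    using tendstoD[OF F e'] eventually_gt_at_top[of 0]
    by eventually_elim (auto simp: norm_divide field_simps)
  then obtain X0 where X0: "\<And>x. x \<ge> X0 \<Longrightarrow> norm (F x) \<le> e' * x" by (auto simp: eventually_at_top_linorder)
  define X where "X = max 1 X0"
  have X: "norm (F x) \<le> e' * x" if "x \<ge> X" for x using X0[of x] that by (simp add: X_def)
  have X1: "X \<ge> 1" by (simp add: X_def)
  \<comment> \<open>\<open>x \<ge> X * P ^ n\<close> keeps \<open>x / P ^ j\<close> above
    \<open>X\<close> for all \<open>j < n\<close>, so the bound on \<open>F\<close> applies at every
    step.\<close>
  have iter: "norm (G x) \<le> e' * x * (\<Sum>j<n. a ^ j) + K * x * a ^ n" if "x \<ge> X * P ^ n" for n x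
    using that
  proof (induction n arbitrary: x)
    case 0
    thus ?case using bound[of x] X1 by simp
  next
    case (Suc n)
    have "1 \<le> P ^ Suc n" using P by (intro one_le_power) auto
    hence "X * 1 \<le> X * P ^ Suc n" using X1 by (intro mult_left_mono) auto
    hence xX: "x \<ge> X" using Suc.prems by linarith
    have "x / P \<ge> X * P ^ n" using Suc.prems P by (simp add: field_simps)
    from Suc.IH[OF this] have IH: "norm (G (x / P)) \<le> e' * x * (a * (\<Sum>j<n. a ^ j)) + K * x * a ^ Suc n"
      by (simp add: a_def mult_ac)
    have "norm (G x) \<le> norm (F x) + norm (G (x / P))" unfolding eq[of x] by (rule norm_triangle_ineq)
    also have "\<dots> \<le> e' * x + (e' * x * (a * (\<Sum>j<n. a ^ j)) + K * x * a ^ Suc n)"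
      using X[OF xX] IH by linarith
    also have "\<dots> = e' * x * (\<Sum>j<Suc n. a ^ j) + K * x * a ^ Suc n"
      unfolding sum.lessThan_Suc_shift by (simp add: sum_distrib_left algebra_simps)
    finally show ?case .
  qed
  have "(\<lambda>n. K * a ^ n) \<longlonglongrightarrow> K * 0" using a by (intro tendsto_intros LIMSEQ_power_zero) auto
  hence "eventually (\<lambda>n. K * a ^ n < e / 4) sequentially" using e by (intro order_tendstoD(2)) auto
  then obtain n where n: "K * a ^ n < e / 4" by (auto simp: eventually_sequentially)
  show "eventually (\<lambda>x. dist (G x / of_real x) 0 < e) at_top"
    using eventually_ge_at_top[of "X * P ^ n"] eventually_gt_at_top[of 0]
  proof eventually_elim
    case (elim x)
    have "(\<Sum>j<n. a ^ j) = (1 - a ^ n) / (1 - a)" using a by (simp add: sum_gp_strict)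
    also have "\<dots> \<le> 1 / (1 - a)" using a by (intro divide_right_mono) auto
    finally have "e' * x * (\<Sum>j<n. a ^ j) \<le> e' * x * (1 / (1 - a))"
      using e' elim by (intro mult_left_mono) auto
    also have "\<dots> = e / 4 * x"
    proof -
      have "e * q / 4 * x * (1 / q) = e / 4 * x" if "q \<noteq> 0" for q using that by simp
      from this[of "1 - a"] show ?thesis using a unfolding e'_def by simp
    qed
    finally have "norm (G x) \<le> e / 4 * x + K * a ^ n * x" using iter[OF elim(1)] by (simp add: mult_ac)
    also have "K * a ^ n * x < e / 4 * x" using n elim by (intro mult_strict_right_mono)
    also have "e / 4 * x + e / 4 * x \<le> e * x" using e elim by simp
    finally show ?case using elim by (simp add: norm_divide field_simps)
  qed
qed

section \<open>Laplace integrals of exponentials\<close>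

lemma set_integrable_exp_minus:
  fixes k a :: real assumes k: "k > 0"
  shows "set_integrable lborel {a..} (\<lambda>u. exp (- k * u))"
    and "(LINT u:{a..}|lborel. exp (- k * u)) = exp (- k * a) / k"
proof -
  have "(\<integral>\<^sup>+u. ennreal (exp (- k * u)) * indicator {a..} u \<partial>lborel) = ennreal (0 - (- exp (- k * a) / k))"
  proof (rule nn_integral_FTC_atLeast)
    show "((\<lambda>u. - exp (- k * u) / k) \<longlongrightarrow> 0) at_top" using k by real_asymp
  qed (use k in \<open>auto intro!: derivative_eq_intros\<close>)
  hence nn: "(\<integral>\<^sup>+u. ennreal (indicator {a..} u * exp (- k * u)) \<partial>lborel) = ennreal (exp (- k * a) / k)"
    by (subst nn_integral_cong[where v = "\<lambda>u. ennreal (exp (- k * u)) * indicator {a..} u"])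
       (auto simp: indicator_def)
  have "has_bochner_integral lborel (\<lambda>u. indicator {a..} u * exp (- k * u)) (exp (- k * a) / k)"
    by (rule has_bochner_integral_nn_integral[OF _ _ _ nn]) (use k in auto)
  thus "set_integrable lborel {a..} (\<lambda>u. exp (- k * u))"
    and "(LINT u:{a..}|lborel. exp (- k * u)) = exp (- k * a) / k"
    by (auto simp: set_integrable_def set_lebesgue_integral_def has_bochner_integral_iff)
qed

lemma set_integrable_ident_exp_minus:
  fixes k :: real assumes k: "k > 0"
  shows "set_integrable lborel {0..} (\<lambda>u. u * exp (- k * u))"
proof -
  have "(\<integral>\<^sup>+u. ennreal (u * exp (- k * u)) * indicator {0..} u \<partial>lborel)
      = ennreal (0 - (- (1 / k^2) * exp (- k * 0)  - 0 / k * exp (- k * 0)))"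
  proof (rule nn_integral_FTC_atLeast[where F = "\<lambda>u. - (1 / k^2) * exp (- k * u) - u / k * exp (- k * u)"])
    show "((\<lambda>u. - (1 / k^2) * exp (- k * u) - u / k * exp (- k * u)) \<longlongrightarrow> 0) at_top" using k by real_asymp
    show "((\<lambda>u. - (1 / k^2) * exp (- k * u) - u / k * exp (- k * u)) has_real_derivative x * exp (- k * x)) (at x)" for x
      using k by (auto intro!: derivative_eq_intros simp: field_simps power2_eq_square)
  qed (use k in auto)
  hence nn: "(\<integral>\<^sup>+u. ennreal (indicator {0..} u * (u * exp (- k * u))) \<partial>lborel) = ennreal (1 / k^2)"
    by (subst nn_integral_cong[where v = "\<lambda>u. ennreal (u * exp (- k * u)) * indicator {0..} u"])
       (auto simp: indicator_def)
  have "has_bochner_integral lborel (\<lambda>u. indicator {0..} u * (u * exp (- k * u))) (1 / k^2)"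
    by (rule has_bochner_integral_nn_integral[OF _ _ _ nn]) (use k in \<open>auto simp: indicator_def\<close>)
  thus ?thesis by (auto simp: set_integrable_def has_bochner_integral_iff)
qed

lemma set_integrable_exp_minus_complex:
  fixes s :: complex and a :: real assumes s: "Re s > 0"
  shows "set_integrable lborel {a..} (\<lambda>u. exp (- s * of_real u))"
proof (rule set_integrable_bound[OF set_integrable_exp_minus(1)[OF s, of a]])
  show "set_borel_measurable lborel {a..} (\<lambda>u. exp (- s * of_real u))"
    unfolding set_borel_measurable_def by simp
qed auto

lemma integral_exp_minus_complex:
  fixes s :: complex and a :: real assumes s: "Re s > 0"
  shows "(LINT u:{a..}|lborel. exp (- s * of_real u)) = exp (- s * of_real a) / s"
proof -
  have s0: "s \<noteq> 0" using s by auto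
  have "(LBINT u=ereal a..\<infinity>. exp (- s * of_real u)) = 0 - (- exp (- s * of_real a) / s)"
  proof (rule interval_integral_FTC_integrable)
    fix x :: real
    show "((\<lambda>u. - exp (- s * of_real u) / s) has_vector_derivative exp (- s * of_real x)) (at x)"
      using s0 by (auto intro!: derivative_eq_intros has_vector_derivative_real_field)
    show "isCont (\<lambda>u. exp (- s * of_real u)) x" by (intro continuous_intros)
  next
    have "set_integrable lborel {a..} (\<lambda>u. exp (- s * of_real u))"
      by (rule set_integrable_exp_minus_complex[OF s])
    thus "set_integrable lborel (einterval (ereal a) \<infinity>) (\<lambda>u. exp (- s * of_real u))"
      by (rule set_integrable_subset) (auto simp: einterval_def)
  next
    have "((\<lambda>u. - exp (- s * of_real u) / s) \<longlongrightarrow> - exp (- s * of_real a) / s) (at a within {a<..})"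
      by (intro tendsto_intros s0)
    thus "(((\<lambda>u. - exp (- s * of_real u) / s) \<circ> real_of_ereal) \<longlongrightarrow> - exp (- s * of_real a) / s) (at_right (ereal a))"
      by (simp add: ereal_tendsto_simps)
    have "((\<lambda>u. norm (- exp (- s * of_real u) / s)) \<longlongrightarrow> 0) at_top"
    proof -
      have "((\<lambda>u. exp (- Re s * u) / norm s) \<longlongrightarrow> 0) at_top" using s s0 by real_asymp
      thus ?thesis by (simp add: norm_divide)
    qed
    hence "((\<lambda>u. - exp (- s * of_real u) / s) \<longlongrightarrow> 0) at_top"
      by (rule tendsto_norm_zero_cancel)
    thus "(((\<lambda>u. - exp (- s * of_real u) / s) \<circ> real_of_ereal) \<longlongrightarrow> 0) (at_left \<infinity>)"
      by (simp add: ereal_tendsto_simps)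
  qed auto
  hence 1: "(LINT u:{a<..}|lborel. exp (- s * of_real u)) = exp (- s * of_real a) / s"
    by (simp add: interval_integral_to_infinity_eq)
  have "(LINT u:{a..}|lborel. exp (- s * of_real u)) = (LINT u:{a<..}|lborel. exp (- s * of_real u))"
  proof (rule set_integral_cong_set)
    have "AE x in lborel. x \<noteq> a" by (rule AE_lborel_singleton)
    thus "AE x in lborel. (x \<in> {a<..}) = (x \<in> {a..})" by eventually_elim auto
  qed (auto simp: set_borel_measurable_def)
  thus ?thesis using 1 by simp
qed

text \<open>The left half plane is convex and the derivative of \<open>exp\<close> has norm at most
  1 there. This later makes a Laplace transform Lipschitz up to the boundary.\<close>

lemma norm_exp_diff_le:
  fixes a b :: complex assumes "Re a \<le> 0" "Re b \<le> 0"
  shows "norm (exp a - exp b) \<le> norm (a - b)"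
proof -
  have "norm (exp a - exp b) \<le> 1 * norm (a - b)"
  proof (rule field_differentiable_bound[of "{z. Re z \<le> 0}"])
    show "convex {z. Re z \<le> 0}" by (rule convex_halfspace_Re_le)
    show "(exp has_field_derivative exp z) (at z within {z. Re z \<le> 0})" for z
      by (auto intro!: derivative_eq_intros)
  qed (use assms in auto)
  thus ?thesis by simp
qed

text \<open>The inequality behind the non-vanishing of zeta on the line of real part 1: it comes from
  \<open>3 + 4 cos \<theta> + cos 2\<theta> = 2 (1 + cos \<theta>)\<^sup>2\<close> applied to each term of the logarithm series.\<close>

lemma three_four_one:
  fixes r :: real and w :: complex
  assumes r: "0 < r" "r < 1" and w: "norm w = 1"
  shows "norm (1 - complex_of_real r) ^ 3 * norm (1 - of_real r * w) ^ 4 * norm (1 - of_real r * w\<^sup>2) \<le> 1"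
proof -
  \<comment> \<open>The term \<open>n = 0\<close> vanishes because division by 0 gives 0, so this is
    the usual logarithm series starting at 1.\<close>
  have ser: "(\<lambda>n. - Re (v ^ n) / of_nat n) sums ln (norm (1 - v))" if "norm v < 1" for v :: complex
  proof -
    have "(\<lambda>n. - (v ^ n) / of_nat n) sums ln (1 - v)"
      using Ln_series'[of "- v"] that by simp
    hence "(\<lambda>n. Re (- (v ^ n) / of_nat n)) sums Re (ln (1 - v))" by (rule sums_Re)
    moreover have "1 - v \<noteq> 0" using that by auto
    ultimately show ?thesis by (simp add: Re_divide_of_nat)
  qed
  have n1: "norm (complex_of_real r) < 1" "norm (of_real r * w) < 1" "norm (of_real r * w\<^sup>2) < 1"
    using r w by (auto simp: norm_mult norm_power)
  define x where "x = norm (1 - complex_of_real r)"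
  define y where "y = norm (1 - of_real r * w)"
  define z where "z = norm (1 - of_real r * w\<^sup>2)"
  have "1 \<noteq> complex_of_real r" "1 \<noteq> of_real r * w" "1 \<noteq> of_real r * w\<^sup>2"
    using n1 by (metis norm_one less_irrefl)+
  hence pos: "x > 0" "y > 0" "z > 0" by (auto simp: x_def y_def z_def)
  have S: "(\<lambda>n. 3 * (- Re (complex_of_real r ^ n) / of_nat n) + 4 * (- Re ((of_real r * w) ^ n) / of_nat n)
      + (- Re ((of_real r * w\<^sup>2) ^ n) / of_nat n)) sums (3 * ln x + 4 * ln y + ln z)"
    unfolding x_def y_def z_def by (intro sums_add sums_mult ser n1)
  have neg: "3 * (- Re (complex_of_real r ^ n) / of_nat n) + 4 * (- Re ((of_real r * w) ^ n) / of_nat n)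
      + (- Re ((of_real r * w\<^sup>2) ^ n) / of_nat n) \<le> 0" for n
  proof -
    define q where "q = w ^ n"
    have "(Re q)\<^sup>2 + (Im q)\<^sup>2 = 1"
      using w by (simp add: q_def norm_power flip: cmod_power2)
    hence re: "Re (q\<^sup>2) = 2 * (Re q)\<^sup>2 - 1" by (simp add: power2_eq_square)
    have e1: "Re (complex_of_real r ^ n) = r ^ n"
      by (metis Re_complex_of_real of_real_power)
    have e2: "Re ((of_real r * w) ^ n) = r ^ n * Re q"
      unfolding q_def power_mult_distrib of_real_power[symmetric] by simp
    have e3: "Re ((of_real r * w\<^sup>2) ^ n) = r ^ n * Re (q\<^sup>2)"
    proof -
      have "(w\<^sup>2) ^ n = q\<^sup>2" unfolding q_def by (metis mult.commute power_mult)
      thus ?thesis unfolding power_mult_distrib of_real_power[symmetric] by simp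
    qed
    have "3 * (- Re (complex_of_real r ^ n) / of_nat n) + 4 * (- Re ((of_real r * w) ^ n) / of_nat n)
      + (- Re ((of_real r * w\<^sup>2) ^ n) / of_nat n) = - (r ^ n * (2 * (1 + Re q)\<^sup>2)) / of_nat n"
      unfolding e1 e2 e3 re by (cases "n = 0") (auto simp: field_simps power2_eq_square)
    also have "\<dots> \<le> 0" using r by (simp add: divide_nonpos_nonneg)
    finally show ?thesis .
  qed
  have "3 * ln x + 4 * ln y + ln z \<le> 0"
    using sums_le[OF neg S sums_zero] by simp
  hence "ln (x ^ 3 * y ^ 4 * z) \<le> 0"
    using pos by (simp add: ln_mult ln_realpow)
  hence "x ^ 3 * y ^ 4 * z \<le> 1" using pos by (subst (asm) ln_le_zero_iff) auto
  thus ?thesis by (simp add: x_def y_def z_def)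
qed

section \<open>A Tauberian theorem with the Fejer kernel\<close>

text \<open>The triangle function on \<open>{-r..r}\<close>. Its compact support restricts the
  boundary values of a Laplace transform to a bounded interval, and its Fourier integral
  \<open>fejer r\<close> is nonnegative and integrable.\<close>

definition fejer_hat :: "real \<Rightarrow> real \<Rightarrow> real" where
  "fejer_hat r t = max 0 (1 - \<bar>t\<bar> / r)"

text \<open>At \<open>w = 0\<close> this is the junk value \<open>0\<close> instead of \<open>r\<close>, which no integral notices.\<close>

definition fejer :: "real \<Rightarrow> real \<Rightarrow> real" where
  "fejer r w = 2 * (1 - cos (r * w)) / (r * w\<^sup>2)"

lemma fejer_nonneg: "r > 0 \<Longrightarrow> fejer r w \<ge> 0"
  by (simp add: fejer_def)

lemma fejer_measurable [measurable]: "fejer r \<in> borel_measurable borel"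
  unfolding fejer_def by measurable

lemma fejer_hat_measurable [measurable]: "fejer_hat r \<in> borel_measurable borel"
  unfolding fejer_hat_def by measurable

lemma continuous_fejer_hat: "r > 0 \<Longrightarrow> continuous_on A (fejer_hat r)"
  unfolding fejer_hat_def by (intro continuous_intros) auto

lemma fejer_hat_bounds: "r > 0 \<Longrightarrow> 0 \<le> fejer_hat r t" "r > 0 \<Longrightarrow> fejer_hat r t \<le> indicator {-r..r} t"
  by (auto simp: fejer_hat_def indicator_def field_simps abs_le_iff)

lemma fejer_hat_eq_0: "r > 0 \<Longrightarrow> \<bar>t\<bar> \<ge> r \<Longrightarrow> fejer_hat r t = 0"
  by (auto simp: fejer_hat_def field_simps)

lemma fejer_hat_integrable: "r > 0 \<Longrightarrow> integrable lborel (fejer_hat r)"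
  by (rule Bochner_Integration.integrable_bound[of _ "indicator {-r..r} :: real \<Rightarrow> real"])
     (use fejer_hat_bounds in \<open>auto intro!: AE_I2 simp: indicator_def\<close>)

lemma has_bochner_integral_fejer:
  assumes r: "r > 0" and w: "w \<noteq> 0"
  shows "has_bochner_integral lborel (\<lambda>t. fejer_hat r t *\<^sub>R exp (\<i> * of_real (t * w))) (of_real (fejer r w))"
proof -
  define q where "q = \<i> * of_real w"
  have q0: "q \<noteq> 0" using w by (simp add: q_def)
  \<comment> \<open>\<open>F1\<close> and \<open>F2\<close> are antiderivatives on the two halves of
    the triangle. Their terms \<open>1 / q\<close> at 0 cancel, which leaves
    \<open>exp (r * q) + exp (- r * q) - 2\<close> over \<open>r * q\<^sup>2\<close>.\<close>
  define F1 where "F1 = (\<lambda>t::real. (1 - of_real t / of_real r) * exp (of_real t * q) / q + exp (of_real t * q) / (of_real r * q\<^sup>2))"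
  define F2 where "F2 = (\<lambda>t::real. (1 + of_real t / of_real r) * exp (of_real t * q) / q - exp (of_real t * q) / (of_real r * q\<^sup>2))"
  define f1 where "f1 = (\<lambda>t::real. (1 - of_real t / of_real r) * exp (of_real t * q))"
  define f2 where "f2 = (\<lambda>t::real. (1 + of_real t / of_real r) * exp (of_real t * q))"
  have 1: "has_bochner_integral lborel (\<lambda>t. indicator {0..r} t *\<^sub>R f1 t) (F1 r - F1 0)"
  proof (rule has_bochner_integral_FTC_Icc)
    show "continuous_on {0..r} f1" unfolding f1_def using r by (intro continuous_intros) auto
    fix t :: real
    have "((\<lambda>z. (1 - z / of_real r) * exp (z * q) / q + exp (z * q) / (of_real r * q\<^sup>2)) has_field_derivative f1 t) (at (of_real t))"
      unfolding f1_def using q0 r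
      by (auto intro!: derivative_eq_intros simp: field_simps power2_eq_square)
    thus "(F1 has_vector_derivative f1 t) (at t within {0..r})"
      unfolding F1_def by (rule has_vector_derivative_real_field[THEN has_vector_derivative_at_within])
  qed (use r in auto)
  have 2: "has_bochner_integral lborel (\<lambda>t. indicator {-r..0} t *\<^sub>R f2 t) (F2 0 - F2 (-r))"
  proof (rule has_bochner_integral_FTC_Icc)
    show "continuous_on {-r..0} f2" unfolding f2_def using r by (intro continuous_intros) auto
    fix t :: real
    have "((\<lambda>z. (1 + z / of_real r) * exp (z * q) / q - exp (z * q) / (of_real r * q\<^sup>2)) has_field_derivative f2 t) (at (of_real t))"
      unfolding f2_def using q0 r
      by (auto intro!: derivative_eq_intros simp: field_simps power2_eq_square)
    thus "(F2 has_vector_derivative f2 t) (at t within {-r..0})"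
      unfolding F2_def by (rule has_vector_derivative_real_field[THEN has_vector_derivative_at_within])
  qed (use r in auto)
  have val: "F1 r - F1 0 + (F2 0 - F2 (-r)) = of_real (fejer r w)"
  proof -
    have "exp (of_real r * q) + exp (of_real (-r) * q) = 2 * of_real (cos (r * w))"
      unfolding q_def by (simp add: cos_exp_eq mult_ac flip: cos_of_real)
    hence e: "exp (of_real (-r) * q) = 2 * of_real (cos (r * w)) - exp (of_real r * q)"
      by (simp add: algebra_simps)
    have q2: "q\<^sup>2 = - of_real (w\<^sup>2)" by (simp add: q_def power_mult_distrib)
    have "F1 r - F1 0 + (F2 0 - F2 (-r)) = (exp (of_real r * q) + exp (of_real (-r) * q) - 2) / (of_real r * q\<^sup>2)"
      using r q0 by (simp add: F1_def F2_def diff_divide_distrib add_divide_distrib)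
    also have "\<dots> = of_real (fejer r w)"
      unfolding e q2 fejer_def using r w by (simp add: field_simps)
    finally show ?thesis .
  qed
  \<comment> \<open>Both half intervals contain 0, where the two pieces add up to twice the
    triangle, so equality holds only almost everywhere.\<close>
  have "AE t in lborel. indicator {0..r} t *\<^sub>R f1 t + indicator {-r..0} t *\<^sub>R f2 t
      = fejer_hat r t *\<^sub>R exp (\<i> * of_real (t * w))"
    using AE_lborel_singleton[of 0]
  proof eventually_elim
    case (elim t)
    have ex: "exp (\<i> * of_real (t * w)) = exp (of_real t * q)" by (simp add: q_def mult_ac)
    have f12: "f1 t = (1 - t / r) *\<^sub>R exp (of_real t * q)" "f2 t = (1 + t / r) *\<^sub>R exp (of_real t * q)"
      by (simp_all add: f1_def f2_def scaleR_conv_of_real)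
    consider "t > r" | "0 < t" "t \<le> r" | "t < - r" | "- r \<le> t" "t < 0" using elim r by linarith
    thus ?case
    proof cases
      case 2
      hence "fejer_hat r t = 1 - t / r" using r by (simp add: fejer_hat_def field_simps)
      thus ?thesis using 2 unfolding ex f12 by simp
    next
      case 4
      hence "fejer_hat r t = 1 + t / r" using r by (simp add: fejer_hat_def field_simps)
      thus ?thesis using 4 unfolding ex f12 by simp
    qed (use r in \<open>simp_all add: fejer_hat_eq_0\<close>)
  qed
  hence "has_bochner_integral lborel (\<lambda>t. indicator {0..r} t *\<^sub>R f1 t + indicator {-r..0} t *\<^sub>R f2 t) (of_real (fejer r w))
     \<longleftrightarrow> has_bochner_integral lborel (\<lambda>t. fejer_hat r t *\<^sub>R exp (\<i> * of_real (t * w))) (of_real (fejer r w))"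
    by (intro has_bochner_integral_cong_AE) (auto simp: f1_def f2_def)
  thus ?thesis using has_bochner_integral_add[OF 1 2] val by simp
qed

section \<open>Size and mass of the Fejer kernel\<close>

lemma has_bochner_integral_inverse_square_right:
  assumes d: "d > (0::real)"
  shows "has_bochner_integral lborel (\<lambda>w. indicator {d..} w * (1 / w\<^sup>2)) (1 / d)"
proof -
  have "(\<integral>\<^sup>+u. ennreal (1 / u\<^sup>2) * indicator {d..} u \<partial>lborel) = ennreal (0 - (- (1 / d)))"
  proof (rule nn_integral_FTC_atLeast)
    show "((\<lambda>u::real. - (1 / u)) \<longlongrightarrow> 0) at_top" by real_asymp
    show "((\<lambda>u. - (1 / u)) has_real_derivative 1 / x\<^sup>2) (at x)" if "d \<le> x" for x
      using d that by (auto intro!: derivative_eq_intros simp: power2_eq_square)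
  qed (use d in auto)
  hence nn: "(\<integral>\<^sup>+u. ennreal (indicator {d..} u * (1 / u\<^sup>2)) \<partial>lborel) = ennreal (1 / d)"
    by (subst nn_integral_cong[where v = "\<lambda>u. ennreal (1 / u\<^sup>2) * indicator {d..} u"])
       (auto simp: indicator_def)
  show ?thesis
    by (rule has_bochner_integral_nn_integral[OF _ _ _ nn]) (use d in auto)
qed

lemma has_bochner_integral_inverse_square:
  assumes d: "d > (0::real)"
  shows "has_bochner_integral lborel (\<lambda>w. indicator {w. \<bar>w\<bar> \<ge> d} w * (1 / w\<^sup>2)) (2 / d)"
proof -
  note 1 = has_bochner_integral_inverse_square_right[OF d]
  have "has_bochner_integral lborel (\<lambda>w. indicator {d..} (0 + (-1) * w) * (1 / (0 + (-1) * w)\<^sup>2)) ((1 / d) /\<^sub>R \<bar>-1\<bar>)"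
    using lborel_has_bochner_integral_real_affine_iff[of "-1" "\<lambda>w. indicator {d..} w * (1 / w\<^sup>2)" "1 / d" 0] 1 by simp
  from has_bochner_integral_add[OF 1 this] d
  have "has_bochner_integral lborel (\<lambda>w. indicator {d..} w * (1 / w\<^sup>2) + indicator {d..} (0 + (-1) * w) * (1 / (0 + (-1) * w)\<^sup>2)) (2 / d)"
    by simp
  also have "(\<lambda>w. indicator {d..} w * (1 / w\<^sup>2) + indicator {d..} (0 + (-1) * w) * (1 / (0 + (-1) * w)\<^sup>2))
     = (\<lambda>w. indicator {w. \<bar>w\<bar> \<ge> d} w * (1 / w\<^sup>2))"
    using d by (auto simp: fun_eq_iff indicator_def)
  finally show ?thesis .
qed

lemma fejer_le: "r > 0 \<Longrightarrow> fejer r w \<le> 4 / r * (1 / w\<^sup>2)"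
proof -
  assume r: "r > 0"
  have "1 - cos y \<le> 2" for y :: real by (smt (verit) cos_ge_minus_one)
  hence "2 * (1 - cos (r * w)) \<le> 2 * 2" by (rule mult_left_mono) simp
  hence "2 * (1 - cos (r * w)) \<le> 4" by simp
  hence "2 * (1 - cos (r * w)) / (r * w\<^sup>2) \<le> 4 / (r * w\<^sup>2)" using r by (intro divide_right_mono) auto
  thus ?thesis by (simp add: fejer_def)
qed

lemma one_minus_cos_le: "1 - cos x \<le> (x::real)\<^sup>2 / 2"
proof -
  have "1 - cos x = 2 * (sin (x / 2))\<^sup>2" using cos_double_sin[of "x / 2"] by simp
  also have "(sin (x / 2))\<^sup>2 \<le> (x / 2)\<^sup>2" using abs_sin_x_le_abs_x[of "x / 2"] by (metis abs_le_square_iff)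
  finally show ?thesis by (simp add: power2_eq_square)
qed

text \<open>As \<open>1 < pi / 3\<close>, cosine is at least 1/2 on the interval; integrating gives
  \<open>sin y \<ge> y / 2\<close>, and integrating again gives the claim.\<close>

lemma one_minus_cos_ge:
  assumes "0 \<le> x" "x \<le> (1::real)"
  shows "x\<^sup>2 / 4 \<le> 1 - cos x"
proof -
  have s: "sin y \<ge> y / 2" if "0 \<le> y" "y \<le> 1" for y :: real
  proof -
    have "sin 0 - 0 / 2 \<le> sin y - y / 2"
    proof (rule DERIV_nonneg_imp_nondecreasing[OF that(1)])
      fix u :: real assume u: "0 \<le> u" "u \<le> y"
      have "u \<le> pi / 3" using u that pi_gt3 by linarith
      hence "cos (pi / 3) \<le> cos u" using u pi_gt_zero by (intro cos_monotone_0_pi_le) auto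
      thus "\<exists>D. ((\<lambda>y. sin y - y / 2) has_real_derivative D) (at u) \<and> 0 \<le> D"
        by (intro exI[of _ "cos u - 1 / 2"]) (auto intro!: derivative_eq_intros simp: cos_60)
    qed
    thus ?thesis by simp
  qed
  have "1 - cos 0 - 0\<^sup>2 / 4 \<le> 1 - cos x - x\<^sup>2 / 4"
  proof (rule DERIV_nonneg_imp_nondecreasing[OF assms(1)])
    fix u :: real assume u: "0 \<le> u" "u \<le> x"
    thus "\<exists>D. ((\<lambda>y. 1 - cos y - y\<^sup>2 / 4) has_real_derivative D) (at u) \<and> 0 \<le> D"
      using s[of u] assms
      by (intro exI[of _ "sin u - u / 2"]) (auto intro!: derivative_eq_intros)
  qed
  thus ?thesis by simp
qed

lemma fejer_le_const: "r > 0 \<Longrightarrow> fejer r w \<le> r"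
proof (cases "w = 0")
  case False
  assume r: "r > 0"
  have "2 * (1 - cos (r * w)) \<le> (r * w)\<^sup>2" using one_minus_cos_le[of "r * w"] by simp
  also have "\<dots> = r * (r * w\<^sup>2)" by (simp add: power2_eq_square)
  finally show ?thesis unfolding fejer_def using r False by (subst pos_divide_le_eq) auto
qed (simp add: fejer_def)

lemma fejer_integrable:
  assumes r: "r > 0"
  shows "integrable lborel (fejer r)"
proof (rule Bochner_Integration.integrable_bound)
  show "integrable lborel (\<lambda>w. r * indicator {-1..1} w + 4 / r * (indicator {w. \<bar>w\<bar> \<ge> 1} w * (1 / w\<^sup>2)))"
    using has_bochner_integral_inverse_square[of 1]
    by (intro Bochner_Integration.integrable_add integrable_mult_right) (auto simp: has_bochner_integral_iff)
  show "AE w in lborel. norm (fejer r w) \<le> norm (r * indicator {-1..1} w + 4 / r * (indicator {w. \<bar>w\<bar> \<ge> 1} w * (1 / w\<^sup>2)))"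
  proof (rule AE_I2)
    fix w :: real
    show "norm (fejer r w) \<le> norm (r * indicator {-1..1} w + 4 / r * (indicator {w. \<bar>w\<bar> \<ge> 1} w * (1 / w\<^sup>2)))"
    proof (cases "\<bar>w\<bar> \<ge> 1")
      case True
      have "norm (fejer r w) \<le> 0 + 4 / r * (1 / w\<^sup>2)" using fejer_le[OF r] fejer_nonneg[OF r] by simp
      also have "\<dots> \<le> r * indicator {-1..1} w + 4 / r * (1 / w\<^sup>2)" using r by (intro add_right_mono) auto
      finally show ?thesis using True by simp
    next
      case False
      hence "w \<in> {-1..1}" by auto
      hence "indicator {-1..1} w = (1::real)" by (rule indicator_simps(1))
      thus ?thesis using fejer_le_const[OF r, of w] fejer_nonneg[OF r, of w] False r by auto
    qed
  qed
qed measurable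

text \<open>The exact value is \<open>2 * pi\<close>, but any positive lower bound independent of
  \<open>r\<close> suffices. On \<open>{0<..1/r}\<close> the kernel is at least
  \<open>r / 2\<close>.\<close>

lemma integral_fejer_ge:
  assumes r: "r > 0"
  shows "(LINT w|lborel. fejer r w) \<ge> 1 / 2"
proof -
  have "(1 / r) * (r / 2) = (LINT w|lborel. indicator {0<..1/r} w * (r / 2))"
    using r by simp
  also have "\<dots> \<le> (LINT w|lborel. fejer r w)"
  proof (rule integral_mono[OF _ fejer_integrable[OF r]])
    show "integrable lborel (\<lambda>w. indicator {0<..1/r} w * (r / 2))"
      using r by (intro integrable_mult_left) auto
    fix w :: real
    show "indicator {0<..1/r} w * (r / 2) \<le> fejer r w"
    proof (cases "w \<in> {0<..1/r}")
      case True
      hence "(r * w)\<^sup>2 / 4 \<le> 1 - cos (r * w)"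
        using r by (intro one_minus_cos_ge) (auto simp: field_simps)
      thus ?thesis using True r by (simp add: fejer_def field_simps power2_eq_square)
    qed (use fejer_nonneg[OF r] in auto)
  qed
  finally show ?thesis using r by simp
qed

text \<open>Translation by \<open>pi / v\<close> changes the sign of the exponential. Twice the
  integral is therefore an integral of \<open>h t - h (pi / v + t)\<close>, which is small by
  uniform continuity and lives on a bounded interval.\<close>

lemma riemann_lebesgue_compact_support:
  fixes h :: "real \<Rightarrow> complex"
  assumes cont: "continuous_on UNIV h" and supp: "\<And>t. \<bar>t\<bar> \<ge> r \<Longrightarrow> h t = 0" and r: "r > 0"
  shows "((\<lambda>v. LINT t|lborel. h t * exp (\<i> * of_real (t * v))) \<longlongrightarrow> 0) at_top"
proof -
  have hm [measurable]: "h \<in> borel_measurable borel" using cont by (rule borel_measurable_continuous_onI)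
  obtain M where M: "\<And>t. norm (h t) \<le> M"
  proof -
    have "compact (h ` {-r..r})" by (rule compact_continuous_image) (auto intro: continuous_on_subset[OF cont])
    then obtain M where "\<And>t. t \<in> {-r..r} \<Longrightarrow> norm (h t) \<le> M" by (meson bounded_iff compact_imp_bounded imageI)
    moreover have "h t = 0" if "t \<notin> {-r..r}" for t by (rule supp) (use that in auto)
    ultimately have "norm (h t) \<le> max M 0" for t
      by (cases "t \<in> {-r..r}") (auto simp: le_max_iff_disj)
    thus ?thesis by (rule that)
  qed
  have hint: "integrable lborel (\<lambda>t. h t * exp (\<i> * of_real (t * v)))" for v :: real
  proof (rule Bochner_Integration.integrable_bound[of _ "\<lambda>t. M * indicator {-r..r} t"])
    show "integrable lborel (\<lambda>t. M * indicator {-r..r} t)"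
      by (intro integrable_mult_right integrable_real_indicator) (use r in auto)
    show "AE t in lborel. norm (h t * exp (\<i> * of_real (t * v))) \<le> norm (M * indicator {-r..r} t)"
    proof (rule AE_I2)
      fix t :: real
      have "M \<ge> 0" using M[of 0] norm_ge_zero order_trans by blast
      thus "norm (h t * exp (\<i> * of_real (t * v))) \<le> norm (M * indicator {-r..r} t)"
        using M[of t] supp[of t] by (cases "\<bar>t\<bar> \<ge> r") (auto simp: norm_mult indicator_def)
    qed
  qed auto
  \<comment> \<open>The margin \<open>pi\<close> leaves room for the translation, which is at most
    \<open>pi\<close> once \<open>v \<ge> 1\<close>.\<close>
  have ucont: "uniformly_continuous_on {-r-pi..r+pi} h"
    by (rule compact_uniformly_continuous) (auto intro: continuous_on_subset[OF cont])
  show ?thesis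
  proof (rule tendstoI)
    fix e :: real assume e: "e > 0"
    define e' where "e' = e / (r + pi) / 2"
    have e': "e' > 0" using e r by (simp add: e'_def add_pos_pos)
    obtain d where d: "d > 0" "\<And>s t. s \<in> {-r-pi..r+pi} \<Longrightarrow> t \<in> {-r-pi..r+pi} \<Longrightarrow> \<bar>s - t\<bar> < d \<Longrightarrow> norm (h s - h t) < e'"
      using ucont e' unfolding uniformly_continuous_on_def dist_norm real_norm_def by (metis dist_norm)
    have "eventually (\<lambda>v. v \<ge> 1 \<and> pi / v < d) at_top"
    proof -
      have "eventually (\<lambda>v. pi / v < d) at_top" using d(1) by real_asymp
      thus ?thesis using eventually_ge_at_top[of 1] by eventually_elim auto
    qed
    thus "eventually (\<lambda>v. dist (LINT t|lborel. h t * exp (\<i> * of_real (t * v))) 0 < e) at_top"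
    proof eventually_elim
      case (elim v)
      define p where "p = pi / v"
      have p: "0 < p" "p \<le> pi" "p < d" using elim by (auto simp: p_def field_simps)
      define I where "I = (LINT t|lborel. h t * exp (\<i> * of_real (t * v)))"
      have "I = (LINT t|lborel. h (p + 1 * t) * exp (\<i> * of_real ((p + 1 * t) * v)))"
        unfolding I_def using lborel_integral_real_affine[of 1 "\<lambda>t. h t * exp (\<i> * of_real (t * v))" p] by simp
      also have "\<dots> = (LINT t|lborel. - (h (p + t) * exp (\<i> * of_real (t * v))))"
      proof (rule Bochner_Integration.integral_cong[OF refl])
        fix t :: real
        have "\<i> * of_real ((p + 1 * t) * v) = \<i> * of_real pi + \<i> * of_real (t * v)"
          using elim by (simp add: p_def field_simps)
        hence "exp (\<i> * of_real ((p + 1 * t) * v)) = - exp (\<i> * of_real (t * v))"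
          by (simp only: exp_add exp_pi_i)  simp
        thus "h (p + 1 * t) * exp (\<i> * of_real ((p + 1 * t) * v)) = - (h (p + t) * exp (\<i> * of_real (t * v)))"
          by simp
      qed
      finally have I2: "I = - (LINT t|lborel. h (p + t) * exp (\<i> * of_real (t * v)))" by simp
      have shint: "integrable lborel (\<lambda>t. h (p + t) * exp (\<i> * of_real (t * v)))"
      proof -
        have "integrable lborel (\<lambda>t. h (p + 1 * t) * exp (\<i> * of_real ((p + 1 * t) * v)))"
          using lborel_integrable_real_affine[OF hint[of v], of 1 p] by simp
        hence "integrable lborel (\<lambda>t. exp (- (\<i> * of_real (p * v))) * (h (p + 1 * t) * exp (\<i> * of_real ((p + 1 * t) * v))))"
          by (rule integrable_mult_right)
        moreover have "exp (- (\<i> * of_real (p * v))) * (h (p + 1 * t) * exp (\<i> * of_real ((p + 1 * t) * v)))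
            = h (p + t) * exp (\<i> * of_real (t * v))" for t
          by (simp add: algebra_simps flip: exp_add)
        ultimately show ?thesis by (simp only:)
      qed
      have "2 * I = I - (LINT t|lborel. h (p + t) * exp (\<i> * of_real (t * v)))" using I2 by simp
      also have "\<dots> = (LINT t|lborel. h t * exp (\<i> * of_real (t * v)) - h (p + t) * exp (\<i> * of_real (t * v)))"
        unfolding I_def by (rule Bochner_Integration.integral_diff[symmetric, OF hint shint])
      finally have I3: "2 * I = (LINT t|lborel. h t * exp (\<i> * of_real (t * v)) - h (p + t) * exp (\<i> * of_real (t * v)))" .
      have "norm (2 * I) \<le> (LINT t|lborel. indicator {-r-pi..r} t * e')"
        unfolding I3
      proof (rule Bochner_Integration.integral_norm_bound_integral)
        show "integrable lborel (\<lambda>t. h t * exp (\<i> * of_real (t * v)) - h (p + t) * exp (\<i> * of_real (t * v)))"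
          by (rule Bochner_Integration.integrable_diff[OF hint shint])
        show "integrable lborel (\<lambda>t. indicator {-r-pi..r} t * e')"
          by (intro integrable_mult_left integrable_real_indicator) (auto simp: emeasure_lborel_Icc_eq)
        fix t :: real
        have "norm (h t * exp (\<i> * of_real (t * v)) - h (p + t) * exp (\<i> * of_real (t * v))) = norm (h t - h (p + t))"
          by (simp add: norm_mult flip: left_diff_distrib)
        also have "\<dots> \<le> indicator {-r-pi..r} t * e'"
        proof (cases "t \<in> {-r-pi..r}")
          case True
          thus ?thesis using d(2)[of t "p + t"] p r by auto
        next
          case False
          hence "\<bar>t\<bar> \<ge> r" "\<bar>p + t\<bar> \<ge> r" using p r by auto
          thus ?thesis using supp e' by simp
        qed
        finally show "norm (h t * exp (\<i> * of_real (t * v)) - h (p + t) * exp (\<i> * of_real (t * v))) \<le> indicator {-r-pi..r} t * e'" .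
      qed
      also have "\<dots> = (2 * r + pi) * e'"
      proof -
        have "- r - pi \<le> r" using r pi_gt_zero by linarith
        thus ?thesis by simp
      qed
      also have "\<dots> < 2 * ((r + pi) * (2 * e'))" using r e' pi_gt_zero by (simp add: algebra_simps add_pos_pos)
      also have "(r + pi) * (2 * e') = e"
      proof -
        have "r + pi \<noteq> 0" using r pi_gt_zero by linarith
        moreover have "q * (2 * (e / q / 2)) = e" if "q \<noteq> 0" for q using that by simp
        ultimately show ?thesis unfolding e'_def by blast
      qed
      finally have "norm I < e" by simp
      thus ?case by (simp add: I_def)
    qed
  qed
qed

text \<open>Fubini for \<open>?F\<close>: integrating over \<open>t\<close> first gives the kernel,
  over \<open>u\<close> first the Laplace transform. The damping by
  \<open>exp (- \<sigma> * u)\<close> with \<open>\<sigma> > 0\<close> makes the double integral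
  absolutely convergent.\<close>

lemma fejer_convolution_laplace:
  fixes f :: "real \<Rightarrow> complex" and G :: "complex \<Rightarrow> complex"
  assumes fm [measurable]: "f \<in> borel_measurable borel"
    and f0: "\<And>u. u < 0 \<Longrightarrow> f u = 0"
    and fB: "\<And>u. norm (f u) \<le> B"
    and lap: "\<And>z. Re z > 0 \<Longrightarrow> (LINT u|lborel. f u * exp (- z * of_real u)) = G z"
    and \<sigma>: "\<sigma> > 0" and r: "r > 0"
  shows "(LINT u|lborel. f u * exp (- of_real \<sigma> * of_real u) * of_real (fejer r (v - u)))
       = (LINT t|lborel. fejer_hat r t *\<^sub>R (exp (\<i> * of_real (t * v)) * G (Complex \<sigma> t)))"
proof -
  let ?F = "\<lambda>u t. fejer_hat r t *\<^sub>R (f u * exp (- of_real \<sigma> * of_real u) * exp (\<i> * of_real (t * (v - u))))"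
  have B0: "B \<ge> 0" using fB[of 0] norm_ge_zero order_trans by blast
  have uint: "integrable lborel (\<lambda>u. norm (f u) * exp (- \<sigma> * u))"
  proof (rule Bochner_Integration.integrable_bound)
    show "integrable lborel (\<lambda>u. B * (indicator {0..} u *\<^sub>R exp (- \<sigma> * u)))"
      using set_integrable_exp_minus(1)[OF \<sigma>, of 0] unfolding set_integrable_def by (rule integrable_mult_right)
    show "AE u in lborel. norm (norm (f u) * exp (- \<sigma> * u)) \<le> norm (B * (indicator {0..} u *\<^sub>R exp (- \<sigma> * u)))"
    proof (rule AE_I2)
      fix u :: real
      show "norm (norm (f u) * exp (- \<sigma> * u)) \<le> norm (B * (indicator {0..} u *\<^sub>R exp (- \<sigma> * u)))"
        using fB[of u] f0[of u] B0 by (cases "u < 0") (auto simp: abs_mult intro!: mult_right_mono)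
    qed
  qed measurable
  have nF: "norm (?F u t) = norm (f u) * exp (- \<sigma> * u) * fejer_hat r t" for u t
    using fejer_hat_bounds(1)[OF r, of t] by (simp add: norm_mult)
  have tint: "integrable lborel (\<lambda>t. ?F u t)" for u
  proof (rule Bochner_Integration.integrable_bound[of _ "\<lambda>t. norm (f u) * exp (- \<sigma> * u) * fejer_hat r t"])
    show "integrable lborel (\<lambda>t. norm (f u) * exp (- \<sigma> * u) * fejer_hat r t)"
      by (intro integrable_mult_right fejer_hat_integrable r)
    show "AE t in lborel. norm (?F u t) \<le> norm (norm (f u) * exp (- \<sigma> * u) * fejer_hat r t)"
      unfolding nF by (intro AE_I2) simp
  qed measurable
  have int: "integrable (lborel \<Otimes>\<^sub>M lborel) (case_prod ?F)"
  proof (rule lborel_pair.Fubini_integrable)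
    show "case_prod ?F \<in> borel_measurable (lborel \<Otimes>\<^sub>M lborel)" by measurable
    have "(LINT t|lborel. norm (case (u, t) of (u, t) \<Rightarrow> ?F u t)) = norm (f u) * exp (- \<sigma> * u) * (LINT t|lborel. fejer_hat r t)" for u
      unfolding prod.case nF by (rule Bochner_Integration.integral_mult_right_zero)
    thus "integrable lborel (\<lambda>u. LINT t|lborel. norm (case (u, t) of (u, t) \<Rightarrow> ?F u t))"
      using uint by (simp only: integrable_mult_left)
    show "AE u in lborel. integrable lborel (\<lambda>t. case (u, t) of (u, t) \<Rightarrow> ?F u t)"
      unfolding prod.case using tint by (intro AE_I2)
  qed
  have "(LINT t|lborel. LINT u|lborel. ?F u t) = (LINT u|lborel. LINT t|lborel. ?F u t)"
    by (rule lborel_pair.Fubini_integral[OF int])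
  moreover have "(LINT u|lborel. ?F u t) = fejer_hat r t *\<^sub>R (exp (\<i> * of_real (t * v)) * G (Complex \<sigma> t))" for t
  proof -
    have "?F u t = fejer_hat r t *\<^sub>R (exp (\<i> * of_real (t * v)) * (f u * exp (- Complex \<sigma> t * of_real u)))" for u
      by (simp add: Complex_eq algebra_simps flip: exp_add)
    hence "(LINT u|lborel. ?F u t) = fejer_hat r t *\<^sub>R (exp (\<i> * of_real (t * v)) * (LINT u|lborel. f u * exp (- Complex \<sigma> t * of_real u)))"
      by (simp only: integral_scaleR_right Bochner_Integration.integral_mult_right_zero)
    thus ?thesis using lap[of "Complex \<sigma> t"] \<sigma> by simp
  qed
  moreover have "(LINT u|lborel. LINT t|lborel. ?F u t)
      = (LINT u|lborel. f u * exp (- of_real \<sigma> * of_real u) * of_real (fejer r (v - u)))"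
  proof (rule integral_cong_AE)
    show "(\<lambda>u. LINT t|lborel. ?F u t) \<in> borel_measurable lborel" by measurable
    show "(\<lambda>u. f u * exp (- of_real \<sigma> * of_real u) * of_real (fejer r (v - u))) \<in> borel_measurable lborel" by measurable
    show "AE u in lborel. (LINT t|lborel. ?F u t) = f u * exp (- of_real \<sigma> * of_real u) * of_real (fejer r (v - u))"
      using AE_lborel_singleton[of v]
    proof eventually_elim
      case (elim u)
      have "?F u t = (f u * exp (- of_real \<sigma> * of_real u)) * (fejer_hat r t *\<^sub>R exp (\<i> * of_real (t * (v - u))))" for t
        by simp
      hence "(LINT t|lborel. ?F u t) = (f u * exp (- of_real \<sigma> * of_real u)) * (LINT t|lborel. fejer_hat r t *\<^sub>R exp (\<i> * of_real (t * (v - u))))"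
        by (simp only: Bochner_Integration.integral_mult_right_zero)
      thus ?case using has_bochner_integral_integral_eq[OF has_bochner_integral_fejer[OF r, of "v - u"]] elim by simp
    qed
  qed
  ultimately show ?thesis by (simp only:)
qed

text \<open>Letting \<open>\<sigma>\<close> tend to 0: the left side is dominated by
  \<open>B * fejer r (v - u)\<close>, the right side by a bound for \<open>G\<close> on a compact
  rectangle touching the boundary line. Continuity of \<open>G\<close> up to that line takes the
  place of analyticity.\<close>

lemma fejer_convolution_boundary:
  fixes f :: "real \<Rightarrow> complex" and G :: "complex \<Rightarrow> complex"
  assumes fm [measurable]: "f \<in> borel_measurable borel"
    and f0: "\<And>u. u < 0 \<Longrightarrow> f u = 0"
    and fB: "\<And>u. norm (f u) \<le> B"
    and lap: "\<And>z. Re z > 0 \<Longrightarrow> (LINT u|lborel. f u * exp (- z * of_real u)) = G z"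
    and cont: "continuous_on {z. Re z \<ge> 0} G" and r: "r > 0"
  shows "(LINT u|lborel. f u * of_real (fejer r (v - u)))
       = (LINT t|lborel. fejer_hat r t *\<^sub>R G (Complex 0 t) * exp (\<i> * of_real (t * v)))"
proof -
  define s where "s = (\<lambda>n. inverse (real (Suc n)))"
  have s: "s n > 0" "s n \<le> 1" for n by (auto simp: s_def field_simps)
  have s_lim: "s \<longlonglongrightarrow> 0" unfolding s_def by (rule LIMSEQ_inverse_real_of_nat)
  have B0: "B \<ge> 0" using fB[of 0] norm_ge_zero order_trans by blast
  define R where "R = cbox (Complex 0 (-r)) (Complex 1 r)"
  have Rsub: "R \<subseteq> {z. Re z \<ge> 0}" by (auto simp: R_def cbox_Complex_eq in_cbox_complex_iff)
  have "bounded (G ` R)"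
    by (intro compact_imp_bounded compact_continuous_image continuous_on_subset[OF cont Rsub]) (simp add: R_def)
  then obtain M where M: "\<And>z. z \<in> R \<Longrightarrow> norm (G z) \<le> M" by (auto simp: bounded_iff)
  have M0: "M \<ge> 0" using M[of "Complex 0 0"] r by (auto simp: R_def in_cbox_complex_iff intro: order_trans[OF norm_ge_zero])
  have Gm: "(\<lambda>t. G (Complex \<sigma> t)) \<in> borel_measurable borel" if "\<sigma> \<ge> 0" for \<sigma>
  proof (rule borel_measurable_continuous_onI)
    show "continuous_on UNIV (\<lambda>t. G (Complex \<sigma> t))"
      by (rule continuous_on_compose2[OF cont]) (use that in \<open>auto simp: Complex_eq intro!: continuous_intros\<close>)
  qed
  have Kint: "integrable lborel (\<lambda>u. B * fejer r (v - u))"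
    using lborel_integrable_real_affine[OF fejer_integrable[OF r], of "-1" v]
    by (intro integrable_mult_right) simp
  have 1: "(\<lambda>n. LINT u|lborel. f u * exp (- of_real (s n) * of_real u) * of_real (fejer r (v - u)))
      \<longlonglongrightarrow> (LINT u|lborel. f u * of_real (fejer r (v - u)))"
  proof (rule integral_dominated_convergence[OF _ _ Kint])
    show "AE u in lborel. (\<lambda>n. f u * exp (- of_real (s n) * of_real u) * of_real (fejer r (v - u))) \<longlonglongrightarrow> f u * of_real (fejer r (v - u))"
    proof (rule AE_I2)
      fix u :: real
      have "(\<lambda>n. f u * exp (- of_real (s n) * of_real u) * of_real (fejer r (v - u))) \<longlonglongrightarrow> f u * exp (- of_real 0 * of_real u) * of_real (fejer r (v - u))"
        by (intro tendsto_intros s_lim)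
      thus "(\<lambda>n. f u * exp (- of_real (s n) * of_real u) * of_real (fejer r (v - u))) \<longlonglongrightarrow> f u * of_real (fejer r (v - u))" by simp
    qed
    show "AE u in lborel. norm (f u * exp (- of_real (s n) * of_real u) * of_real (fejer r (v - u))) \<le> B * fejer r (v - u)" for n
    proof (rule AE_I2)
      fix u :: real
      have "norm (f u * exp (- of_real (s n) * of_real u)) \<le> B"
      proof (cases "u < 0")
        case False
        have "norm (f u) * exp (- s n * u) \<le> B * 1"
          using False fB[of u] s[of n] B0 by (intro mult_mono) auto
        thus ?thesis by (simp add: norm_mult)
      qed (use f0 B0 in auto)
      thus "norm (f u * exp (- of_real (s n) * of_real u) * of_real (fejer r (v - u))) \<le> B * fejer r (v - u)"
        using fejer_nonneg[OF r, of "v - u"] unfolding norm_mult[of "f u * exp (- of_real (s n) * of_real u)"]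
        by (simp only: norm_of_real abs_of_nonneg mult_right_mono)
    qed
  qed measurable
  have 2: "(\<lambda>n. LINT t|lborel. fejer_hat r t *\<^sub>R (exp (\<i> * of_real (t * v)) * G (Complex (s n) t)))
      \<longlonglongrightarrow> (LINT t|lborel. fejer_hat r t *\<^sub>R (exp (\<i> * of_real (t * v)) * G (Complex 0 t)))"
  proof (rule integral_dominated_convergence[where w = "\<lambda>t. M * fejer_hat r t"])
    show "integrable lborel (\<lambda>t. M * fejer_hat r t)"
      by (intro integrable_mult_right fejer_hat_integrable r)
    show "(\<lambda>t. fejer_hat r t *\<^sub>R (exp (\<i> * of_real (t * v)) * G (Complex 0 t))) \<in> borel_measurable lborel"
    proof -
      have [measurable]: "(\<lambda>t. G (Complex 0 t)) \<in> borel_measurable borel" using Gm[of 0] by simp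
      show ?thesis by measurable
    qed
    show "(\<lambda>t. fejer_hat r t *\<^sub>R (exp (\<i> * of_real (t * v)) * G (Complex (s n) t))) \<in> borel_measurable lborel" for n
    proof -
      have [measurable]: "(\<lambda>t. G (Complex (s n) t)) \<in> borel_measurable borel" using Gm[of "s n"] s(1)[of n] by simp
      show ?thesis by measurable
    qed
    show "AE t in lborel. (\<lambda>n. fejer_hat r t *\<^sub>R (exp (\<i> * of_real (t * v)) * G (Complex (s n) t)))
       \<longlonglongrightarrow> fejer_hat r t *\<^sub>R (exp (\<i> * of_real (t * v)) * G (Complex 0 t))"
    proof (rule AE_I2)
      fix t :: real
      have "(\<lambda>n. G (Complex (s n) t)) \<longlonglongrightarrow> G (Complex 0 t)"
      proof (rule continuous_on_tendsto_compose[OF cont])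
        show "(\<lambda>n. Complex (s n) t) \<longlonglongrightarrow> Complex 0 t"
          unfolding Complex_eq using s_lim by (auto intro!: tendsto_eq_intros)
      qed (use s(1) in \<open>auto intro!: always_eventually less_imp_le\<close>)
      thus "(\<lambda>n. fejer_hat r t *\<^sub>R (exp (\<i> * of_real (t * v)) * G (Complex (s n) t)))
       \<longlonglongrightarrow> fejer_hat r t *\<^sub>R (exp (\<i> * of_real (t * v)) * G (Complex 0 t))" by (intro tendsto_intros)
    qed
    show "AE t in lborel. norm (fejer_hat r t *\<^sub>R (exp (\<i> * of_real (t * v)) * G (Complex (s n) t))) \<le> M * fejer_hat r t" for n
    proof (rule AE_I2)
      fix t :: real
      show "norm (fejer_hat r t *\<^sub>R (exp (\<i> * of_real (t * v)) * G (Complex (s n) t))) \<le> M * fejer_hat r t"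
      proof (cases "\<bar>t\<bar> \<ge> r")
        case False
        hence "Complex (s n) t \<in> R" using s[of n] by (auto simp: R_def in_cbox_complex_iff)
        hence "norm (G (Complex (s n) t)) \<le> M" by (rule M)
        hence "fejer_hat r t * norm (G (Complex (s n) t)) \<le> fejer_hat r t * M"
          using fejer_hat_bounds(1)[OF r, of t] by (intro mult_left_mono)
        thus ?thesis using fejer_hat_bounds(1)[OF r, of t] by (simp add: norm_mult mult.commute)
      qed (simp add: fejer_hat_eq_0[OF r])
    qed
  qed
  have "(LINT u|lborel. f u * of_real (fejer r (v - u))) = (LINT t|lborel. fejer_hat r t *\<^sub>R (exp (\<i> * of_real (t * v)) * G (Complex 0 t)))"
  proof (rule LIMSEQ_unique[OF 1])
    have eq: "(LINT u|lborel. f u * exp (- of_real (s n) * of_real u) * of_real (fejer r (v - u)))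
       = (LINT t|lborel. fejer_hat r t *\<^sub>R (exp (\<i> * of_real (t * v)) * G (Complex (s n) t)))" for n
      by (rule fejer_convolution_laplace[OF fm f0 fB lap s(1) r])
    show "(\<lambda>n. LINT u|lborel. f u * exp (- of_real (s n) * of_real u) * of_real (fejer r (v - u)))
      \<longlonglongrightarrow> (LINT t|lborel. fejer_hat r t *\<^sub>R (exp (\<i> * of_real (t * v)) * G (Complex 0 t)))"
      unfolding eq by (rule 2)
  qed
  thus ?thesis by (simp add: mult.commute)
qed

lemma fejer_convolution_tendsto_0:
  fixes f :: "real \<Rightarrow> complex" and G :: "complex \<Rightarrow> complex"
  assumes fm [measurable]: "f \<in> borel_measurable borel"
    and f0: "\<And>u. u < 0 \<Longrightarrow> f u = 0"
    and fB: "\<And>u. norm (f u) \<le> B"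
    and lap: "\<And>z. Re z > 0 \<Longrightarrow> (LINT u|lborel. f u * exp (- z * of_real u)) = G z"
    and cont: "continuous_on {z. Re z \<ge> 0} G" and r: "r > 0"
  shows "((\<lambda>v. LINT w|lborel. f (v - w) * of_real (fejer r w)) \<longlongrightarrow> 0) at_top"
proof -
  have "((\<lambda>v. LINT t|lborel. (fejer_hat r t *\<^sub>R G (Complex 0 t)) * exp (\<i> * of_real (t * v))) \<longlongrightarrow> 0) at_top"
  proof (rule riemann_lebesgue_compact_support[OF _ _ r])
    have "continuous_on UNIV (\<lambda>t. G (Complex 0 t))"
      by (rule continuous_on_compose2[OF cont]) (auto simp: Complex_eq intro!: continuous_intros)
    thus "continuous_on UNIV (\<lambda>t. fejer_hat r t *\<^sub>R G (Complex 0 t))"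
      by (intro continuous_intros continuous_fejer_hat r)
  qed (simp add: fejer_hat_eq_0[OF r])
  moreover have "(LINT t|lborel. (fejer_hat r t *\<^sub>R G (Complex 0 t)) * exp (\<i> * of_real (t * v)))
     = (LINT w|lborel. f (v - w) * of_real (fejer r w))" for v
  proof -
    have "(LINT u|lborel. f u * of_real (fejer r (v - u))) = (LINT w|lborel. f (v + (-1) * w) * of_real (fejer r (v - (v + (-1) * w))))"
      using lborel_integral_real_affine[of "-1" "\<lambda>u. f u * of_real (fejer r (v - u))" v] by simp
    thus ?thesis using fejer_convolution_boundary[OF fm f0 fB lap cont r, of v] by simp
  qed
  ultimately show ?thesis by simp
qed

text \<open>Wiener--Ikehara style: convolution with the Fejer kernel only sees the boundary values of the
  Laplace transform on a compact interval, where the Riemann--Lebesgue lemma applies.\<close>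

theorem tauberian_slowly_oscillating:
  fixes f :: "real \<Rightarrow> complex" and G :: "complex \<Rightarrow> complex"
  assumes fm [measurable]: "f \<in> borel_measurable borel"
    and f0: "\<And>u. u < 0 \<Longrightarrow> f u = 0"
    and fB: "\<And>u. norm (f u) \<le> B"
    and lap: "\<And>z. Re z > 0 \<Longrightarrow> (LINT u|lborel. f u * exp (- z * of_real u)) = G z"
    and cont: "continuous_on {z. Re z \<ge> 0} G"
    and osc: "\<And>e. e > 0 \<Longrightarrow> \<exists>d>0. eventually (\<lambda>v. \<forall>w. \<bar>w\<bar> \<le> d \<longrightarrow> norm (f (v - w) - f v) \<le> e) at_top"
  shows "(f \<longlongrightarrow> 0) at_top"
proof (rule tendstoI)
  fix e :: real assume e: "e > 0"
  have B0: "B \<ge> 0" using fB[of 0] norm_ge_zero order_trans by blast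
  obtain d where d: "d > 0" "eventually (\<lambda>v. \<forall>w. \<bar>w\<bar> \<le> d \<longrightarrow> norm (f (v - w) - f v) \<le> e / 4) at_top"
    using osc[of "e / 4"] e by auto
  \<comment> \<open>Chosen such that the part of the kernel with
    \<open>\<bar>w\<bar> \<ge> d\<close>, of mass at most \<open>8 / (r * d)\<close>, contributes at
    most \<open>e / 4\<close> against the bound \<open>2 * B\<close>. The \<open>+ 1\<close> covers
    \<open>B = 0\<close>.\<close>
  define r where "r = 64 * (B + 1) / (d * e)"
  have r: "r > 0" using d e B0 by (simp add: r_def)
  have "eventually (\<lambda>v. norm (LINT w|lborel. f (v - w) * of_real (fejer r w)) < e / 8) at_top"
    using tendstoD[OF fejer_convolution_tendsto_0[OF fm f0 fB lap cont r], of "e / 8"] e by simp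
  with d(2) show "eventually (\<lambda>v. dist (f v) 0 < e) at_top"
  proof eventually_elim
    case (elim v)
    define I where "I = (LINT w|lborel. fejer r w)"
    have I: "I \<ge> 1 / 2" unfolding I_def by (rule integral_fejer_ge[OF r])
    let ?T = "\<lambda>w. indicator {w. \<bar>w\<bar> \<ge> d} w * (1 / w\<^sup>2)"
    have T: "integrable lborel ?T" "(LINT w|lborel. ?T w) = 2 / d"
      using has_bochner_integral_inverse_square[OF d(1)] by (auto simp: has_bochner_integral_iff)
    have Kc: "integrable lborel (\<lambda>w. complex_of_real (fejer r w))"
      using fejer_integrable[OF r] by (rule integrable_of_real)
    have i1: "integrable lborel (\<lambda>w. f v * of_real (fejer r w))" by (rule integrable_mult_right[OF Kc])
    have i2: "integrable lborel (\<lambda>w. f (v - w) * of_real (fejer r w))"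
    proof (rule Bochner_Integration.integrable_bound[of _ "\<lambda>w. B * fejer r w"])
      show "integrable lborel (\<lambda>w. B * fejer r w)" by (intro integrable_mult_right fejer_integrable r)
      show "AE w in lborel. norm (f (v - w) * of_real (fejer r w)) \<le> norm (B * fejer r w)"
        using fB B0 fejer_nonneg[OF r] by (intro AE_I2) (auto simp: norm_mult abs_mult intro!: mult_right_mono)
    qed measurable
    have eq: "f v * of_real I - (LINT w|lborel. f (v - w) * of_real (fejer r w))
        = (LINT w|lborel. f v * of_real (fejer r w) - f (v - w) * of_real (fejer r w))"
    proof -
      have "f v * of_real I = (LINT w|lborel. f v * of_real (fejer r w))"
        unfolding I_def by (simp only: Bochner_Integration.integral_mult_right_zero integral_complex_of_real)
      thus ?thesis using Bochner_Integration.integral_diff[OF i1 i2] by simp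
    qed
    \<comment> \<open>Near 0 slow oscillation bounds the difference by \<open>e / 4\<close>; away
      from 0 it is at most \<open>2 * B\<close> against the tail of the kernel.\<close>
    have "norm (f v * of_real I - (LINT w|lborel. f (v - w) * of_real (fejer r w)))
       \<le> (LINT w|lborel. e / 4 * fejer r w + (2 * B * (4 / r)) * ?T w)"
      unfolding eq
    proof (rule Bochner_Integration.integral_norm_bound_integral)
      show "integrable lborel (\<lambda>w. f v * of_real (fejer r w) - f (v - w) * of_real (fejer r w))"
        by (rule Bochner_Integration.integrable_diff[OF i1 i2])
      show "integrable lborel (\<lambda>w. e / 4 * fejer r w + (2 * B * (4 / r)) * ?T w)"
        by (intro Bochner_Integration.integrable_add integrable_mult_right T fejer_integrable r)
      fix w :: real
      have n: "norm (f v * of_real (fejer r w) - f (v - w) * of_real (fejer r w)) = norm (f (v - w) - f v) * fejer r w"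
        using fejer_nonneg[OF r, of w] by (simp add: norm_mult norm_minus_commute flip: left_diff_distrib)
      show "norm (f v * of_real (fejer r w) - f (v - w) * of_real (fejer r w)) \<le> e / 4 * fejer r w + (2 * B * (4 / r)) * ?T w"
      proof (cases "\<bar>w\<bar> \<le> d")
        case True
        hence "norm (f (v - w) - f v) * fejer r w \<le> e / 4 * fejer r w"
          using elim fejer_nonneg[OF r, of w] by (intro mult_right_mono) auto
        moreover have "(2 * B * (4 / r)) * ?T w \<ge> 0" using B0 r by simp
        ultimately show ?thesis unfolding n by linarith
      next
        case False
        have "norm (f (v - w) - f v) \<le> 2 * B"
          using norm_triangle_ineq4[of "f (v - w)" "f v"] fB[of v] fB[of "v - w"] by linarith
        hence "norm (f (v - w) - f v) * fejer r w \<le> (2 * B) * (4 / r * (1 / w\<^sup>2))"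
          using fejer_le[OF r, of w] fejer_nonneg[OF r, of w] B0 by (intro mult_mono) auto
        moreover have "(2 * B * (4 / r)) * ?T w = (2 * B) * (4 / r * (1 / w\<^sup>2))" using False by simp
        moreover have "e / 4 * fejer r w \<ge> 0" using e fejer_nonneg[OF r, of w] by simp
        ultimately show ?thesis unfolding n by linarith
      qed
    qed
    also have "\<dots> = e / 4 * I + (2 * B * (4 / r)) * (2 / d)"
      unfolding I_def T(2)[symmetric]
      by (subst Bochner_Integration.integral_add)
         (use T(1) fejer_integrable[OF r] in \<open>auto simp only: integrable_mult_right Bochner_Integration.integral_mult_right_zero\<close>)
    finally have "norm (f v * of_real I) < e / 4 * I + (2 * B * (4 / r)) * (2 / d) + e / 8"
      using norm_triangle_sub[of "f v * of_real I" "LINT w|lborel. f (v - w) * of_real (fejer r w)"] elim by linarith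
    moreover have "(2 * B * (4 / r)) * (2 / d) \<le> e / 4"
    proof -
      have "(2 * B * (4 / r)) * (2 / d) = e / 4 * (B / (B + 1))"
        using d e B0 by (simp add: r_def field_simps)
      also have "\<dots> \<le> e / 4 * 1" using e B0 by (intro mult_left_mono) auto
      finally show ?thesis by simp
    qed
    moreover have "norm (f v * of_real I) = norm (f v) * I" using I by (simp add: norm_mult)
    ultimately have "norm (f v) * I < e / 4 * I + 3 * e / 8" by simp
    \<comment> \<open>The mass is at least 1/2, so \<open>3 * e / 8\<close>, which is
      \<open>e / 4\<close> from the tail plus \<open>e / 8\<close> from the convolution, is absorbed
      into \<open>3 * e / 4 * I\<close>.\<close>
    moreover have "3 * e / 4 * (1 / 2) \<le> 3 * e / 4 * I" using I e by (intro mult_left_mono) auto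
    ultimately have "norm (f v) * I < e * I" by (simp add: algebra_simps)
    thus ?case using I by simp
  qed
qed

section \<open>Arithmetical semigroups with Axiom A\<close>

text \<open>The Landau bound is turned into one constant valid for all \<open>x \<ge> 1\<close>,
  since counts are later evaluated at \<open>x / nm g\<close> with arguments down to 1.\<close>

locale axiom_A_semigroup =
  fixes N :: "'p \<Rightarrow> real" and c \<eta> C :: real
  assumes N_gt_1: "N p > 1"
    and finite_le: "finite {g. gnorm N g \<le> x}"
    and c_pos: "c > 0" and eta_pos: "0 < \<eta>" and eta_less_1: "\<eta> < 1"
    and count_approx: "x \<ge> 1 \<Longrightarrow> \<bar>count_G N x - c * x\<bar> \<le> C * x powr \<eta>"
begin

abbreviation nm :: "'p multiset \<Rightarrow> real" where "nm \<equiv> gnorm N"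

definition le :: "real \<Rightarrow> 'p multiset set" where "le x = {g. nm g \<le> x}"

definition rough :: "real \<Rightarrow> 'p multiset set" where "rough y = {g. \<forall>p\<in>#g. y < N p}"

lemma N_pos [simp]: "N p > 0" using N_gt_1[of p] by simp

lemma finite_le' [simp]: "finite (le x)" using finite_le by (simp add: le_def)

lemma nm_ge_1: "nm g \<ge> 1"
proof (induction g)
  case (add p g)
  have "1 * 1 \<le> N p * nm g" using add N_gt_1[of p] by (intro mult_mono) auto
  thus ?case by simp
qed simp

lemma nm_pos [simp]: "nm g > 0" using nm_ge_1[of g] by linarith

lemma nm_neq_0 [simp]: "nm g \<noteq> 0" using nm_pos[of g] by linarith

lemma nm_mono: "h \<subseteq># g \<Longrightarrow> nm h \<le> nm g"
proof -
  assume "h \<subseteq># g"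
  then obtain k where "g = h + k" by (auto simp: mset_subset_eq_exists_conv)
  thus ?thesis using nm_ge_1[of k] nm_pos[of h] mult_left_mono[of 1 "nm k" "nm h"] by simp
qed

lemma N_le_nm: "p \<in># g \<Longrightarrow> N p \<le> nm g"
  using nm_mono[of "{#p#}" g] by simp

lemma le_less_1: "x < 1 \<Longrightarrow> le x = {}"
proof -
  assume x: "x < 1"
  have "\<not> nm g \<le> x" for g using nm_ge_1[of g] x by linarith
  thus ?thesis by (simp add: le_def)
qed

lemma finite_subsets_mset [simp]: "finite {h. h \<subseteq># (g :: 'p multiset)}"
  by (rule finite_subset[OF _ finite_le'[of "nm g"]]) (auto simp: le_def nm_mono)

lemma finite_primes_le [simp]: "finite {p. N p \<le> x}"
proof -
  have "(\<lambda>p. {#p#}) ` {p. N p \<le> x} \<subseteq> le x" by (auto simp: le_def)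
  hence "finite ((\<lambda>p. {#p#}) ` {p. N p \<le> x})" using finite_le' finite_subset by blast
  thus ?thesis by (rule finite_imageD) (auto simp: inj_on_def)
qed

lemma card_primes_le: "real (card {p. N p \<le> x}) \<le> count_G N x"
proof -
  have "(\<lambda>p. {#p#}) ` {p. N p \<le> x} \<subseteq> le x" by (auto simp: le_def)
  hence "card ((\<lambda>p. {#p#}) ` {p. N p \<le> x}) \<le> card (le x)" by (rule card_mono[OF finite_le'])
  also have "card ((\<lambda>p. {#p#}) ` {p. N p \<le> x}) = card {p. N p \<le> x}"
    by (rule card_image) (auto simp: inj_on_def)
  finally show ?thesis by (simp add: count_G_def le_def)
qed

lemma count_G_eq: "count_G N x = real (card (le x))"
  by (simp add: count_G_def le_def)

lemma count_G_mono: "x \<le> y \<Longrightarrow> count_G N x \<le> count_G N y"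
  unfolding count_G_eq by (intro of_nat_mono card_mono finite_le') (auto simp: le_def)

lemma count_G_less_1: "x < 1 \<Longrightarrow> count_G N x = 0"
  by (simp add: count_G_eq le_less_1)

lemma count_G_ge_1: "x \<ge> 1 \<Longrightarrow> count_G N x \<ge> 1"
proof -
  assume "x \<ge> 1"
  hence "{#} \<in> le x" by (simp add: le_def)
  hence "card (le x) \<noteq> 0" by auto
  thus ?thesis unfolding count_G_eq by linarith
qed

lemma C_nonneg: "C \<ge> 0"
  using count_approx[of 1] by simp

text \<open>A single constant with \<open>count_G N x \<le> B * x\<close> for all
  \<open>x \<ge> 0\<close>; the summand 1 ensures \<open>B \<ge> 1\<close>.\<close>

definition B :: real where "B = C + c + 1"

lemma B_ge_1: "B \<ge> 1" using C_nonneg c_pos by (simp add: B_def)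

lemma count_G_le: "x \<ge> 0 \<Longrightarrow> count_G N x \<le> B * x"
proof (cases "x \<ge> 1")
  case True
  have "count_G N x \<le> c * x + C * x powr \<eta>" using count_approx[OF True] by linarith
  also have "x powr \<eta> \<le> x powr 1" using True eta_less_1 by (intro powr_mono) auto
  hence "C * x powr \<eta> \<le> C * x" using True C_nonneg by (intro mult_left_mono) auto
  finally show ?thesis using True by (simp add: B_def algebra_simps)
next
  case False
  assume "x \<ge> 0" thus ?thesis using False B_ge_1 by (simp add: count_G_less_1)
qed

lemma count_G_over_tendsto: "((\<lambda>x. count_G N x / x) \<longlongrightarrow> c) at_top"
proof -
  have "((\<lambda>x. (C * x powr \<eta>) / x) \<longlongrightarrow> 0) at_top"
    using eta_less_1 by real_asymp
  moreover have "eventually (\<lambda>x. norm (count_G N x / x - c) \<le> (C * x powr \<eta>) / x) at_top"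
    using eventually_ge_at_top[of 1]
  proof eventually_elim
    case (elim x)
    have "count_G N x / x - c = (count_G N x - c * x) / x" using elim by (simp add: field_simps)
    thus ?case using count_approx[OF elim] elim by (simp add: divide_right_mono)
  qed
  ultimately have "((\<lambda>x. count_G N x / x - c) \<longlongrightarrow> 0) at_top"
    by (rule Lim_null_comparison[rotated])
  thus ?thesis by (rule LIM_zero_cancel)
qed

text \<open>Summation over \<open>g\<close> and its divisors is summation over pairs
  \<open>(h, k)\<close> with \<open>g = h + k\<close>. The Moebius inversions and the convolution
  with \<open>a\<close> are instances.\<close>

lemma sum_divisors_swap:
  fixes F :: "'p multiset \<Rightarrow> 'p multiset \<Rightarrow> 'b::comm_monoid_add"
  shows "(\<Sum>g\<in>le x. \<Sum>h | h \<subseteq># g. F h (g - h)) = (\<Sum>h\<in>le x. \<Sum>k\<in>le (x / nm h). F h k)"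
proof -
  have "(\<Sum>g\<in>le x. \<Sum>h | h \<subseteq># g. F h (g - h)) = (\<Sum>(g,h)\<in>Sigma (le x) (\<lambda>g. {h. h \<subseteq># g}). F h (g - h))"
    by (rule sum.Sigma) auto
  also have "\<dots> = (\<Sum>(h,k)\<in>Sigma (le x) (\<lambda>h. le (x / nm h)). F h k)"
  proof (rule sum.reindex_bij_witness[of _ "\<lambda>(h,k). (h + k, h)" "\<lambda>(g,h). (h, g - h)"], goal_cases)
    case (2 gh)
    then obtain g h where gh: "gh = (g, h)" "nm g \<le> x" "h \<subseteq># g" by (auto simp: le_def)
    then obtain k where k: "g = h + k" by (auto simp: mset_subset_eq_exists_conv)
    have "nm h \<le> x" using gh nm_mono[of h g] by linarith
    thus ?case using gh k by (auto simp: le_def field_simps)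
  qed (auto simp: le_def field_simps)
  also have "\<dots> = (\<Sum>h\<in>le x. \<Sum>k\<in>le (x / nm h). F h k)"
    by (rule sum.Sigma[symmetric]) auto
  finally show ?thesis .
qed

text \<open>Moebius inversion over the primes above \<open>y\<close> only. With \<open>y\<close> the
  norm of a prime this is the arithmetic core of the duality; with \<open>y = 1\<close> it is the
  classical inversion.\<close>

lemma sum_moebius_rough:
  "(\<Sum>h | h \<subseteq># g. if h \<in> rough y then moebius h else 0) = (if \<forall>p\<in>#g. N p \<le> y then 1 else 0)"
proof -
  have "(\<Sum>h | h \<subseteq># g. if h \<in> rough y then moebius h else 0)
      = (\<Sum>h | h \<subseteq># g \<and> (\<forall>p\<in>#h. p \<in> {p. y < N p}). moebius h)"
    by (rule sum.mono_neutral_cong_right) (auto simp: rough_def)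
  also have "\<dots> = (if set_mset g \<inter> {p. y < N p} = {} then 1 else 0)"
    by (rule sum_moebius_subset_over) simp
  also have "\<dots> = (if \<forall>p\<in>#g. N p \<le> y then 1 else 0)"
    by (rule if_cong) (auto simp: disjoint_iff not_less)
  finally show ?thesis .
qed

lemma rough_1: "rough 1 = UNIV"
  using N_gt_1 by (auto simp: rough_def)

lemma sum_moebius_divisors: "(\<Sum>h | h \<subseteq># (g :: 'p multiset). moebius h) = (if g = {#} then 1 else 0)"
proof -
  have "(\<forall>p\<in>#g. N p \<le> 1) \<longleftrightarrow> g = {#}" 
  proof
    assume "\<forall>p\<in>#g. N p \<le> 1"
    thus "g = {#}" using N_gt_1 by (meson leD multiset_nonemptyE)
  qed simp
  thus ?thesis using sum_moebius_rough[of 1 g] by (simp add: rough_1)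
qed

subsection \<open>The zeta function near the line of real part one\<close>

lemma mem_le [simp]: "g \<in> le x \<longleftrightarrow> nm g \<le> x" by (simp add: le_def)

definition summ :: "('p multiset \<Rightarrow> complex) \<Rightarrow> real \<Rightarrow> complex" where
  "summ f x = (\<Sum>g\<in>le x. f g)"

lemma norm_sum_le_count:
  assumes "\<And>g. norm (f g) \<le> (1::real)"
  shows "norm (\<Sum>g\<in>le x. f g) \<le> count_G N x"
  using sum_norm_le[of "le x" f "\<lambda>_. 1"] assms by (simp add: count_G_eq)

text \<open>The Dirichlet series are normalised so that the boundary line is \<open>Re z = 0\<close>:
  \<open>dterm z g = nm g powr -(1 + z)\<close>.\<close>

definition dterm :: "complex \<Rightarrow> 'p multiset \<Rightarrow> complex" where
  "dterm z g = exp (- (1 + z) * of_real (ln (nm g)))"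

lemma ln_nm_plus: "ln (nm (g + h)) = ln (nm g) + ln (nm h)"
  by (simp add: ln_mult)

lemma ln_nm_nonneg [simp]: "ln (nm g) \<ge> 0" using nm_ge_1 by simp

lemma dterm_plus: "dterm z (g + h) = dterm z g * dterm z h"
  unfolding dterm_def ln_nm_plus by (simp add: algebra_simps flip: exp_add)

lemma dterm_empty [simp]: "dterm z {#} = 1"
  by (simp add: dterm_def)

lemma norm_dterm: "norm (dterm z g) = exp (- (1 + Re z) * ln (nm g))"
  by (simp add: dterm_def)

lemma norm_dterm_powr: "norm (dterm z g) = nm g powr (- (1 + Re z))"
  by (simp add: norm_dterm powr_def mult.commute)

lemma dterm_prod: "dterm z g = prod_mset (image_mset (\<lambda>p. dterm z {#p#}) g)"
proof (induction g)
  case (add p g)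
  thus ?case using dterm_plus[of z "{#p#}" g] by simp
qed simp

text \<open>Truncating at norm \<open>n\<close> makes the Laplace transform of a summatory function a finite sum.\<close>

definition step :: "('p multiset \<Rightarrow> complex) \<Rightarrow> real \<Rightarrow> real \<Rightarrow> complex" where
  "step f n u = (\<Sum>g\<in>le n. indicator {ln (nm g)..} u *\<^sub>R f g)"

lemma step_eq_summ: "exp u \<le> n \<Longrightarrow> step f n u = summ f (exp u)"
proof -
  assume n: "exp u \<le> n"
  have iff: "ln (nm g) \<le> u \<longleftrightarrow> nm g \<le> exp u" for g
    by (metis exp_ln ln_exp exp_gt_zero ln_le_cancel_iff nm_pos)
  show ?thesis unfolding step_def summ_def
    by (rule sum.mono_neutral_cong_right) (use n iff in \<open>auto simp: indicator_def\<close>)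
qed

lemma step_measurable [measurable]: "step f n \<in> borel_measurable borel"
  unfolding step_def by measurable

lemma summ_exp_measurable [measurable]: "(\<lambda>u. summ f (exp u)) \<in> borel_measurable borel"
proof (rule borel_measurable_LIMSEQ_metric)
  show "(\<lambda>u. step f (real n) u) \<in> borel_measurable borel" for n by measurable
  fix u :: real
  have "eventually (\<lambda>n. step f (real n) u = summ f (exp u)) sequentially"
    using eventually_ge_at_top[of "nat \<lceil>exp u\<rceil>"]
    by eventually_elim (rule step_eq_summ, linarith)
  thus "(\<lambda>n. step f (real n) u) \<longlonglongrightarrow> summ f (exp u)"
    by (rule tendsto_eventually)
qed

lemma norm_step_le:
  assumes f: "\<And>g. norm (f g) \<le> 1"
  shows "norm (step f n u) \<le> count_G N (exp u)"
proof -
  have iff: "ln (nm g) \<le> u \<longleftrightarrow> nm g \<le> exp u" for g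
    by (metis exp_ln ln_exp exp_gt_zero ln_le_cancel_iff nm_pos)
  have "norm (step f n u) \<le> (\<Sum>g\<in>le n. indicator (le (exp u)) g)"
    unfolding step_def by (rule sum_norm_le) (use f iff in \<open>auto simp: indicator_def\<close>)
  also have "\<dots> = real (card (le n \<inter> le (exp u)))" by (simp add: indicator_def sum.If_cases Int_def)
  also have "\<dots> \<le> count_G N (exp u)" unfolding count_G_eq by (intro of_nat_mono card_mono) auto
  finally show ?thesis .
qed

lemma has_bochner_integral_step:
  assumes z: "Re z > -1"
  shows "has_bochner_integral lborel
     (\<lambda>u. indicator {0..} u *\<^sub>R (step f n u * exp (- (1 + z) * of_real u)))
     (\<Sum>g\<in>le n. f g * (dterm z g / (1 + z)))"
proof -
  have "has_bochner_integral lborel (\<lambda>u. \<Sum>g\<in>le n. f g * (indicator {ln (nm g)..} u *\<^sub>R exp (- (1 + z) * of_real u)))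
     (\<Sum>g\<in>le n. f g * (dterm z g / (1 + z)))"
  proof (intro has_bochner_integral_sum has_bochner_integral_mult_right)
    fix g
    show "has_bochner_integral lborel (\<lambda>u. indicator {ln (nm g)..} u *\<^sub>R exp (- (1 + z) * of_real u)) (dterm z g / (1 + z))"
      using integral_exp_minus_complex[of "1 + z" "ln (nm g)"] set_integrable_exp_minus_complex[of "1 + z" "ln (nm g)"] z
      by (simp add: has_bochner_integral_iff set_integrable_def set_lebesgue_integral_def dterm_def)
  qed
  also have "(\<lambda>u. \<Sum>g\<in>le n. f g * (indicator {ln (nm g)..} u *\<^sub>R exp (- (1 + z) * of_real u)))
      = (\<lambda>u. indicator {0..} u *\<^sub>R (step f n u * exp (- (1 + z) * of_real u)))"
  proof
    fix u :: real
    have "indicator {0..} u *\<^sub>R (indicator {ln (nm g)..} u *\<^sub>R f g) = indicator {ln (nm g)..} u *\<^sub>R f g" for g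
      using order_trans[OF ln_nm_nonneg[of g], of u] by (auto simp: indicator_def)
    hence "indicator {0..} u *\<^sub>R step f n u = step f n u"
      unfolding step_def scaleR_sum_right by (intro sum.cong refl)
    hence "indicator {0..} u *\<^sub>R (step f n u * exp (- (1 + z) * of_real u)) = step f n u * exp (- (1 + z) * of_real u)"
      by (metis mult_scaleR_left)
    thus "(\<Sum>g\<in>le n. f g * (indicator {ln (nm g)..} u *\<^sub>R exp (- (1 + z) * of_real u)))
      = indicator {0..} u *\<^sub>R (step f n u * exp (- (1 + z) * of_real u))"
      by (simp add: step_def sum_distrib_right)
  qed
  finally show ?thesis .
qed

lemma norm_integrand_le:
  assumes "norm v \<le> count_G N (exp u)"
  shows "norm (v * exp (- (1 + z) * of_real u)) \<le> B * exp (- Re z * u)"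
proof -
  have "norm (v * exp (- (1 + z) * of_real u)) = norm v * exp (- (1 + Re z) * u)"
    by (simp add: norm_mult)
  also have "\<dots> \<le> (B * exp u) * exp (- (1 + Re z) * u)"
    using assms count_G_le[of "exp u"] by (intro mult_right_mono) auto
  also have "\<dots> = B * exp (- Re z * u)" by (simp add: algebra_simps flip: exp_add)
  finally show ?thesis .
qed

text \<open>At the real point with the same real part the terms equal their norms, so the complex
  Laplace integral of the counting function bounds the sum of the norms uniformly in
  \<open>n\<close>.\<close>

lemma sum_norm_dterm_le:
  assumes z: "Re z > 0"
  shows "(\<Sum>g\<in>le n. norm (dterm z g)) \<le> (1 + Re z) * (B / Re z)"
proof -
  define x where "x = complex_of_real (Re z)"
  have x: "Re x > 0" "Re x = Re z" using z by (auto simp: x_def)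
  have eq: "norm (dterm z g) = Re (dterm x g)" "Im (dterm x g) = 0" for g
  proof -
    have "dterm x g = of_real (exp (- (1 + Re z) * ln (nm g)))"
      unfolding dterm_def x_def by (simp flip: exp_of_real)
    thus "norm (dterm z g) = Re (dterm x g)" "Im (dterm x g) = 0" by (simp_all add: norm_dterm)
  qed
  have hb: "has_bochner_integral lborel
     (\<lambda>u. indicator {0..} u *\<^sub>R (step (\<lambda>_. 1) n u * exp (- (1 + x) * of_real u)))
     (\<Sum>g\<in>le n. 1 * (dterm x g / (1 + x)))"
    by (rule has_bochner_integral_step) (use x in auto)
  have int: "integrable lborel (\<lambda>u. indicator {0..} u * (B * exp (- Re z * u)))"
    using set_integrable_exp_minus(1)[OF z, of 0] by (simp add: set_integrable_def mult.left_commute)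
  have nb: "norm (LINT u|lborel. indicator {0..} u *\<^sub>R (step (\<lambda>_. 1) n u * exp (- (1 + x) * of_real u)))
      \<le> (LINT u|lborel. indicator {0..} u * (B * exp (- Re z * u)))"
  proof (rule Bochner_Integration.integral_norm_bound_integral[OF _ int])
    show "integrable lborel (\<lambda>u. indicator {0..} u *\<^sub>R (step (\<lambda>_. 1) n u * exp (- (1 + x) * of_real u)))"
      using hb by (simp add: has_bochner_integral_iff)
    show "norm (indicator {0..} u *\<^sub>R (step (\<lambda>_. 1) n u * exp (- (1 + x) * of_real u)))
        \<le> indicator {0..} u * (B * exp (- Re z * u))" for u
      using norm_integrand_le[OF norm_step_le, of "\<lambda>_. 1" n u x] x by (auto simp: indicator_def)
  qed
  have "norm (\<Sum>g\<in>le n. 1 * (dterm x g / (1 + x))) \<le> (LINT u|lborel. indicator {0..} u * (B * exp (- Re z * u)))"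
    using nb unfolding has_bochner_integral_integral_eq[OF hb] .
  also have "\<dots> = B * (LINT u:{0..}|lborel. exp (- Re z * u))"
    by (simp add: set_lebesgue_integral_def mult.left_commute)
  also have "\<dots> = B / Re z" using set_integrable_exp_minus(2)[OF z, of 0] by simp
  finally have "norm ((\<Sum>g\<in>le n. dterm x g) / (1 + x)) \<le> B / Re z" by (simp add: sum_divide_distrib)
  moreover have "norm (1 + x) = 1 + Re z"
  proof -
    have "1 + x = of_real (1 + Re z)" by (simp add: x_def)
    thus ?thesis using z by (simp only: norm_of_real)
  qed
  ultimately have "norm (\<Sum>g\<in>le n. dterm x g) \<le> (1 + Re z) * (B / Re z)"
    using z by (simp add: norm_divide pos_divide_le_eq mult.commute)
  moreover have "(\<Sum>g\<in>le n. norm (dterm z g)) = Re (\<Sum>g\<in>le n. dterm x g)" by (simp add: eq)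
  ultimately show ?thesis using complex_Re_le_cmod[of "\<Sum>g\<in>le n. dterm x g"] by linarith
qed

lemma finite_subset_le: "finite F \<Longrightarrow> \<exists>n. F \<subseteq> le n"
proof -
  assume "finite F"
  hence "F \<subseteq> le (Max (insert 0 (nm ` F)))" by (auto)
  thus ?thesis by blast
qed

section \<open>Dirichlet series and the inverse of zeta\<close>

lemma dterm_abs_summable:
  assumes z: "Re z > 0"
  shows "(\<lambda>g. norm (dterm z g)) summable_on UNIV"
proof (rule nonneg_bdd_above_summable_on)
  have "sum (\<lambda>g. norm (dterm z g)) F \<le> (1 + Re z) * (B / Re z)" if F: "finite F" for F
  proof -
    obtain n where n: "F \<subseteq> le n" using finite_subset_le[OF F] by blast
    have "sum (\<lambda>g. norm (dterm z g)) F \<le> (\<Sum>g\<in>le n. norm (dterm z g))"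
      using n by (intro sum_mono2) auto
    thus ?thesis using sum_norm_dterm_le[OF z, of n] by linarith
  qed
  thus "bdd_above (sum (\<lambda>g. norm (dterm z g)) ` {F. F \<subseteq> UNIV \<and> finite F})"
    by (intro bdd_aboveI2) auto
qed auto

lemma filterlim_le_finite_subsets: "filterlim le (finite_subsets_at_top UNIV) at_top"
  unfolding filterlim_finite_subsets_at_top
proof (intro allI impI)
  fix X :: "'p multiset set" assume "finite X \<and> X \<subseteq> UNIV"
  then obtain n where n: "X \<subseteq> le n" using finite_subset_le by blast
  show "eventually (\<lambda>y. finite (le y) \<and> X \<subseteq> le y \<and> le y \<subseteq> UNIV) at_top"
    using eventually_ge_at_top[of n] by eventually_elim (use n in \<open>auto\<close>)
qed

lemma sum_le_tendsto:
  fixes F :: "'p multiset \<Rightarrow> complex"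
  assumes "F summable_on UNIV"
  shows "((\<lambda>x. \<Sum>g\<in>le x. F g) \<longlongrightarrow> infsum F UNIV) at_top"
  using filterlim_compose[OF infsum_tendsto[OF assms] filterlim_le_finite_subsets] by simp

lemma mult_dterm_summable:
  assumes z: "Re z > 0" and f: "\<And>g. norm (f g) \<le> 1"
  shows "(\<lambda>g. f g * dterm z g) summable_on UNIV"
proof (rule abs_summable_summable, rule summable_on_comparison_test[OF dterm_abs_summable[OF z]])
  fix g show "norm (f g * dterm z g) \<le> norm (dterm z g)"
    using f[of g] by (simp add: norm_mult mult_left_le_one_le)
qed auto

definition dseries :: "('p multiset \<Rightarrow> complex) \<Rightarrow> complex \<Rightarrow> complex" where
  "dseries f z = infsum (\<lambda>g. f g * dterm z g) UNIV"

text \<open>Abel summation in integral form. The truncated versions are finite sums, and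
  \<open>B * exp (- Re z * u)\<close> dominates all of them.\<close>

lemma laplace_summ:
  assumes z: "Re z > 0" and f: "\<And>g. norm (f g) \<le> 1"
  shows "integrable lborel (\<lambda>u. indicator {0..} u *\<^sub>R (summ f (exp u) * exp (- (1 + z) * of_real u)))"
    and "(LINT u:{0..}|lborel. summ f (exp u) * exp (- (1 + z) * of_real u)) = dseries f z / (1 + z)"
proof -
  let ?s = "\<lambda>n u. indicator {0..} u *\<^sub>R (step f (real n) u * exp (- (1 + z) * of_real u))"
  let ?l = "\<lambda>u. indicator {0..} u *\<^sub>R (summ f (exp u) * exp (- (1 + z) * of_real u))"
  let ?w = "\<lambda>u. indicator {0..} u * (B * exp (- Re z * u))"
  have w: "integrable lborel ?w"
    using set_integrable_exp_minus(1)[OF z, of 0] by (simp add: set_integrable_def mult.left_commute)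
  have lim: "AE u in lborel. (\<lambda>n. ?s n u) \<longlonglongrightarrow> ?l u"
  proof (rule AE_I2)
    fix u :: real
    have "eventually (\<lambda>n. step f (real n) u = summ f (exp u)) sequentially"
      using eventually_ge_at_top[of "nat \<lceil>exp u\<rceil>"]
      by eventually_elim (rule step_eq_summ, linarith)
    hence "eventually (\<lambda>n. ?s n u = ?l u) sequentially" by eventually_elim simp
    thus "(\<lambda>n. ?s n u) \<longlonglongrightarrow> ?l u" by (rule tendsto_eventually)
  qed
  have bnd: "AE u in lborel. norm (?s n u) \<le> ?w u" for n
    using norm_integrand_le[OF norm_step_le[OF f]] by (auto simp: indicator_def)
  have m1: "?l \<in> borel_measurable lborel" by measurable
  have m2: "?s n \<in> borel_measurable lborel" for n by measurable
  show int: "integrable lborel ?l"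
    by (rule integrable_dominated_convergence[OF m1 m2 w lim bnd])
  have "(\<lambda>n. integral\<^sup>L lborel (?s n)) \<longlonglongrightarrow> integral\<^sup>L lborel ?l"
    by (rule integral_dominated_convergence[OF m1 m2 w lim bnd])
  moreover have "integral\<^sup>L lborel (?s n) = (\<Sum>g\<in>le (real n). f g * dterm z g) / (1 + z)" for n
    using has_bochner_integral_integral_eq[OF has_bochner_integral_step[of z f "real n"]] z
    by (simp add: sum_divide_distrib)
  ultimately have "(\<lambda>n. (\<Sum>g\<in>le (real n). f g * dterm z g) / (1 + z)) \<longlonglongrightarrow> integral\<^sup>L lborel ?l"
    by simp
  moreover have "(\<lambda>n. (\<Sum>g\<in>le (real n). f g * dterm z g) / (1 + z)) \<longlonglongrightarrow> dseries f z / (1 + z)"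
  proof (intro tendsto_divide tendsto_const)
    show "(\<lambda>n. \<Sum>g\<in>le (real n). f g * dterm z g) \<longlonglongrightarrow> dseries f z"
      unfolding dseries_def
      by (rule filterlim_compose[OF sum_le_tendsto[OF mult_dterm_summable[OF z f]] filterlim_real_sequentially])
  qed (use z in \<open>auto simp: complex_eq_iff\<close>)
  ultimately show "(LINT u:{0..}|lborel. summ f (exp u) * exp (- (1 + z) * of_real u)) = dseries f z / (1 + z)"
    unfolding set_lebesgue_integral_def by (rule LIMSEQ_unique)
qed

abbreviation zeta :: "complex \<Rightarrow> complex" where "zeta \<equiv> dseries (\<lambda>_. 1)"

abbreviation zeta_inv :: "complex \<Rightarrow> complex" where "zeta_inv \<equiv> dseries moebius"

text \<open>Grouping the product by pairs with \<open>nm h * nm k \<le> x\<close> makes every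
  partial sum with \<open>x \<ge> 1\<close> exactly 1 by Moebius inversion; dominated convergence
  identifies the limit with the product of the two series.\<close>

lemma zeta_inv_mult_zeta:
  assumes z: "Re z > 0"
  shows "zeta_inv z * zeta z = 1"
proof -
  define Z where "Z = infsum (\<lambda>g. norm (dterm z g)) UNIV"
  have abs: "(\<lambda>g. norm (dterm z g)) summable_on UNIV" by (rule dterm_abs_summable[OF z])
  have Zb: "(\<Sum>g\<in>A. norm (dterm z g)) \<le> Z" if "finite A" for A
    unfolding Z_def by (rule finite_sum_le_infsum[OF abs]) (use that in auto)
  have Z0: "Z \<ge> 0" using Zb[of "{}"] by simp
  have zs: "(\<lambda>g. 1 * dterm z g) summable_on UNIV" by (rule mult_dterm_summable[OF z]) simp
  have lim1: "((\<lambda>x. \<Sum>h\<in>le x. moebius h * dterm z h * (\<Sum>k\<in>le (x / nm h). dterm z k))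
      \<longlongrightarrow> infsum (\<lambda>h. moebius h * dterm z h * zeta z) UNIV) at_top"
  proof (rule tendsto_sum_dominated[where g = "\<lambda>h. norm (dterm z h) * Z"])
    show "(\<lambda>h. norm (dterm z h) * Z) summable_on UNIV"
      by (intro summable_on_cmult_left abs)
  next
    fix x h
    have "norm (\<Sum>k\<in>le (x / nm h). dterm z k) \<le> Z"
      using sum_norm_le[of "le (x / nm h)" "dterm z" "\<lambda>k. norm (dterm z k)"] Zb[of "le (x / nm h)"] by simp
    hence "norm (moebius h) * norm (dterm z h) * norm (\<Sum>k\<in>le (x / nm h). dterm z k) \<le> 1 * norm (dterm z h) * Z"
      by (intro mult_mono norm_moebius_le_1) auto
    thus "norm (moebius h * dterm z h * (\<Sum>k\<in>le (x / nm h). dterm z k)) \<le> norm (dterm z h) * Z"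
      by (simp add: norm_mult)
  next
    fix h
    have "norm (zeta z) \<le> Z"
      unfolding dseries_def Z_def using norm_infsum_bound[of "\<lambda>g. 1 * dterm z g" UNIV] abs by simp
    hence "norm (moebius h) * norm (dterm z h) * norm (zeta z) \<le> 1 * norm (dterm z h) * Z"
      by (intro mult_mono norm_moebius_le_1) auto
    thus "norm (moebius h * dterm z h * zeta z) \<le> norm (dterm z h) * Z"
      by (simp add: norm_mult)
  next
    fix h
    have "filterlim (\<lambda>x. x / nm h) at_top at_top"
      by (rule filterlim_divide_const_at_top) simp
    hence "((\<lambda>x. \<Sum>k\<in>le (x / nm h). dterm z k) \<longlongrightarrow> zeta z) at_top"
      using filterlim_compose[OF sum_le_tendsto[OF zs]] by (simp add: dseries_def)
    hence "((\<lambda>x. moebius h * dterm z h * (\<Sum>k\<in>le (x / nm h). dterm z k)) \<longlongrightarrow> moebius h * dterm z h * zeta z) at_top"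
      by (intro tendsto_intros)
    moreover have "eventually (\<lambda>x. moebius h * dterm z h * (\<Sum>k\<in>le (x / nm h). dterm z k)
        = (if h \<in> le x then moebius h * dterm z h * (\<Sum>k\<in>le (x / nm h). dterm z k) else 0)) at_top"
      using eventually_ge_at_top[of "nm h"] by eventually_elim (auto)
    ultimately show "((\<lambda>x. if h \<in> le x then moebius h * dterm z h * (\<Sum>k\<in>le (x / nm h). dterm z k) else 0)
       \<longlongrightarrow> moebius h * dterm z h * zeta z) at_top"
      by (rule Lim_transform_eventually)
  qed auto
  have "(\<Sum>h\<in>le x. moebius h * dterm z h * (\<Sum>k\<in>le (x / nm h). dterm z k)) = 1" if "x \<ge> 1" for x
  proof -
    have "(\<Sum>h\<in>le x. moebius h * dterm z h * (\<Sum>k\<in>le (x / nm h). dterm z k))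
       = (\<Sum>h\<in>le x. \<Sum>k\<in>le (x / nm h). moebius h * dterm z h * dterm z k)"
      by (simp add: sum_distrib_left)
    also have "\<dots> = (\<Sum>g\<in>le x. \<Sum>h | h \<subseteq># g. moebius h * dterm z h * dterm z (g - h))"
      by (rule sum_divisors_swap[symmetric])
    also have "\<dots> = (\<Sum>g\<in>le x. \<Sum>h | h \<subseteq># g. moebius h * dterm z g)"
      by (intro sum.cong refl) (auto simp: mult.assoc simp flip: dterm_plus)
    also have "\<dots> = (\<Sum>g\<in>le x. (if g = {#} then dterm z g else 0))"
      by (intro sum.cong refl) (simp add: sum_moebius_divisors flip: sum_distrib_right)
    also have "\<dots> = 1" using that by simp
    finally show ?thesis .
  qed
  hence "eventually (\<lambda>x. (\<Sum>h\<in>le x. moebius h * dterm z h * (\<Sum>k\<in>le (x / nm h). dterm z k)) = 1) at_top"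
    by (rule eventually_at_top_linorderI)
  hence "((\<lambda>x. \<Sum>h\<in>le x. moebius h * dterm z h * (\<Sum>k\<in>le (x / nm h). dterm z k)) \<longlongrightarrow> 1) at_top"
    by (rule tendsto_eventually)
  from tendsto_unique[OF _ lim1 this]
  have "infsum (\<lambda>h. moebius h * dterm z h * zeta z) UNIV = 1" by simp
  moreover have "infsum (\<lambda>h. moebius h * dterm z h * zeta z) UNIV = zeta_inv z * zeta z"
    unfolding dseries_def[of moebius] by (rule infsum_cmult_left')
  ultimately show ?thesis by simp
qed

text \<open>The finite products are sums over squarefree elements with primes of norm up to
  \<open>x\<close>. An element of norm at most \<open>x\<close> is among them unless its Moebius
  value is 0, so the absolutely convergent series is reached by dominated convergence.\<close>

lemma zeta_inv_euler_tendsto: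
  assumes z: "Re z > 0"
  shows "((\<lambda>x. \<Prod>p | N p \<le> x. 1 - dterm z {#p#}) \<longlongrightarrow> zeta_inv z) at_top"
proof -
  let ?A = "\<lambda>x. {g. squarefree_mset g \<and> set_mset g \<subseteq> {p. N p \<le> x}}"
  have "((\<lambda>x. \<Sum>g\<in>?A x. moebius g * dterm z g) \<longlongrightarrow> infsum (\<lambda>g. moebius g * dterm z g) UNIV) at_top"
  proof (rule tendsto_sum_dominated[where g = "\<lambda>h. norm (dterm z h)"])
    show "finite (?A x)" for x by (simp add: squarefree_mset_over_eq_image)
    show "(\<lambda>h. norm (dterm z h)) summable_on UNIV" by (rule dterm_abs_summable[OF z])
    show *: "norm (moebius g * dterm z g) \<le> norm (dterm z g)" for g
      using norm_moebius_le_1[of g] by (simp add: norm_mult mult_left_le_one_le)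
    show "norm (moebius g * dterm z g) \<le> norm (dterm z g)" for g by (rule *)
    fix g :: "'p multiset"
    have "eventually (\<lambda>x. (if g \<in> ?A x then moebius g * dterm z g else 0) = moebius g * dterm z g) at_top"
      using eventually_ge_at_top[of "nm g"]
    proof eventually_elim
      case (elim x)
      have "set_mset g \<subseteq> {p. N p \<le> x}" using N_le_nm elim by fastforce
      thus ?case using moebius_eq_0[of g] by auto
    qed
    thus "((\<lambda>x. if g \<in> ?A x then moebius g * dterm z g else 0) \<longlongrightarrow> moebius g * dterm z g) at_top"
      by (rule tendsto_eventually)
  qed
  moreover have "(\<Sum>g\<in>?A x. moebius g * dterm z g) = (\<Prod>p | N p \<le> x. 1 - dterm z {#p#})" for x
    using sum_moebius_squarefree_over[of "{p. N p \<le> x}" "\<lambda>p. dterm z {#p#}"]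
    by (simp flip: dterm_prod)
  ultimately show ?thesis by (simp add: dseries_def)
qed

text \<open>\<open>three_four_one\<close> holds factor by factor in the Euler product, with
  \<open>r\<close> the modulus and \<open>w\<close> the phase of the Dirichlet term of a prime at
  \<open>Complex \<sigma> t\<close>; doubling \<open>t\<close> squares the phase.\<close>

lemma zeta_inv_three_four_one:
  fixes \<sigma> t :: real
  assumes "\<sigma> > 0"
  shows "norm (zeta_inv (of_real \<sigma>)) ^ 3 * norm (zeta_inv (Complex \<sigma> t)) ^ 4 * norm (zeta_inv (Complex \<sigma> (2 * t))) \<le> 1"
proof -
  define P where "P = (\<lambda>z x. \<Prod>p | N p \<le> x. 1 - dterm z {#p#})"
  have "((\<lambda>x. norm (P (of_real \<sigma>) x) ^ 3 * norm (P (Complex \<sigma> t) x) ^ 4 * norm (P (Complex \<sigma> (2 * t)) x))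
    \<longlongrightarrow> norm (zeta_inv (of_real \<sigma>)) ^ 3 * norm (zeta_inv (Complex \<sigma> t)) ^ 4 * norm (zeta_inv (Complex \<sigma> (2 * t)))) at_top"
    unfolding P_def by (intro tendsto_intros zeta_inv_euler_tendsto) (use assms in auto)
  moreover have "norm (P (of_real \<sigma>) x) ^ 3 * norm (P (Complex \<sigma> t) x) ^ 4 * norm (P (Complex \<sigma> (2 * t)) x) \<le> 1" for x
  proof -
    have "norm (1 - dterm (of_real \<sigma>) {#p#}) ^ 3 * norm (1 - dterm (Complex \<sigma> t) {#p#}) ^ 4 * norm (1 - dterm (Complex \<sigma> (2 * t)) {#p#}) \<le> 1" for p
    proof -
      define l where "l = ln (N p)"
      have l: "l > 0" using N_gt_1[of p] by (simp add: l_def)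
      define r where "r = exp (- (1 + \<sigma>) * l)"
      define w where "w = exp (- (\<i> * of_real (t * l)))"
      have "0 < r" "r < 1" using assms l by (auto simp: r_def intro!: mult_neg_pos)
      moreover have "norm w = 1" by (simp add: w_def norm_exp_eq_Re)
      moreover have "dterm (of_real \<sigma>) {#p#} = of_real r"
        unfolding dterm_def r_def l_def[symmetric] gnorm_add_mset gnorm_empty mult_1_right
        by (simp flip: exp_of_real)
      moreover have "dterm (Complex \<sigma> t) {#p#} = of_real r * w"
        unfolding dterm_def r_def w_def by (simp add: Complex_eq l_def algebra_simps flip: exp_add exp_of_real)
      moreover have "dterm (Complex \<sigma> (2 * t)) {#p#} = of_real r * w\<^sup>2"
        unfolding dterm_def r_def w_def
        by (simp add: Complex_eq l_def algebra_simps power2_eq_square flip: exp_add exp_of_real)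
      ultimately show ?thesis using three_four_one[of r w] by simp
    qed
    hence "(\<Prod>p | N p \<le> x. norm (1 - dterm (of_real \<sigma>) {#p#}) ^ 3 * norm (1 - dterm (Complex \<sigma> t) {#p#}) ^ 4 * norm (1 - dterm (Complex \<sigma> (2 * t)) {#p#})) \<le> 1"
      by (intro prod_le_1) auto
    thus ?thesis unfolding P_def
      by (simp add: prod.distrib prod_power_distrib flip: prod_norm)
  qed
  ultimately show ?thesis by (intro tendsto_upperbound) auto
qed

section \<open>Zeta on the closed half plane\<close>

definition err :: "real \<Rightarrow> real" where "err u = count_G N (exp u) * exp (- u) - c"

lemma count_exp_measurable [measurable]: "(\<lambda>u. count_G N (exp u)) \<in> borel_measurable borel"
  by (rule borel_measurable_mono) (auto intro!: monoI count_G_mono)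

lemma err_measurable [measurable]: "err \<in> borel_measurable borel"
  unfolding err_def by measurable

lemma abs_err_le: "u \<ge> 0 \<Longrightarrow> \<bar>err u\<bar> \<le> C * exp (- (1 - \<eta>) * u)"
proof -
  assume u: "u \<ge> 0"
  have "\<bar>count_G N (exp u) - c * exp u\<bar> \<le> C * exp (\<eta> * u)"
    using count_approx[of "exp u"] u by (simp add: powr_def)
  hence "\<bar>count_G N (exp u) - c * exp u\<bar> * exp (- u) \<le> C * exp (\<eta> * u) * exp (- u)"
    by (intro mult_right_mono) auto
  moreover have "err u = (count_G N (exp u) - c * exp u) * exp (- u)"
    by (simp add: err_def algebra_simps flip: exp_add)
  moreover have "C * exp (\<eta> * u) * exp (- u) = C * exp (- (1 - \<eta>) * u)"
    by (simp add: algebra_simps flip: exp_add)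
  ultimately show ?thesis by (simp add: abs_mult)
qed

text \<open>Laplace transform of the relative error of Axiom A. Because \<open>err\<close> decays
  like \<open>exp (- (1 - \<eta>) * u)\<close>, the integral converges on the boundary
  \<open>Re z = 0\<close> too.\<close>

definition H :: "complex \<Rightarrow> complex" where
  "H z = (LINT u|lborel. indicator {0..} u *\<^sub>R (of_real (err u) * exp (- z * of_real u)))"

lemma H_integrable:
  assumes z: "Re z \<ge> 0"
  shows "integrable lborel (\<lambda>u. indicator {0..} u *\<^sub>R (of_real (err u) * exp (- z * of_real u)))"
proof (rule Bochner_Integration.integrable_bound)
  show "integrable lborel (\<lambda>u. C * (indicator {0..} u *\<^sub>R exp (- (1 - \<eta>) * u)))"
    using set_integrable_exp_minus(1)[of "1 - \<eta>" 0] eta_less_1 by (simp add: set_integrable_def)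
  show "(\<lambda>u. indicator {0..} u *\<^sub>R (complex_of_real (err u) * exp (- z * of_real u))) \<in> borel_measurable lborel"
    by measurable
  show "AE u in lborel. norm (indicator {0..} u *\<^sub>R (complex_of_real (err u) * exp (- z * of_real u)))
      \<le> norm (C * (indicator {0..} u *\<^sub>R exp (- (1 - \<eta>) * u)))"
  proof (rule AE_I2)
    fix u :: real
    show "norm (indicator {0..} u *\<^sub>R (complex_of_real (err u) * exp (- z * of_real u)))
      \<le> norm (C * (indicator {0..} u *\<^sub>R exp (- (1 - \<eta>) * u)))"
    proof (cases "u \<ge> 0")
      case True
      have "norm (complex_of_real (err u) * exp (- z * of_real u)) = \<bar>err u\<bar> * exp (- Re z * u)"
        by (simp add: norm_mult)
      also have "\<dots> \<le> \<bar>err u\<bar> * 1" using z True by (intro mult_left_mono) auto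
      also have "\<dots> \<le> C * exp (- (1 - \<eta>) * u)" using abs_err_le[OF True] by simp
      finally show ?thesis using True C_nonneg by (simp add: abs_mult)
    qed simp
  qed
qed

text \<open>The kernel \<open>exp (- z * u)\<close> changes by at most
  \<open>u * norm (z - z')\<close>, and the factor \<open>u\<close> is still integrable against the
  decay of \<open>err\<close>. This takes the place of differentiability on the boundary
  line.\<close>

lemma H_lipschitz:
  "\<exists>K>0. \<forall>z z'. Re z \<ge> 0 \<longrightarrow> Re z' \<ge> 0 \<longrightarrow> norm (H z - H z') \<le> K * norm (z - z')"
proof -
  let ?w = "\<lambda>u. indicator {0..} u * (u * exp (- (1 - \<eta>) * u))"
  define W where "W = (LINT u|lborel. ?w u)"
  define K where "K = C * W"
  have w: "integrable lborel ?w"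
    using set_integrable_ident_exp_minus[of "1 - \<eta>"] eta_less_1 by (simp add: set_integrable_def)
  have "norm (H z - H z') \<le> (\<bar>K\<bar> + 1) * norm (z - z')" if z: "Re z \<ge> 0" "Re z' \<ge> 0" for z z'
  proof -
    let ?f = "\<lambda>z u. indicator {0..} u *\<^sub>R (complex_of_real (err u) * exp (- z * of_real u))"
    have eq: "H z - H z' = (LINT u|lborel. ?f z u - ?f z' u)"
      unfolding H_def by (rule Bochner_Integration.integral_diff[symmetric]) (use z H_integrable in auto)
    have "norm (H z - H z') \<le> (LINT u|lborel. (C * norm (z - z')) * ?w u)"
      unfolding eq
    proof (rule Bochner_Integration.integral_norm_bound_integral)
      show "integrable lborel (\<lambda>u. ?f z u - ?f z' u)"
        by (intro Bochner_Integration.integrable_diff H_integrable z)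
      show "integrable lborel (\<lambda>u. (C * norm (z - z')) * ?w u)"
        by (intro integrable_mult_right w)
      fix u :: real
      show "norm (?f z u - ?f z' u) \<le> (C * norm (z - z')) * ?w u"
      proof (cases "u \<ge> 0")
        case True
        have "norm (exp (- z * of_real u) - exp (- z' * of_real u)) \<le> norm (- z * of_real u - - z' * of_real u)"
          by (rule norm_exp_diff_le) (use z True in auto)
        also have "- z * of_real u - - z' * of_real u = - ((z - z') * of_real u)" by (simp add: algebra_simps)
        also have "norm \<dots> = norm (z - z') * u" using True by (simp add: norm_mult)
        finally have *: "\<bar>err u\<bar> * norm (exp (- z * of_real u) - exp (- z' * of_real u))
          \<le> (C * exp (- (1 - \<eta>) * u)) * (norm (z - z') * u)"
          using abs_err_le[OF True] C_nonneg by (intro mult_mono) auto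
        have "?f z u - ?f z' u = of_real (err u) * (exp (- z * of_real u) - exp (- z' * of_real u))"
          using True by (simp add: right_diff_distrib)
        hence "norm (?f z u - ?f z' u) = \<bar>err u\<bar> * norm (exp (- z * of_real u) - exp (- z' * of_real u))"
          by (simp only: norm_mult norm_of_real)
        moreover have "(C * exp (- (1 - \<eta>) * u)) * (norm (z - z') * u) = (C * norm (z - z')) * ?w u"
          using True by simp
        ultimately show ?thesis using * by linarith
      next
        case False
        hence "indicator {0..} u = (0::real)" by simp
        thus ?thesis by (simp only: mult_zero_left mult_zero_right scaleR_zero_left diff_self norm_zero)
      qed
    qed
    also have "\<dots> = (C * norm (z - z')) * W"
      unfolding W_def by (rule Bochner_Integration.integral_mult_right_zero)
    also have "\<dots> = K * norm (z - z')" by (simp add: K_def)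
    also have "\<dots> \<le> (\<bar>K\<bar> + 1) * norm (z - z')" by (intro mult_right_mono) auto
    finally show ?thesis .
  qed
  thus ?thesis by (intro exI[of _ "\<bar>K\<bar> + 1"]) auto
qed

text \<open>\<open>D z = z * zeta z / (1 + z)\<close>, in a form that makes sense on the closed half plane.\<close>

definition D :: "complex \<Rightarrow> complex" where "D z = of_real c + z * H z"

text \<open>The density \<open>c\<close> in the counting function contributes \<open>c / z\<close>,
  the pole; the remainder contributes \<open>H z\<close>.\<close>

lemma zeta_eq_D:
  assumes z: "Re z > 0"
  shows "zeta z = (1 + z) * D z / z"
proof -
  have z0: "z \<noteq> 0" "1 + z \<noteq> 0" using z by (auto simp: complex_eq_iff)
  have eq: "indicator {0..} u *\<^sub>R (summ (\<lambda>_. 1) (exp u) * exp (- (1 + z) * of_real u))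
     = indicator {0..} u *\<^sub>R (of_real (err u) * exp (- z * of_real u))
       + of_real c * (indicator {0..} u *\<^sub>R exp (- z * of_real u))" for u
  proof -
    have "exp (- (1 + z) * of_real u) = of_real (exp (- u)) * exp (- z * of_real u)"
      by (simp add: algebra_simps flip: exp_add exp_of_real)
    thus ?thesis
      by (simp add: summ_def err_def count_G_eq algebra_simps indicator_def)
  qed
  have "zeta z / (1 + z) = (LINT u:{0..}|lborel. summ (\<lambda>_. 1) (exp u) * exp (- (1 + z) * of_real u))"
    using laplace_summ(2)[OF z, of "\<lambda>_. 1"] by simp
  also have "\<dots> = (LINT u|lborel. indicator {0..} u *\<^sub>R (of_real (err u) * exp (- z * of_real u))
       + of_real c * (indicator {0..} u *\<^sub>R exp (- z * of_real u)))"
    unfolding set_lebesgue_integral_def eq ..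
  also have "\<dots> = H z + of_real c * (LINT u:{0..}|lborel. exp (- z * of_real u))"
  proof -
    have "integrable lborel (\<lambda>u. of_real c * (indicator {0..} u *\<^sub>R exp (- z * of_real u)))"
      using set_integrable_exp_minus_complex[OF z, of 0] unfolding set_integrable_def
      by (intro integrable_mult_right)
    from Bochner_Integration.integral_add[OF H_integrable[of z] this] show ?thesis
      using z unfolding H_def set_lebesgue_integral_def Bochner_Integration.integral_mult_right_zero by simp
  qed
  also have "\<dots> = D z / z"
    using integral_exp_minus_complex[OF z, of 0] z0 by (simp add: D_def field_simps)
  finally show ?thesis using z0 by (simp add: field_simps)
qed

lemma zeta_inv_mult_D:
  assumes z: "Re z > 0"
  shows "zeta_inv z * ((1 + z) * D z) = z"
proof -
  have z0: "z \<noteq> 0" using z by auto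
  have "zeta_inv z * ((1 + z) * D z / z) = 1" using zeta_inv_mult_zeta[OF z] zeta_eq_D[OF z] by simp
  thus ?thesis using z0 by (simp add: field_simps)
qed

lemma continuous_on_D: "continuous_on {z. Re z \<ge> 0} D"
proof -
  obtain K where K: "K > 0" "\<And>z z'. Re z \<ge> 0 \<Longrightarrow> Re z' \<ge> 0 \<Longrightarrow> norm (H z - H z') \<le> K * norm (z - z')"
    using H_lipschitz by blast
  have "continuous_on {z. Re z \<ge> 0} H"
    by (rule lipschitz_on_continuous_on[of K]) (use K in \<open>auto intro!: lipschitz_onI simp: dist_norm\<close>)
  thus ?thesis unfolding D_def by (intro continuous_intros)
qed

text \<open>A zero of \<open>D\<close> at height \<open>t\<close> would have order at least one
  because \<open>H\<close> is Lipschitz, so the inverse of zeta at \<open>Complex \<sigma> t\<close>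
  would be at least a multiple of \<open>1 / \<sigma>\<close>, while at \<open>\<sigma>\<close> it
  behaves like \<open>\<sigma> / c\<close>. The 3-4-1 inequality then forces the inverse of zeta at
  height \<open>2 * t\<close> to be \<open>O(\<sigma>)\<close>, contradicting the boundedness of
  \<open>D\<close> there.\<close>

lemma D_neq_0_imaginary:
  assumes t: "t \<noteq> (0::real)"
  shows "D (Complex 0 t) \<noteq> 0"
proof
  assume D0: "D (Complex 0 t) = 0"
  obtain K where K: "K > 0" "\<And>z z'. Re z \<ge> 0 \<Longrightarrow> Re z' \<ge> 0 \<Longrightarrow> norm (H z - H z') \<le> K * norm (z - z')"
    using H_lipschitz by blast
  have contD: "((\<lambda>\<sigma>. D (Complex \<sigma> s)) \<longlongrightarrow> D (Complex 0 s)) (at_right 0)" for s :: real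
  proof -
    have "continuous_on {0..} (\<lambda>\<sigma>. D (Complex \<sigma> s))"
      by (rule continuous_on_compose2[OF continuous_on_D])
         (auto simp: Complex_eq intro!: continuous_intros)
    hence "((\<lambda>\<sigma>. D (Complex \<sigma> s)) \<longlongrightarrow> D (Complex 0 s)) (at 0 within {0..})"
      by (auto simp: continuous_on_def)
    thus ?thesis by (rule tendsto_mono[rotated]) (auto intro: at_le)
  qed
  have contC: "((\<lambda>\<sigma>. Complex \<sigma> s) \<longlongrightarrow> Complex 0 s) (at_right 0)" for s :: real
    unfolding Complex_eq by (auto intro!: tendsto_eq_intros)
  \<comment> \<open>From \<open>D z - D z' = (z - z') * H z' + z * (H z - H z')\<close> with
    \<open>norm z \<le> norm (Complex 1 t)\<close>; the summand 1 makes \<open>K'\<close>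
    positive.\<close>
  define K' where "K' = norm (H (Complex 0 t)) + K * norm (Complex 1 t) + 1"
  have Dle: "norm (D (Complex \<sigma> t)) \<le> K' * \<sigma>" if \<sigma>: "0 < \<sigma>" "\<sigma> < 1" for \<sigma>
  proof -
    let ?z = "Complex \<sigma> t" and ?z' = "Complex 0 t"
    have "D ?z = D ?z - D ?z'" using D0 by simp
    also have "\<dots> = (?z - ?z') * H ?z' + ?z * (H ?z - H ?z')" by (simp add: D_def algebra_simps)
    also have "norm \<dots> \<le> norm (?z - ?z') * norm (H ?z') + norm ?z * norm (H ?z - H ?z')"
      by (metis norm_mult norm_triangle_ineq)
    also have "norm (H ?z - H ?z') \<le> K * norm (?z - ?z')" using K(2)[of ?z ?z'] \<sigma> by simp
    hence "norm ?z * norm (H ?z - H ?z') \<le> norm (Complex 1 t) * (K * norm (?z - ?z'))"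
      using \<sigma> K by (intro mult_mono) (auto simp: cmod_def intro!: power_le_one)
    also have "norm (?z - ?z') = \<sigma>" using \<sigma> by (simp add: cmod_def)
    finally have "norm (D ?z) \<le> \<sigma> * norm (H ?z') + norm (Complex 1 t) * (K * \<sigma>)" by simp
    also have "\<dots> \<le> K' * \<sigma>" using \<sigma> by (simp add: K'_def algebra_simps)
    finally show ?thesis .
  qed
  have K': "K' > 0" using K(1) by (simp add: K'_def add_nonneg_pos)
  define A where "A = (\<lambda>\<sigma>. norm (zeta_inv (of_real \<sigma>)) / \<sigma>)"
  define A' where "A' = (\<lambda>\<sigma>. norm (Complex \<sigma> t) / (norm (1 + Complex \<sigma> t) * K'))"
  define R where "R = (\<lambda>\<sigma>. norm (zeta_inv (Complex \<sigma> (2 * t))))"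
  \<comment> \<open>The quantities are normalised to have limits: as \<open>\<sigma>\<close> tends
    to 0 the left side tends to a positive number, the right side to 0.\<close>
  have ev: "eventually (\<lambda>\<sigma>. A \<sigma> ^ 3 * A' \<sigma> ^ 4 * norm (Complex \<sigma> (2 * t))
     \<le> \<sigma> * norm (1 + Complex \<sigma> (2 * t)) * norm (D (Complex \<sigma> (2 * t)))) (at_right (0::real))"
  proof -
    have "eventually (\<lambda>\<sigma>. 0 < \<sigma> \<and> \<sigma> < (1::real)) (at_right 0)"
      by (auto intro: eventually_at_rightI[of 0 1])
    thus ?thesis
    proof eventually_elim
      case (elim \<sigma>)
      hence \<sigma>: "0 < \<sigma>" "\<sigma> < 1" by auto
      let ?z = "Complex \<sigma> t" and ?z2 = "Complex \<sigma> (2 * t)"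
      have "norm ?z = norm (zeta_inv ?z) * (norm (1 + ?z) * norm (D ?z))"
        using arg_cong[OF zeta_inv_mult_D[of ?z], of norm] \<sigma> by (simp add: norm_mult)
      also have "\<dots> \<le> norm (zeta_inv ?z) * (norm (1 + ?z) * (K' * \<sigma>))"
        using Dle[OF \<sigma>] by (intro mult_left_mono) auto
      finally have "A' \<sigma> \<le> norm (zeta_inv ?z) * \<sigma>"
      proof -
        assume *: "norm ?z \<le> norm (zeta_inv ?z) * (norm (1 + ?z) * (K' * \<sigma>))"
        have "1 + ?z \<noteq> 0" using t by (auto simp: complex_eq_iff)
        hence "norm (1 + ?z) * K' > 0" using K' by simp
        thus ?thesis using * unfolding A'_def by (simp add: pos_divide_le_eq mult_ac)
      qed
      hence "A' \<sigma> ^ 4 \<le> (norm (zeta_inv ?z) * \<sigma>) ^ 4"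
        using K' by (intro power_mono) (auto simp: A'_def)
      hence "A \<sigma> ^ 3 * A' \<sigma> ^ 4 * R \<sigma> \<le> A \<sigma> ^ 3 * (norm (zeta_inv ?z) * \<sigma>) ^ 4 * R \<sigma>"
        using \<sigma> by (intro mult_right_mono mult_left_mono) (auto simp: A_def R_def)
      also have "\<dots> = \<sigma> * (norm (zeta_inv (of_real \<sigma>)) ^ 3 * norm (zeta_inv ?z) ^ 4 * R \<sigma>)"
        using \<sigma> by (simp add: A_def power_mult_distrib power_divide field_simps power3_eq_cube power4_eq_xxxx)
      also have "\<dots> \<le> \<sigma> * 1"
        unfolding R_def using zeta_inv_three_four_one[OF \<sigma>(1), of t] \<sigma> by (intro mult_left_mono) auto
      finally have 1: "A \<sigma> ^ 3 * A' \<sigma> ^ 4 * R \<sigma> \<le> \<sigma>" by simp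
      have "norm ?z2 = R \<sigma> * (norm (1 + ?z2) * norm (D ?z2))"
        using arg_cong[OF zeta_inv_mult_D[of ?z2], of norm] \<sigma> by (simp add: norm_mult R_def)
      hence "A \<sigma> ^ 3 * A' \<sigma> ^ 4 * norm ?z2 = (A \<sigma> ^ 3 * A' \<sigma> ^ 4 * R \<sigma>) * (norm (1 + ?z2) * norm (D ?z2))"
        by (simp add: mult_ac)
      also have "\<dots> \<le> \<sigma> * (norm (1 + ?z2) * norm (D ?z2))"
        by (intro mult_right_mono 1) auto
      finally show ?case by (simp add: mult.assoc)
    qed
  qed
  have A_lim: "(A \<longlongrightarrow> 1 / c) (at_right 0)"
  proof -
    have "((\<lambda>\<sigma>. 1 / norm ((1 + Complex \<sigma> 0) * D (Complex \<sigma> 0))) \<longlongrightarrow> 1 / norm ((1 + Complex 0 0) * D (Complex 0 0))) (at_right 0)"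
      by (intro tendsto_intros contC contD) (use c_pos in \<open>auto simp: D_def complex_eq_iff\<close>)
    moreover have "D (Complex 0 0) = of_real c" "1 + Complex 0 0 = 1"
      by (auto simp: D_def Complex_eq)
    ultimately have "((\<lambda>\<sigma>. 1 / norm ((1 + Complex \<sigma> 0) * D (Complex \<sigma> 0))) \<longlongrightarrow> 1 / c) (at_right 0)"
      using c_pos by simp
    moreover have "eventually (\<lambda>\<sigma>. 1 / norm ((1 + Complex \<sigma> 0) * D (Complex \<sigma> 0)) = A \<sigma>) (at_right 0)"
      using eventually_at_right_less[of "0::real"]
    proof eventually_elim
      case (elim \<sigma>)
      have "norm (zeta_inv (of_real \<sigma>)) * norm ((1 + Complex \<sigma> 0) * D (Complex \<sigma> 0)) = \<sigma>"
        using arg_cong[OF zeta_inv_mult_D[of "of_real \<sigma>"], of norm] elim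
        unfolding complex_of_real_def[symmetric] by (simp add: norm_mult)
      moreover have "D (Complex \<sigma> 0) \<noteq> 0" using elim zeta_inv_mult_D[of "Complex \<sigma> 0"]
        by (auto simp: complex_eq_iff)
      moreover have "1 + Complex \<sigma> 0 \<noteq> 0" using elim by (auto simp: complex_eq_iff)
      ultimately have "norm (zeta_inv (of_real \<sigma>)) = \<sigma> / norm ((1 + Complex \<sigma> 0) * D (Complex \<sigma> 0))"
        by (metis nonzero_eq_divide_eq norm_eq_zero mult_eq_0_iff)
      thus ?case using elim by (simp add: A_def)
    qed
    ultimately show ?thesis by (rule Lim_transform_eventually)
  qed
  have "1 + Complex 0 t \<noteq> 0" by (auto simp: complex_eq_iff)
  hence lim1: "((\<lambda>\<sigma>. A \<sigma> ^ 3 * A' \<sigma> ^ 4 * norm (Complex \<sigma> (2 * t))) \<longlongrightarrow>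
     (1 / c) ^ 3 * (norm (Complex 0 t) / (norm (1 + Complex 0 t) * K')) ^ 4 * norm (Complex 0 (2 * t))) (at_right 0)"
    unfolding A'_def by (intro tendsto_intros A_lim contC) (use K' in auto)
  have lim2: "((\<lambda>\<sigma>. \<sigma> * norm (1 + Complex \<sigma> (2 * t)) * norm (D (Complex \<sigma> (2 * t)))) \<longlongrightarrow>
     0 * norm (1 + Complex 0 (2 * t)) * norm (D (Complex 0 (2 * t)))) (at_right 0)"
    by (intro tendsto_intros contC contD)
  have "(1 / c) ^ 3 * (norm (Complex 0 t) / (norm (1 + Complex 0 t) * K')) ^ 4 * norm (Complex 0 (2 * t))
     \<le> 0 * norm (1 + Complex 0 (2 * t)) * norm (D (Complex 0 (2 * t)))"
    by (rule tendsto_le[OF _ lim2 lim1 ev]) simp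
  moreover have "(1 / c) ^ 3 * (norm (Complex 0 t) / (norm (1 + Complex 0 t) * K')) ^ 4 * norm (Complex 0 (2 * t)) > 0"
    using c_pos K' t \<open>1 + Complex 0 t \<noteq> 0\<close> by (intro mult_pos_pos zero_less_power divide_pos_pos) (auto simp: complex_eq_iff)
  ultimately show False by simp
qed

lemma D_neq_0:
  assumes z: "Re z \<ge> 0"
  shows "D z \<noteq> 0"
proof (cases "Re z > 0")
  case True
  thus ?thesis using zeta_inv_mult_D[OF True] by auto
next
  case False
  hence eq: "z = Complex 0 (Im z)" using z by (simp add: complex_eq_iff)
  show ?thesis
  proof (cases "Im z = 0")
    case True
    hence "z = 0" using eq by (simp add: complex_eq_iff)
    thus ?thesis using c_pos by (simp add: D_def)
  qed (use D_neq_0_imaginary eq in metis)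
qed

text \<open>The continuous extension of the Laplace transform of \<open>exp (-u) * summ moebius (exp u)\<close>
  to the closed half plane.\<close>

definition lap :: "complex \<Rightarrow> complex" where "lap z = z / ((1 + z)\<^sup>2 * D z)"

lemma continuous_on_lap: "continuous_on {z. Re z \<ge> 0} lap"
  unfolding lap_def
proof (intro continuous_intros continuous_on_D ballI)
  fix z :: complex assume "z \<in> {z. Re z \<ge> 0}"
  hence "D z \<noteq> 0" "1 + z \<noteq> 0" using D_neq_0[of z] by (auto simp: complex_eq_iff)
  thus "(1 + z)\<^sup>2 * D z \<noteq> 0" by simp
qed

lemma laplace_moebius:
  assumes z: "Re z > 0"
  shows "(LINT u:{0..}|lborel. summ moebius (exp u) * exp (- (1 + z) * of_real u)) = lap z"
proof -
  have "1 + z \<noteq> 0" "D z \<noteq> 0" using z D_neq_0[of z] by (auto simp: complex_eq_iff)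
  have "lap z = zeta_inv z * ((1 + z) * D z) / ((1 + z)\<^sup>2 * D z)"
    unfolding lap_def zeta_inv_mult_D[OF z] ..
  hence "zeta_inv z / (1 + z) = lap z"
    using \<open>1 + z \<noteq> 0\<close> \<open>D z \<noteq> 0\<close> by (simp add: power2_eq_square)
  thus ?thesis using laplace_summ(2)[OF z, of moebius, OF norm_moebius_le_1] by simp
qed

section \<open>Mean value of the Moebius function\<close>

lemma norm_summ_diff_le:
  assumes f: "\<And>g. norm (f g) \<le> 1" and xy: "x \<le> y"
  shows "norm (summ f y - summ f x) \<le> count_G N y - count_G N x"
proof -
  have sub: "le x \<subseteq> le y" using xy by (auto intro: order_trans)
  have "summ f y - summ f x = (\<Sum>g\<in>le y - le x. f g)"
    unfolding summ_def using sum_diff[OF finite_le' sub, of f] by simp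
  also have "norm \<dots> \<le> real (card (le y - le x))"
    using sum_norm_le[of "le y - le x" f "\<lambda>_. 1"] f by simp
  also have "\<dots> = count_G N y - count_G N x"
    using sub by (simp add: count_G_eq card_Diff_subset of_nat_diff card_mono)
  finally show ?thesis .
qed

text \<open>The Moebius form of the prime number theorem. In the variable \<open>u = ln x\<close>
  the function \<open>summ moebius x / x\<close> is bounded with Laplace transform
  \<open>lap\<close>; it oscillates slowly since Axiom A bounds the number of elements in short
  multiplicative intervals.\<close>

theorem summ_moebius_tendsto_0: "((\<lambda>x. summ moebius x / of_real x) \<longlongrightarrow> 0) at_top"
proof -
  define f where "f = (\<lambda>u::real. indicator {0..} u *\<^sub>R (summ moebius (exp u) * of_real (exp (- u))))"
  have summ_le: "norm (summ moebius (exp u)) \<le> B * exp u" for u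
    using norm_sum_le_count[of moebius "exp u", OF norm_moebius_le_1] count_G_le[of "exp u"]
    unfolding summ_def by simp
  have nf: "norm (summ moebius (exp u) * of_real (exp (- u))) \<le> B" for u
  proof -
    have "norm (summ moebius (exp u)) * exp (- u) \<le> (B * exp u) * exp (- u)"
      by (intro mult_right_mono summ_le) auto
    thus ?thesis by (simp add: norm_mult mult.assoc flip: exp_add)
  qed
  have "(f \<longlongrightarrow> 0) at_top"
  proof (rule tauberian_slowly_oscillating)
    show "f \<in> borel_measurable borel" unfolding f_def by measurable
    show "f u = 0" if "u < 0" for u using that by (simp add: f_def)
    show "norm (f u) \<le> B" for u
      using nf[of u] B_ge_1 by (simp add: f_def indicator_def)
    show "(LINT u|lborel. f u * exp (- z * of_real u)) = lap z" if z: "Re z > 0" for z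
    proof -
      have "f u * exp (- z * of_real u) = indicator {0..} u *\<^sub>R (summ moebius (exp u) * exp (- (1 + z) * of_real u))" for u
      proof -
        have "complex_of_real (exp (- u)) * exp (- z * of_real u) = exp (- (1 + z) * of_real u)"
          by (simp add: algebra_simps flip: exp_add exp_of_real)
        thus ?thesis unfolding f_def by (metis mult.assoc mult_scaleR_left)
      qed
      thus ?thesis using laplace_moebius[OF z] by (simp only: set_lebesgue_integral_def)
    qed
    show "continuous_on {z. Re z \<ge> 0} lap" by (rule continuous_on_lap)
    fix e :: real assume e: "e > 0"
    \<comment> \<open>The change splits into the terms between \<open>exp x\<close> and
      \<open>exp y\<close> and the change of the weight \<open>exp (- x)\<close>.\<close>
    have osc_aux: "norm (f y - f x) \<le> (count_G N (exp y) - count_G N (exp x)) * exp (- x) + B * (exp (y - x) - 1)"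
      if "0 \<le> x" "x \<le> y" for x y
    proof -
      have "f y - f x = (summ moebius (exp y) - summ moebius (exp x)) * of_real (exp (- x))
          - summ moebius (exp y) * of_real (exp (- x) - exp (- y))"
        using that by (simp add: f_def algebra_simps)
      also have "norm \<dots> \<le> norm (summ moebius (exp y) - summ moebius (exp x)) * exp (- x)
          + norm (summ moebius (exp y)) * \<bar>exp (- x) - exp (- y)\<bar>"
        by (rule order_trans[OF norm_triangle_ineq4]) (simp only: norm_mult norm_of_real abs_exp_cancel order_refl)
      also have "norm (summ moebius (exp y) - summ moebius (exp x)) * exp (- x) \<le> (count_G N (exp y) - count_G N (exp x)) * exp (- x)"
        using norm_summ_diff_le[of moebius "exp x" "exp y", OF norm_moebius_le_1] that by (intro mult_right_mono) auto
      also have "norm (summ moebius (exp y)) * \<bar>exp (- x) - exp (- y)\<bar> \<le> (B * exp y) * (exp (- x) - exp (- y))"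
        using summ_le[of y] that B_ge_1 by (intro mult_mono) auto
      also have "(B * exp y) * (exp (- x) - exp (- y)) = B * (exp (y - x) - 1)"
        by (simp add: right_diff_distrib mult.assoc flip: exp_add)
      finally show ?thesis by simp
    qed
    define K where "K = c + B"
    have K: "K > 0" using c_pos B_ge_1 by (simp add: K_def)
    \<comment> \<open>Solves \<open>K * (exp d - 1) = e / 2\<close>, the limiting oscillation over a
      window of length \<open>d\<close>.\<close>
    define d where "d = ln (1 + e / (2 * K))"
    have eK: "e / (2 * K) > 0" using e K by simp
    have d: "d > 0" unfolding d_def by (rule ln_gt_zero) (use eK in linarith)
    have "exp d = 1 + e / (2 * K)" unfolding d_def by (rule exp_ln) (use eK in linarith)
    hence ed: "K * (exp d - 1) = e / 2" using K by simp
    have osc2: "norm (f y - f x) \<le> e / 2 + 2 * C * exp (\<eta> * (x + d)) * exp (- x)" if "0 \<le> x" "x \<le> y" "y \<le> x + d" for x y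
    proof -
      have pow: "exp t powr \<eta> = exp (\<eta> * t)" for t :: real by (simp add: powr_def)
      have "count_G N (exp y) \<le> c * exp y + C * exp (\<eta> * y)"
        using count_approx[of "exp y"] that pow[of y] by auto
      moreover have "count_G N (exp x) \<ge> c * exp x - C * exp (\<eta> * x)"
        using count_approx[of "exp x"] that pow[of x] by auto
      moreover have "C * exp (\<eta> * y) \<le> C * exp (\<eta> * (x + d))" "C * exp (\<eta> * x) \<le> C * exp (\<eta> * (x + d))"
        using that d C_nonneg eta_pos by (auto intro!: mult_left_mono)
      ultimately have "count_G N (exp y) - count_G N (exp x) \<le> c * (exp y - exp x) + 2 * C * exp (\<eta> * (x + d))"
        by (simp add: algebra_simps)
      hence "(count_G N (exp y) - count_G N (exp x)) * exp (- x) \<le> (c * (exp y - exp x) + 2 * C * exp (\<eta> * (x + d))) * exp (- x)"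
        by (intro mult_right_mono) auto
      also have "\<dots> = c * (exp (y - x) - 1) + 2 * C * exp (\<eta> * (x + d)) * exp (- x)"
        by (simp add: distrib_right right_diff_distrib left_diff_distrib mult.assoc flip: exp_add)
      finally have "norm (f y - f x) \<le> K * (exp (y - x) - 1) + 2 * C * exp (\<eta> * (x + d)) * exp (- x)"
        using osc_aux[OF that(1,2)] by (simp add: K_def algebra_simps)
      moreover have "K * (exp (y - x) - 1) \<le> K * (exp d - 1)" using K that by (intro mult_left_mono) auto
      ultimately show ?thesis using ed by linarith
    qed
    have "((\<lambda>v. 2 * C * exp (\<eta> * (v + d)) * exp (- (v - d))) \<longlongrightarrow> 0) at_top"
    proof -
      have "((\<lambda>v. exp (- (k * v))) \<longlongrightarrow> 0) at_top" if "k > 0" for k :: real using that by real_asymp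
      from tendsto_mult_right_zero[OF this[of "1 - \<eta>"], of "2 * C * exp (\<eta> * d + d)"]
      have "((\<lambda>v. 2 * C * exp (\<eta> * d + d) * exp (- ((1 - \<eta>) * v))) \<longlongrightarrow> 0) at_top"
        using eta_less_1 by simp
      moreover have "2 * C * exp (\<eta> * d + d) * exp (- ((1 - \<eta>) * v)) = 2 * C * exp (\<eta> * (v + d)) * exp (- (v - d))" for v
        by (simp add: mult.assoc algebra_simps flip: exp_add)
      ultimately show ?thesis by simp
    qed
    hence "eventually (\<lambda>v. 2 * C * exp (\<eta> * (v + d)) * exp (- (v - d)) < e / 2) at_top"
      using e by (intro order_tendstoD(2)) auto
    hence "eventually (\<lambda>v. \<forall>w. \<bar>w\<bar> \<le> d \<longrightarrow> norm (f (v - w) - f v) \<le> e) at_top"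
      using eventually_ge_at_top[of d]
    proof eventually_elim
      case (elim v)
      show ?case
      proof (intro allI impI)
        fix w :: real assume w: "\<bar>w\<bar> \<le> d"
        define x where "x = min v (v - w)"
        define y where "y = max v (v - w)"
        have xy: "0 \<le> x" "x \<le> y" "y \<le> x + d" "x \<le> v" "x \<ge> v - d" using w elim by (auto simp: x_def y_def)
        have "norm (f (v - w) - f v) = norm (f y - f x)"
          unfolding x_def y_def min_def max_def by (auto simp: norm_minus_commute)
        also have "\<dots> \<le> e / 2 + 2 * C * exp (\<eta> * (x + d)) * exp (- x)" by (rule osc2[OF xy(1-3)])
        also have "2 * C * exp (\<eta> * (x + d)) * exp (- x) \<le> 2 * C * exp (\<eta> * (v + d)) * exp (- (v - d))"
          using xy C_nonneg eta_pos by (intro mult_mono) auto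
        finally show "norm (f (v - w) - f v) \<le> e" using elim by linarith
      qed
    qed
    thus "\<exists>d>0. eventually (\<lambda>v. \<forall>w. \<bar>w\<bar> \<le> d \<longrightarrow> norm (f (v - w) - f v) \<le> e) at_top"
      using d by blast
  qed
  hence "((\<lambda>x. f (ln x)) \<longlongrightarrow> 0) at_top"
    by (rule filterlim_compose[OF _ ln_at_top])
  moreover have "eventually (\<lambda>x. f (ln x) = summ moebius x / of_real x) at_top"
    using eventually_ge_at_top[of 1]
  proof eventually_elim
    case (elim x)
    thus ?case by (simp add: f_def exp_minus field_simps)
  qed
  ultimately show ?thesis by (rule Lim_transform_eventually)
qed

subsection \<open>Rough and smooth elements\<close>

lemma N_neq_0 [simp]: "N p \<noteq> 0" using N_pos[of p] by linarith

definition restr :: "'p multiset set \<Rightarrow> ('p multiset \<Rightarrow> complex) \<Rightarrow> 'p multiset \<Rightarrow> complex" where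
  "restr A f g = (if g \<in> A then f g else 0)"

lemma summ_restr: "summ (restr A f) x = (\<Sum>g\<in>le x \<inter> A. f g)"
  unfolding summ_def restr_def by (simp add: sum.inter_restrict)

lemma norm_restr_le: "(\<And>g. norm (f g) \<le> 1) \<Longrightarrow> norm (restr A f g) \<le> 1"
  by (simp add: restr_def)

lemma norm_summ_le:
  assumes "\<And>g. norm (f g) \<le> 1" "x \<ge> 0"
  shows "norm (summ f x) \<le> B * x"
  using norm_sum_le_count[of f x] count_G_le[of x] assms unfolding summ_def by fastforce

text \<open>As \<open>A\<close> is closed under adding and removing \<open>p\<close>, division by
  \<open>p\<close> maps its multiples of \<open>p\<close> up to \<open>x\<close> bijectively to its
  elements up to \<open>x / N p\<close>.\<close>

lemma sum_split_prime:
  fixes f :: "'p multiset \<Rightarrow> 'b::comm_monoid_add"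
  assumes cl: "\<And>h. add_mset p h \<in> A \<longleftrightarrow> h \<in> A"
  shows "(\<Sum>g\<in>le x \<inter> A. f g) = (\<Sum>g\<in>le x \<inter> (A \<inter> {g. p \<notin># g}). f g) + (\<Sum>h\<in>le (x / N p) \<inter> A. f (add_mset p h))"
proof -
  have eq: "add_mset p ` (le (x / N p) \<inter> A) = le x \<inter> A \<inter> {g. p \<in># g}"
  proof (intro equalityI subsetI)
    fix g assume "g \<in> le x \<inter> A \<inter> {g. p \<in># g}"
    then obtain h where "g = add_mset p h" "g \<in> A" "nm g \<le> x" by (auto dest: multi_member_split)
    thus "g \<in> add_mset p ` (le (x / N p) \<inter> A)" using cl by (auto simp: field_simps)
  qed (use cl in \<open>auto simp: field_simps\<close>)
  have "(\<Sum>g\<in>le x \<inter> A. f g) = (\<Sum>g\<in>le x \<inter> (A \<inter> {g. p \<notin># g}) \<union> le x \<inter> A \<inter> {g. p \<in># g}. f g)"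
    by (rule sum.cong) auto
  also have "\<dots> = (\<Sum>g\<in>le x \<inter> (A \<inter> {g. p \<notin># g}). f g) + (\<Sum>g\<in>le x \<inter> A \<inter> {g. p \<in># g}. f g)"
    by (rule sum.union_disjoint) auto
  also have "(\<Sum>g\<in>le x \<inter> A \<inter> {g. p \<in># g}. f g) = (\<Sum>h\<in>le (x / N p) \<inter> A. f (add_mset p h))"
    unfolding eq[symmetric] by (subst sum.reindex) (auto simp: inj_on_def)
  finally show ?thesis .
qed

text \<open>Indexed by a set of primes rather than by a bound, so that primes can be removed one at
  a time by induction; \<open>rough y\<close> is the case of all primes of norm at most
  \<open>y\<close>.\<close>

definition avoid :: "'p set \<Rightarrow> 'p multiset set" where "avoid Z = {g. \<forall>p\<in>#g. p \<notin> Z}"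

definition smooth :: "'p set \<Rightarrow> 'p multiset set" where "smooth Z = {g. set_mset g \<subseteq> Z}"

lemma rough_eq_avoid: "rough y = avoid {p. N p \<le> y}"
  by (auto simp: rough_def avoid_def not_le)

text \<open>Among elements avoiding \<open>Z\<close>, those divisible by \<open>p\<close> exactly
  once contribute \<open>- moebius h\<close> with \<open>h\<close> free of \<open>p\<close>, and
  those divisible by a higher power contribute 0. This is the shift equation for the Euler factor of
  \<open>p\<close>.\<close>

lemma summ_moebius_avoid_tendsto_0:
  assumes "finite Z"
  shows "((\<lambda>x. summ (restr (avoid Z) moebius) x / of_real x) \<longlongrightarrow> 0) at_top"
  using assms
proof (induction Z)
  case empty
  have "restr (avoid {}) moebius = moebius" by (auto simp: restr_def avoid_def)
  thus ?case using summ_moebius_tendsto_0 by simp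
next
  case (insert p Z)
  show ?case
  proof (rule tendsto_0_of_shift_equation[OF N_gt_1 _ _ insert.IH])
    show "norm (summ (restr (avoid (insert p Z)) moebius) x) \<le> B * x" if "x > 0" for x
      by (rule norm_summ_le) (use that in \<open>auto intro!: norm_restr_le norm_moebius_le_1\<close>)
    fix x
    have "summ (restr (avoid Z) moebius) x = (\<Sum>g\<in>le x \<inter> (avoid Z \<inter> {g. p \<notin># g}). moebius g)
        + (\<Sum>h\<in>le (x / N p) \<inter> avoid Z. moebius (add_mset p h))"
      unfolding summ_restr by (rule sum_split_prime) (use insert.hyps in \<open>auto simp: avoid_def\<close>)
    also have "avoid Z \<inter> {g. p \<notin># g} = avoid (insert p Z)" by (auto simp: avoid_def)
    also have "(\<Sum>h\<in>le (x / N p) \<inter> avoid Z. moebius (add_mset p h)) = (\<Sum>h\<in>le (x / N p) \<inter> avoid (insert p Z). - moebius h)"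
      by (rule sum.mono_neutral_cong_right) (auto simp: avoid_def moebius_add_mset)
    finally show "summ (restr (avoid (insert p Z)) moebius) x
        = summ (restr (avoid Z) moebius) x + summ (restr (avoid (insert p Z)) moebius) (x / N p)"
      by (simp add: summ_restr sum_negf)
  qed
qed

text \<open>Sorting by divisibility by the new prime gives the shift equation again, now with
  \<open>smooth Z\<close> as the known function; the empty set of primes leaves only the
  identity.\<close>

lemma summ_smooth_tendsto_0:
  assumes "finite Z"
  shows "((\<lambda>x. summ (restr (smooth Z) (\<lambda>_. 1)) x / of_real x) \<longlongrightarrow> 0) at_top"
  using assms
proof (induction Z)
  case empty
  have "smooth {} = {{#}}" by (auto simp: smooth_def)
  hence "summ (restr (smooth {}) (\<lambda>_. 1)) x = (if x \<ge> 1 then 1 else 0)" for x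
    by (auto simp: summ_restr)
  hence "eventually (\<lambda>x. of_real (1 / x) = summ (restr (smooth {}) (\<lambda>_. 1)) x / of_real x) at_top"
    by (intro eventually_at_top_linorderI[of 1]) auto
  moreover have "((\<lambda>x::real. of_real (1 / x) :: complex) \<longlongrightarrow> of_real 0) at_top"
    by (rule tendsto_of_real) real_asymp
  ultimately show ?case by (metis Lim_transform_eventually of_real_0)
next
  case (insert p Z)
  show ?case
  proof (rule tendsto_0_of_shift_equation[OF N_gt_1 _ _ insert.IH])
    show "norm (summ (restr (smooth (insert p Z)) (\<lambda>_. 1)) x) \<le> B * x" if "x > 0" for x
      by (rule norm_summ_le) (use that in \<open>auto intro!: norm_restr_le\<close>)
    fix x
    have "summ (restr (smooth (insert p Z)) (\<lambda>_. 1)) x = (\<Sum>g\<in>le x \<inter> (smooth (insert p Z) \<inter> {g. p \<notin># g}). 1)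
        + (\<Sum>h\<in>le (x / N p) \<inter> smooth (insert p Z). 1)"
      unfolding summ_restr by (rule sum_split_prime) (auto simp: smooth_def)
    also have "smooth (insert p Z) \<inter> {g. p \<notin># g} = smooth Z" using insert.hyps by (auto simp: smooth_def)
    finally show "summ (restr (smooth (insert p Z)) (\<lambda>_. 1)) x
        = summ (restr (smooth Z) (\<lambda>_. 1)) x + summ (restr (smooth (insert p Z)) (\<lambda>_. 1)) (x / N p)"
      by (simp add: summ_restr)
  qed
qed

lemma card_smooth_tendsto_0:
  "((\<lambda>x. real (card (le x \<inter> smooth {p. N p \<le> y})) / x) \<longlongrightarrow> 0) at_top"
proof -
  have "((\<lambda>x. norm (summ (restr (smooth {p. N p \<le> y}) (\<lambda>_. 1)) x / of_real x)) \<longlongrightarrow> 0) at_top"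
    by (rule tendsto_norm_zero[OF summ_smooth_tendsto_0]) simp
  moreover have "eventually (\<lambda>x. norm (summ (restr (smooth {p. N p \<le> y}) (\<lambda>_. 1)) x / of_real x)
      = real (card (le x \<inter> smooth {p. N p \<le> y})) / x) at_top"
    using eventually_gt_at_top[of 0] by eventually_elim (simp add: summ_restr norm_divide)
  ultimately show ?thesis by (rule Lim_transform_eventually)
qed

text \<open>Each excluded prime multiplies the density by \<open>1 - 1 / N p\<close>. The value is
  not tracked; \<open>card_rough_eventually_le\<close> bounds it by other means.\<close>

lemma card_avoid_tendsto:
  assumes "finite Z"
  shows "\<exists>d. ((\<lambda>x. real (card (le x \<inter> avoid Z)) / x) \<longlongrightarrow> d) at_top"
  using assms
proof (induction Z)
  case empty
  have "avoid {} = UNIV" by (auto simp: avoid_def)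
  thus ?case using count_G_over_tendsto by (auto simp: count_G_eq)
next
  case (insert p Z)
  then obtain d where d: "((\<lambda>x. real (card (le x \<inter> avoid Z)) / x) \<longlongrightarrow> d) at_top" by blast
  have "real (card (le x \<inter> avoid (insert p Z))) = real (card (le x \<inter> avoid Z)) - real (card (le (x / N p) \<inter> avoid Z))" for x
  proof -
    have "(\<Sum>g\<in>le x \<inter> avoid Z. 1::real) = (\<Sum>g\<in>le x \<inter> (avoid Z \<inter> {g. p \<notin># g}). 1)
        + (\<Sum>h\<in>le (x / N p) \<inter> avoid Z. 1)"
      by (rule sum_split_prime) (use insert.hyps in \<open>auto simp: avoid_def\<close>)
    moreover have "avoid Z \<inter> {g. p \<notin># g} = avoid (insert p Z)" by (auto simp: avoid_def)
    ultimately show ?thesis by simp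
  qed
  moreover have "((\<lambda>x. real (card (le x \<inter> avoid Z)) / x - real (card (le (x / N p) \<inter> avoid Z)) / (x / N p) / N p) \<longlongrightarrow> d - d / N p) at_top"
    by (intro tendsto_intros d filterlim_compose[OF d] filterlim_divide_const_at_top) (auto simp: less_imp_neq[symmetric])
  ultimately have "((\<lambda>x. real (card (le x \<inter> avoid (insert p Z))) / x) \<longlongrightarrow> d - d / N p) at_top"
    by (simp add: diff_divide_distrib)
  thus ?case by blast
qed

section \<open>Density of rough elements\<close>

lemma count_G_lower: "\<exists>k>0. \<forall>x\<ge>1. k * x \<le> count_G N x"
proof -
  have "eventually (\<lambda>x. count_G N x / x > c / 2) at_top"
    using c_pos by (intro order_tendstoD(1)[OF count_G_over_tendsto]) auto
  then obtain X where X: "\<And>x. x \<ge> X \<Longrightarrow> count_G N x / x > c / 2" by (auto simp: eventually_at_top_linorder)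
  define k where "k = min (c / 2) (1 / max 1 X)"
  have k: "k > 0" using c_pos by (simp add: k_def)
  have "k * x \<le> count_G N x" if x: "x \<ge> 1" for x
  proof (cases "x \<ge> max 1 X")
    case True
    hence "c / 2 * x \<le> count_G N x" using X[of x] x by (simp add: field_simps)
    moreover have "k * x \<le> c / 2 * x" using x by (intro mult_right_mono) (auto simp: k_def)
    ultimately show ?thesis by linarith
  next
    case False
    have "k * x \<le> (1 / max 1 X) * max 1 X" using False x k by (intro mult_mono) (auto simp: k_def)
    also have "\<dots> = 1" by simp
    finally show ?thesis using count_G_ge_1[OF x] by linarith
  qed
  thus ?thesis using k by blast
qed

lemma sum_inverse_unbounded: "\<exists>T\<ge>1. A \<le> (\<Sum>g\<in>le T. 1 / nm g)"
proof -
  obtain k where k: "k > 0" "\<And>x. x \<ge> 1 \<Longrightarrow> k * x \<le> count_G N x" using count_G_lower by blast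
  \<comment> \<open>By the lower bound on counts, \<open>k * (K * y) = 2 * B * y + k * y\<close>, so
    at least \<open>B * y\<close> elements have norm between \<open>y\<close> and
    \<open>K * y\<close>, and each such interval adds at least \<open>B / K\<close>.\<close>
  define K where "K = 2 * B / k + 1"
  have K: "K > 1" using k B_ge_1 by (simp add: K_def)
  have step: "(\<Sum>g\<in>le y. 1 / nm g) + B / K \<le> (\<Sum>g\<in>le (K * y). 1 / nm g)" if y: "y \<ge> 1" for y
  proof -
    have "y \<le> K * y" using K y by simp
    hence sub: "le y \<subseteq> le (K * y)" by (auto intro: order_trans)
    have "k * (K * y) \<le> count_G N (K * y)" by (rule k(2)) (use \<open>y \<le> K * y\<close> y in linarith)
    moreover have "k * (K * y) = 2 * B * y + k * y" using k by (simp add: K_def field_simps)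
    moreover have "count_G N y \<le> B * y" by (rule count_G_le) (use y in simp)
    moreover have "k * y \<ge> 0" using k y by simp
    ultimately have "B * y \<le> count_G N (K * y) - count_G N y" by linarith
    also have "\<dots> = real (card (le (K * y) - le y))"
      using sub by (simp add: count_G_eq card_Diff_subset of_nat_diff card_mono)
    finally have 1: "B * y \<le> real (card (le (K * y) - le y))" .
    have "B / K = B * y * (1 / (K * y))" using y K by simp
    also have "\<dots> \<le> real (card (le (K * y) - le y)) * (1 / (K * y))" using 1 y K by (intro mult_right_mono) auto
    also have "\<dots> = (\<Sum>g\<in>le (K * y) - le y. 1 / (K * y))" by simp
    also have "\<dots> \<le> (\<Sum>g\<in>le (K * y) - le y. 1 / nm g)"
      by (intro sum_mono divide_left_mono) (use y K in auto)
    also have "\<dots> = (\<Sum>g\<in>le (K * y). 1 / nm g) - (\<Sum>g\<in>le y. 1 / nm g)"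
      by (rule sum_diff[OF finite_le' sub])
    finally show ?thesis by linarith
  qed
  have "real n * (B / K) \<le> (\<Sum>g\<in>le (K ^ n). 1 / nm g)" for n
  proof (induction n)
    case 0
    have "0 \<le> (\<Sum>g\<in>le (K ^ 0). 1 / nm g)" by (intro sum_nonneg) (auto intro: less_imp_le)
    thus ?case by simp
  next
    case (Suc n)
    have "K ^ n \<ge> 1" using K by (intro one_le_power) auto
    from step[OF this] Suc show ?case unfolding of_nat_Suc distrib_right power_Suc by linarith
  qed
  moreover obtain n where "A \<le> real n * (B / K)"
    using reals_Archimedean3[of "B / K"] K B_ge_1 by (metis divide_pos_pos less_le_trans less_imp_le zero_less_one order_less_trans)
  moreover have "K ^ n \<ge> 1" using K by (intro one_le_power) auto
  ultimately show ?thesis by (intro exI[of _ "K ^ n"]) (auto intro: order_trans)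
qed

text \<open>The products of an element of norm at most \<open>y\<close> and a rough element are
  pairwise distinct. Comparing densities bounds the rough density times the sum of
  \<open>1 / nm m\<close> by \<open>c\<close>, and that sum is unbounded in \<open>y\<close>; no
  product over primes is evaluated.\<close>

lemma card_rough_eventually_le:
  assumes e: "e > 0"
  shows "\<exists>y\<ge>1. eventually (\<lambda>x. real (card (le x \<inter> rough y)) \<le> e * x) at_top"
proof -
  obtain y where y: "y \<ge> 1" "2 * c / e \<le> (\<Sum>g\<in>le y. 1 / nm g)" using sum_inverse_unbounded by blast
  obtain d where d: "((\<lambda>x. real (card (le x \<inter> rough y)) / x) \<longlongrightarrow> d) at_top"
    using card_avoid_tendsto[of "{p. N p \<le> y}"] by (auto simp: rough_eq_avoid)
  have d0: "d \<ge> 0"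
    by (rule tendsto_lowerbound[OF d]) (auto intro: eventually_mono[OF eventually_ge_at_top[of 0]])
  have le: "(\<Sum>m\<in>le y. real (card (le (x / nm m) \<inter> rough y))) \<le> count_G N x" for x
  proof -
    let ?S = "Sigma (le y) (\<lambda>m. le (x / nm m) \<inter> rough y)"
    \<comment> \<open>Recovers \<open>m\<close> from \<open>m + g\<close>: primes of
      \<open>m\<close> have norm at most \<open>nm m \<le> y\<close>, those of \<open>g\<close>
      more.\<close>
    have filt: "filter_mset (\<lambda>p. N p \<le> y) (m + g) = m" if "m \<in> le y" "g \<in> rough y" for m g
    proof -
      have "N p \<le> y" if "p \<in># m" for p using N_le_nm[OF that] \<open>m \<in> le y\<close> by simp
      hence "filter_mset (\<lambda>p. N p \<le> y) m = m" by (simp add: filter_mset_eq_conv)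
      moreover have "filter_mset (\<lambda>p. N p \<le> y) g = {#}" using that(2) by (auto simp: rough_def filter_mset_eq_conv not_le)
      ultimately show ?thesis by simp
    qed
    have "inj_on (\<lambda>(m, g). m + g) ?S"
    proof (rule inj_onI, clarify)
      fix m g m' g' assume *: "m \<in> le y" "g \<in> le (x / nm m)" "g \<in> rough y" "m' \<in> le y" "g' \<in> rough y" "m + g = m' + g'"
      have "m = m'" using filt[of m g] filt[of m' g'] * by metis
      thus "m = m' \<and> g = g'" using * by simp
    qed
    hence "card ?S = card ((\<lambda>(m, g). m + g) ` ?S)" by (rule card_image[symmetric])
    also have "\<dots> \<le> card (le x)" by (rule card_mono) (auto simp: field_simps)
    finally have "card ?S \<le> card (le x)" .
    moreover have "card ?S = (\<Sum>m\<in>le y. card (le (x / nm m) \<inter> rough y))" by (rule card_SigmaI) auto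
    ultimately show ?thesis unfolding count_G_eq by (metis of_nat_le_iff of_nat_sum)
  qed
  have "((\<lambda>x. \<Sum>m\<in>le y. real (card (le (x / nm m) \<inter> rough y)) / (x / nm m) * (1 / nm m)) \<longlongrightarrow> (\<Sum>m\<in>le y. d * (1 / nm m))) at_top"
    by (intro tendsto_intros filterlim_compose[OF d] filterlim_divide_const_at_top) auto
  moreover have "eventually (\<lambda>x. (\<Sum>m\<in>le y. real (card (le (x / nm m) \<inter> rough y)) / (x / nm m) * (1 / nm m)) \<le> count_G N x / x) at_top"
    using eventually_gt_at_top[of 0]
  proof eventually_elim
    case (elim x)
    have "(\<Sum>m\<in>le y. real (card (le (x / nm m) \<inter> rough y)) / (x / nm m) * (1 / nm m)) = (\<Sum>m\<in>le y. real (card (le (x / nm m) \<inter> rough y))) / x"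
      by (simp add: sum_divide_distrib)
    thus ?case using le[of x] elim by (simp add: divide_right_mono)
  qed
  ultimately have "(\<Sum>m\<in>le y. d * (1 / nm m)) \<le> c"
    by (intro tendsto_le[OF _ count_G_over_tendsto]) auto
  hence "d * (2 * c / e) \<le> c"
    using mult_left_mono[OF y(2) d0] by (simp add: sum_distrib_left)
  hence "d \<le> e / 2" using c_pos e by (simp add: field_simps)
  hence "eventually (\<lambda>x. real (card (le x \<inter> rough y)) / x < e) at_top"
    using e by (intro order_tendstoD(2)[OF d]) auto
  hence "eventually (\<lambda>x. real (card (le x \<inter> rough y)) \<le> e * x) at_top"
    using eventually_gt_at_top[of 0] by eventually_elim (auto simp: field_simps)
  thus ?thesis using y by blast
qed

subsection \<open>Axer's theorem\<close>

lemma nm_nonneg [simp]: "nm g \<ge> 0" using nm_pos[of g] by linarith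

text \<open>Fixed point of \<open>K = 2 powr \<eta> * B + 2 powr (\<eta> - 1) * K\<close>, the
  recursion of the dyadic induction in \<open>sum_powr_le\<close>; it is positive as
  \<open>\<eta> < 1\<close>.\<close>

definition powsum_const :: real where
  "powsum_const = 2 powr \<eta> * B / (1 - 2 powr (\<eta> - 1))"

lemma powsum_const_pos: "powsum_const > 0"
proof -
  have "2 powr (\<eta> - 1) < (2::real) powr 0" using eta_less_1 by (intro powr_less_mono) auto
  thus ?thesis unfolding powsum_const_def using B_ge_1 by (intro divide_pos_pos mult_pos_pos) auto
qed

text \<open>Terms with \<open>nm g > y / 2\<close> are at most \<open>2 powr \<eta>\<close> and
  number at most \<open>B * y\<close>; the others scale to the sum for \<open>y / 2\<close>. The
  induction halves \<open>y\<close> until it is below 1, where the sum is empty.\<close>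

lemma sum_powr_le:
  assumes "y \<ge> 0"
  shows "(\<Sum>g\<in>le y. (y / nm g) powr \<eta>) \<le> powsum_const * y"
proof -
  have main: "(\<Sum>g\<in>le y. (y / nm g) powr \<eta>) \<le> powsum_const * y" if "y \<ge> 0" "y < 2 ^ n" for n y
    using that
  proof (induction n arbitrary: y)
    case 0
    thus ?case using powsum_const_pos by (simp add: le_less_1)
  next
    case (Suc n)
    have sub: "le (y / 2) \<subseteq> le y" using Suc.prems by auto
    have IH: "(\<Sum>g\<in>le (y / 2). (y / 2 / nm g) powr \<eta>) \<le> powsum_const * (y / 2)"
      using Suc.prems by (intro Suc.IH) auto
    have 1: "(\<Sum>g\<in>le (y / 2). (y / nm g) powr \<eta>) = 2 powr \<eta> * (\<Sum>g\<in>le (y / 2). (y / 2 / nm g) powr \<eta>)"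
    proof -
      have "(y / nm g) powr \<eta> = 2 powr \<eta> * (y / 2 / nm g) powr \<eta>" for g
      proof -
        have "y / nm g = 2 * (y / 2 / nm g)" by simp
        thus ?thesis using Suc.prems by (metis powr_mult)
      qed
      thus ?thesis by (simp add: sum_distrib_left)
    qed
    have "(\<Sum>g\<in>le y - le (y / 2). (y / nm g) powr \<eta>) \<le> (\<Sum>g\<in>le y - le (y / 2). 2 powr \<eta>)"
    proof (rule sum_mono)
      fix g assume "g \<in> le y - le (y / 2)"
      hence "y / nm g \<le> 2" by (simp add: field_simps)
      thus "(y / nm g) powr \<eta> \<le> 2 powr \<eta>" using Suc.prems eta_pos by (intro powr_mono2) (auto intro: divide_nonneg_pos)
    qed
    also have "\<dots> = real (card (le y - le (y / 2))) * 2 powr \<eta>" by simp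
    also have "\<dots> \<le> (B * y) * 2 powr \<eta>"
    proof (rule mult_right_mono)
      have "real (card (le y - le (y / 2))) \<le> count_G N y" unfolding count_G_eq by (intro of_nat_mono card_mono) auto
      thus "real (card (le y - le (y / 2))) \<le> B * y" using count_G_le[of y] Suc.prems by linarith
    qed auto
    finally have 2: "(\<Sum>g\<in>le y - le (y / 2). (y / nm g) powr \<eta>) \<le> (B * y) * 2 powr \<eta>" .
    have "(\<Sum>g\<in>le y. (y / nm g) powr \<eta>) = (\<Sum>g\<in>le y - le (y / 2). (y / nm g) powr \<eta>) + (\<Sum>g\<in>le (y / 2). (y / nm g) powr \<eta>)"
      by (rule sum.subset_diff[OF sub finite_le'])
    also have "\<dots> \<le> (B * y) * 2 powr \<eta> + 2 powr \<eta> * (powsum_const * (y / 2))"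
      unfolding 1 using 2 IH by (intro add_mono mult_left_mono) auto
    also have "\<dots> = (B * 2 powr \<eta> + 2 powr (\<eta> - 1) * powsum_const) * y"
      by (simp add: powr_diff algebra_simps)
    also have "B * 2 powr \<eta> + 2 powr (\<eta> - 1) * powsum_const = powsum_const"
    proof -
      have "2 powr (\<eta> - 1) < (2::real) powr 0" using eta_less_1 by (intro powr_less_mono) auto
      hence "1 - 2 powr (\<eta> - 1) \<noteq> (0::real)" using eta_less_1 by simp
      hence "powsum_const * (1 - 2 powr (\<eta> - 1)) = 2 powr \<eta> * B" by (simp add: powsum_const_def)
      thus ?thesis by (simp add: algebra_simps)
    qed
    finally show ?case .
  qed
  obtain n where "y < 2 ^ n" using real_arch_pow[of 2 y] by auto
  thus ?thesis using main[of y n] assms by blast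
qed

text \<open>Integrating \<open>summ f t / t\<^sup>2\<close> over \<open>{a..b}\<close> costs
  \<open>e * ln (b / a)\<close>, and the two boundary terms cost \<open>e\<close> each.\<close>

lemma sum_inverse_summation_by_parts:
  fixes f :: "'p multiset \<Rightarrow> complex"
  assumes a: "0 < a" "a \<le> b" and e: "e \<ge> 0"
    and F: "\<And>t. a \<le> t \<Longrightarrow> t \<le> b \<Longrightarrow> norm (summ f t) \<le> e * t"
  shows "norm (\<Sum>g\<in>le b - le a. f g / of_real (nm g)) \<le> e * (2 + ln (b / a))"
proof -
  have sub: "le t \<subseteq> le t'" if "t \<le> t'" for t t' using that by auto
  have base: "((\<lambda>t. 1 / t\<^sup>2) has_integral (1 / x - 1 / b)) {x..b}" if "0 < x" "x \<le> b" for x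
  proof -
    have "((\<lambda>t. 1 / t\<^sup>2) has_integral ((- (1 / b)) - (- (1 / x)))) {x..b}"
    proof (rule fundamental_theorem_of_calculus[OF that(2)])
      fix t assume t: "t \<in> {x..b}"
      have "((\<lambda>t. - (1 / t)) has_real_derivative 1 / t\<^sup>2) (at t within {x..b})"
        using t that by (auto intro!: derivative_eq_intros simp: power2_eq_square)
      thus "((\<lambda>t. - (1 / t)) has_vector_derivative 1 / t\<^sup>2) (at t within {x..b})"
        by (simp add: has_real_derivative_iff_has_vector_derivative)
    qed
    thus ?thesis by simp
  qed
  \<comment> \<open>The value of that integral computed term by term: each \<open>g\<close>
    contributes from \<open>nm g\<close> onwards.\<close>
  define I where "I = (1 / a - 1 / b) *\<^sub>R summ f a + (\<Sum>g\<in>le b - le a. (1 / nm g - 1 / b) *\<^sub>R f g)"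
  have int: "((\<lambda>t. (1 / t\<^sup>2) *\<^sub>R summ f t) has_integral I) {a..b}"
  proof (rule has_integral_eq[rotated])
    show "((\<lambda>t. (1 / t\<^sup>2) *\<^sub>R summ f a + (\<Sum>g\<in>le b - le a. if t \<in> {nm g..b} then (1 / t\<^sup>2) *\<^sub>R f g else 0)) has_integral I) {a..b}"
      unfolding I_def
    proof (intro has_integral_add has_integral_sum)
      show "((\<lambda>t. (1 / t\<^sup>2) *\<^sub>R summ f a) has_integral (1 / a - 1 / b) *\<^sub>R summ f a) {a..b}"
        by (rule has_integral_scaleR_left[OF base]) (use a in auto)
      fix g assume g: "g \<in> le b - le a"
      have "((\<lambda>t. (1 / t\<^sup>2) *\<^sub>R f g) has_integral (1 / nm g - 1 / b) *\<^sub>R f g) {nm g..b}"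
        by (rule has_integral_scaleR_left[OF base]) (use g in auto)
      thus "((\<lambda>t. if t \<in> {nm g..b} then (1 / t\<^sup>2) *\<^sub>R f g else 0) has_integral (1 / nm g - 1 / b) *\<^sub>R f g) {a..b}"
        by (subst has_integral_restrict) (use g in auto)
    qed auto
    fix t assume t: "t \<in> {a..b}"
    have "summ f t = summ f a + (\<Sum>g\<in>le t - le a. f g)"
      unfolding summ_def using sum.subset_diff[OF sub[of a t], of f] t by simp
    also have "(\<Sum>g\<in>le t - le a. f g) = (\<Sum>g\<in>le b - le a. if t \<in> {nm g..b} then f g else 0)"
      by (rule sum.mono_neutral_cong_left) (use t in auto)
    finally show "(1 / t\<^sup>2) *\<^sub>R summ f a + (\<Sum>g\<in>le b - le a. if t \<in> {nm g..b} then (1 / t\<^sup>2) *\<^sub>R f g else 0) = (1 / t\<^sup>2) *\<^sub>R summ f t"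
      by (simp add: scaleR_add_right scaleR_sum_right if_distrib cong: if_cong)
  qed
  have log: "((\<lambda>t. e * (1 / t)) has_integral e * (ln b - ln a)) {a..b}"
  proof (rule has_integral_mult_right, rule fundamental_theorem_of_calculus[OF a(2)])
    fix t assume t: "t \<in> {a..b}"
    have "(ln has_real_derivative 1 / t) (at t within {a..b})"
      using t a by (auto intro!: derivative_eq_intros)
    thus "(ln has_vector_derivative 1 / t) (at t within {a..b})"
      by (simp add: has_real_derivative_iff_has_vector_derivative)
  qed
  have "norm (integral {a..b} (\<lambda>t. (1 / t\<^sup>2) *\<^sub>R summ f t)) \<le> integral {a..b} (\<lambda>t. e * (1 / t))"
  proof (rule Henstock_Kurzweil_Integration.integral_norm_bound_integral)
    show "(\<lambda>t. (1 / t\<^sup>2) *\<^sub>R summ f t) integrable_on {a..b}" using int by blast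
    show "(\<lambda>t. e * (1 / t)) integrable_on {a..b}" using log by blast
    fix t assume t: "t \<in> {a..b}"
    have "1 / t\<^sup>2 * norm (summ f t) \<le> 1 / t\<^sup>2 * (e * t)" using F[of t] t by (intro mult_left_mono) auto
    thus "norm ((1 / t\<^sup>2) *\<^sub>R summ f t) \<le> e * (1 / t)" using t a by (simp add: power2_eq_square)
  qed
  hence nI: "norm I \<le> e * ln (b / a)"
    using integral_unique[OF int] integral_unique[OF log] a by (simp add: ln_div)
  have "I = (1 / a) *\<^sub>R summ f a - (1 / b) *\<^sub>R (summ f a + (\<Sum>g\<in>le b - le a. f g)) + (\<Sum>g\<in>le b - le a. (1 / nm g) *\<^sub>R f g)"
    unfolding I_def by (simp add: scaleR_left_diff_distrib scaleR_add_right sum_subtractf scaleR_sum_right)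
  also have "summ f a + (\<Sum>g\<in>le b - le a. f g) = summ f b"
    unfolding summ_def using sum.subset_diff[OF sub[of a b], of f] a by simp
  also have "(\<Sum>g\<in>le b - le a. (1 / nm g) *\<^sub>R f g) = (\<Sum>g\<in>le b - le a. f g / of_real (nm g))"
    by (simp add: scaleR_conv_of_real)
  finally have "(\<Sum>g\<in>le b - le a. f g / of_real (nm g)) = I - (1 / a) *\<^sub>R summ f a + (1 / b) *\<^sub>R summ f b"
    by simp
  also have "norm \<dots> \<le> norm I + norm ((1 / a) *\<^sub>R summ f a) + norm ((1 / b) *\<^sub>R summ f b)"
    by (rule order_trans[OF norm_triangle_ineq add_right_mono[OF norm_triangle_ineq4]])
  also have "norm ((1 / a) *\<^sub>R summ f a) \<le> e" using F[of a] a by (simp add: field_simps)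
  also have "norm ((1 / b) *\<^sub>R summ f b) \<le> e" using F[of b] a by (simp add: field_simps)
  finally show ?thesis using nI by (simp add: algebra_simps)
qed

text \<open>The errors of Axiom A are summed by \<open>sum_powr_le\<close>. For
  \<open>y = t * x\<close> the bound is \<open>t powr (1 - \<eta>) * x\<close> up to a constant,
  negligible for small \<open>t\<close>; for \<open>y = x\<close> it is O(x).\<close>

lemma sum_count_diff_le:
  fixes f :: "'p multiset \<Rightarrow> complex"
  assumes f: "\<And>g. norm (f g) \<le> 1" and y: "0 < y" "y \<le> x"
  shows "norm (\<Sum>g\<in>le y. f g * of_real (count_G N (x / nm g) - c * (x / nm g))) \<le> C * powsum_const * (x / y) powr \<eta> * y"
proof -
  have "norm (\<Sum>g\<in>le y. f g * of_real (count_G N (x / nm g) - c * (x / nm g)))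
     \<le> (\<Sum>g\<in>le y. (C * (x / y) powr \<eta>) * (y / nm g) powr \<eta>)"
  proof (rule sum_norm_le)
    fix g assume g: "g \<in> le y"
    hence "x / nm g \<ge> 1" using y by simp
    hence "\<bar>count_G N (x / nm g) - c * (x / nm g)\<bar> \<le> C * (x / nm g) powr \<eta>" by (rule count_approx)
    also have "x / nm g = (x / y) * (y / nm g)" using y by simp
    also have "((x / y) * (y / nm g)) powr \<eta> = (x / y) powr \<eta> * (y / nm g) powr \<eta>"
      using y by (intro powr_mult)
    finally have "\<bar>count_G N (x / nm g) - c * (x / nm g)\<bar> \<le> (C * (x / y) powr \<eta>) * (y / nm g) powr \<eta>"
      using y by simp
    moreover have "norm (f g) * \<bar>count_G N (x / nm g) - c * (x / nm g)\<bar> \<le> 1 * \<bar>count_G N (x / nm g) - c * (x / nm g)\<bar>"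
      by (intro mult_right_mono f) auto
    ultimately show "norm (f g * of_real (count_G N (x / nm g) - c * (x / nm g))) \<le> (C * (x / y) powr \<eta>) * (y / nm g) powr \<eta>"
      unfolding norm_mult norm_of_real mult_1 by (rule order_trans[rotated])
  qed
  also have "\<dots> = (C * (x / y) powr \<eta>) * (\<Sum>g\<in>le y. (y / nm g) powr \<eta>)" by (simp add: sum_distrib_left)
  also have "\<dots> \<le> (C * (x / y) powr \<eta>) * (powsum_const * y)"
    using C_nonneg y by (intro mult_left_mono sum_powr_le) auto
  finally show ?thesis by (simp add: mult_ac)
qed

text \<open>Hyperbola method: when \<open>nm g\<close> exceeds \<open>t * x\<close> the cofactor has
  norm at most \<open>1 / t\<close>, so the number of sums over \<open>g\<close> does not depend on
  \<open>x\<close>, and each is a difference of values of \<open>summ f\<close>.\<close>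

lemma sum_count_swap:
  assumes t: "t > 0" and x: "x > 0"
  shows "(\<Sum>g\<in>le x - le (t * x). f g * of_real (count_G N (x / nm g)))
    = (\<Sum>k\<in>le (1 / t). \<Sum>g\<in>le (x / nm k) - le (t * x). f g :: complex)"
proof -
  have "(\<Sum>g\<in>le x - le (t * x). f g * of_real (count_G N (x / nm g)))
     = (\<Sum>g\<in>le x - le (t * x). \<Sum>k | k \<in> le (1 / t) \<and> nm g * nm k \<le> x. f g)"
  proof (rule sum.cong[OF refl])
    fix g assume g: "g \<in> le x - le (t * x)"
    have "{k. k \<in> le (1 / t) \<and> nm g * nm k \<le> x} = le (x / nm g)"
    proof (intro equalityI subsetI)
      fix k assume "k \<in> le (x / nm g)"
      hence k: "nm g * nm k \<le> x" by (simp add: field_simps)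
      have "t * x * nm k \<le> nm g * nm k" using g by (intro mult_right_mono) auto
      hence "t * x * nm k \<le> x" using k by linarith
      hence "(t * nm k) * x \<le> 1 * x" by (simp only: mult_ac mult_1)
      hence "t * nm k \<le> 1" using x by (simp only: mult_le_cancel_right_pos)
      thus "k \<in> {k. k \<in> le (1 / t) \<and> nm g * nm k \<le> x}" using k t by (simp add: field_simps)
    qed (simp add: field_simps)
    thus "f g * of_real (count_G N (x / nm g)) = (\<Sum>k | k \<in> le (1 / t) \<and> nm g * nm k \<le> x. f g)"
      by (simp add: count_G_eq mult.commute)
  qed
  also have "\<dots> = (\<Sum>k\<in>le (1 / t). \<Sum>g | g \<in> le x - le (t * x) \<and> nm g * nm k \<le> x. f g)"
    by (rule sum.swap_restrict) auto
  also have "\<dots> = (\<Sum>k\<in>le (1 / t). \<Sum>g\<in>le (x / nm k) - le (t * x). f g)"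
  proof (rule sum.cong[OF refl])
    fix k
    have "nm g \<le> x" if "nm g * nm k \<le> x" for g
    proof -
      have "nm g * 1 \<le> nm g * nm k" by (intro mult_left_mono nm_ge_1 nm_nonneg)
      thus ?thesis using that by linarith
    qed
    hence "{g. g \<in> le x - le (t * x) \<and> nm g * nm k \<le> x} = le (x / nm k) - le (t * x)"
      by (auto simp: field_simps)
    thus "(\<Sum>g | g \<in> le x - le (t * x) \<and> nm g * nm k \<le> x. f g) = (\<Sum>g\<in>le (x / nm k) - le (t * x). f g)" by simp
  qed
  finally show ?thesis .
qed

text \<open>Below \<open>t * x\<close> count and main term are compared directly by Axiom A; above
  it both are small separately since \<open>summ f\<close> is o(x).\<close>

lemma axer:
  assumes f: "\<And>g. norm (f g) \<le> 1" and F: "((\<lambda>x. summ f x / of_real x) \<longlongrightarrow> 0) at_top"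
  shows "((\<lambda>x. (\<Sum>g\<in>le x. f g * of_real (count_G N (x / nm g))) / of_real x
           - of_real c * (\<Sum>g\<in>le x. f g / of_real (nm g))) \<longlongrightarrow> 0) at_top"
proof (rule tendstoI)
  fix e :: real assume e: "e > 0"
  define K where "K = C * powsum_const"
  have K: "K \<ge> 0" using C_nonneg powsum_const_pos by (simp add: K_def)
  obtain t where t: "0 < t" "t < 1" "K * t powr (1 - \<eta>) < e / 2"
  proof -
    have "((\<lambda>t. t powr (1 - \<eta>)) \<longlongrightarrow> 0) (at_right 0)" using eta_less_1 by real_asymp
    hence "((\<lambda>t. K * t powr (1 - \<eta>)) \<longlongrightarrow> K * 0) (at_right 0)" by (intro tendsto_intros)
    hence "eventually (\<lambda>t. K * t powr (1 - \<eta>) < e / 2) (at_right 0)" using e by (intro order_tendstoD(2)) auto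
    moreover have "eventually (\<lambda>t. 0 < t \<and> t < (1::real)) (at_right 0)"
      by (auto intro: eventually_at_rightI[of 0 1])
    ultimately have "eventually (\<lambda>t. 0 < t \<and> t < 1 \<and> K * t powr (1 - \<eta>) < e / 2) (at_right 0)"
      by eventually_elim auto
    from eventually_happens'[OF trivial_limit_at_right_real this] show ?thesis using that by blast
  qed
  define n where "n = real (card (le (1 / t)))"
  \<comment> \<open>Total weight of the contributions of size \<open>e' * x\<close> from above
    \<open>t * x\<close>: \<open>2 * n\<close> from the hyperbola swap, the logarithmic part from
    partial summation, and 1 for positivity. As \<open>t\<close> is fixed first, \<open>L\<close>
    does not depend on \<open>x\<close>.\<close>
  define L where "L = 2 * n + c * (2 + ln (1 / t)) + 1"
  have "ln (1 / t) \<ge> 0" using t by (intro ln_ge_zero) auto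
  hence L: "L > 0" using c_pos unfolding L_def n_def by (intro add_nonneg_pos add_nonneg_nonneg mult_nonneg_nonneg) auto
  define e' where "e' = e / (2 * L)"
  have e': "e' > 0" using e L by (simp add: e'_def)
  have "eventually (\<lambda>x. norm (summ f x) \<le> e' * x) at_top"
    using tendstoD[OF F e'] eventually_gt_at_top[of 0]
    by eventually_elim (auto simp: norm_divide field_simps)
  then obtain X where X: "\<And>x. x \<ge> X \<Longrightarrow> norm (summ f x) \<le> e' * x" by (auto simp: eventually_at_top_linorder)
  show "eventually (\<lambda>x. dist ((\<Sum>g\<in>le x. f g * of_real (count_G N (x / nm g))) / of_real x
           - of_real c * (\<Sum>g\<in>le x. f g / of_real (nm g))) 0 < e) at_top"
    using eventually_ge_at_top[of "X / t"] eventually_gt_at_top[of 0]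
  proof eventually_elim
    case (elim x)
    have tx: "0 < t * x" "t * x \<le> x" "X \<le> t * x" using t elim by (auto simp: field_simps)
    have Fb: "norm (summ f y) \<le> e' * y" if "t * x \<le> y" for y using X[of y] that tx by linarith
    define S1 where "S1 = (\<Sum>g\<in>le (t * x). f g * of_real (count_G N (x / nm g) - c * (x / nm g)))"
    define S2 where "S2 = (\<Sum>g\<in>le x - le (t * x). f g * of_real (count_G N (x / nm g)))"
    define S3 where "S3 = (\<Sum>g\<in>le x - le (t * x). f g / of_real (nm g))"
    have sub: "le (t * x) \<subseteq> le x" using tx by auto
    have "(\<Sum>g\<in>le x. f g * of_real (count_G N (x / nm g))) - of_real (c * x) * (\<Sum>g\<in>le x. f g / of_real (nm g))
       = (\<Sum>g\<in>le x. f g * of_real (count_G N (x / nm g) - c * (x / nm g)))"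
      by (simp add: sum_distrib_left flip: sum_subtractf) (intro sum.cong refl, simp add: algebra_simps)
    also have "\<dots> = (\<Sum>g\<in>le x - le (t * x). f g * of_real (count_G N (x / nm g) - c * (x / nm g))) + S1"
      unfolding S1_def by (rule sum.subset_diff[OF sub finite_le'])
    also have "(\<Sum>g\<in>le x - le (t * x). f g * of_real (count_G N (x / nm g) - c * (x / nm g))) = S2 - of_real (c * x) * S3"
      unfolding S2_def S3_def
      by (simp add: sum_distrib_left flip: sum_subtractf) (intro sum.cong refl, simp add: algebra_simps)
    finally have eq: "(\<Sum>g\<in>le x. f g * of_real (count_G N (x / nm g))) - of_real (c * x) * (\<Sum>g\<in>le x. f g / of_real (nm g))
       = S2 - of_real (c * x) * S3 + S1" .
    have n1: "norm S1 \<le> K * t powr (1 - \<eta>) * x"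
    proof -
      have "norm S1 \<le> K * (x / (t * x)) powr \<eta> * (t * x)"
        unfolding S1_def K_def by (rule sum_count_diff_le[OF f]) (use tx in auto)
      also have "x / (t * x) = 1 / t" using elim by simp
      also have "K * (1 / t) powr \<eta> * (t * x) = K * (t powr (1 - \<eta>)) * x"
        using t by (simp add: powr_diff powr_divide)
      finally show ?thesis .
    qed
    have n2: "norm S2 \<le> n * (2 * e' * x)"
    proof -
      have "S2 = (\<Sum>k\<in>le (1 / t). \<Sum>g\<in>le (x / nm k) - le (t * x). f g)"
        unfolding S2_def by (rule sum_count_swap) (use t elim in auto)
      also have "norm \<dots> \<le> (\<Sum>k\<in>le (1 / t). 2 * e' * x)"
      proof (rule sum_norm_le)
        fix k assume k: "k \<in> le (1 / t)"
        have 1: "t * x \<le> x / nm k" using k t elim by (simp add: field_simps)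
        have 2: "x / nm k \<le> x" using nm_ge_1[of k] elim by (simp add: divide_le_eq mult_left_le)
        have "(\<Sum>g\<in>le (x / nm k) - le (t * x). f g) = summ f (x / nm k) - summ f (t * x)"
          unfolding summ_def by (rule sum_diff) (use 1 in auto)
        also have "norm \<dots> \<le> norm (summ f (x / nm k)) + norm (summ f (t * x))" by (rule norm_triangle_ineq4)
        also have "\<dots> \<le> e' * (x / nm k) + e' * (t * x)" using 1 by (intro add_mono Fb) auto
        also have "\<dots> \<le> e' * x + e' * x" using 2 tx e' by (intro add_mono mult_left_mono) auto
        finally show "norm (\<Sum>g\<in>le (x / nm k) - le (t * x). f g) \<le> 2 * e' * x" by simp
      qed
      also have "\<dots> = n * (2 * e' * x)" by (simp add: n_def)
      finally show ?thesis .
    qed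
    have n3: "norm S3 \<le> e' * (2 + ln (1 / t))"
    proof -
      have "norm S3 \<le> e' * (2 + ln (x / (t * x)))"
        unfolding S3_def by (rule sum_inverse_summation_by_parts) (use tx e' Fb in auto)
      thus ?thesis using elim by simp
    qed
    have "norm (S2 - of_real (c * x) * S3 + S1) \<le> norm S2 + (c * x) * norm S3 + norm S1"
      using norm_triangle_ineq[of "S2 - of_real (c * x) * S3" S1] norm_triangle_ineq4[of S2 "of_real (c * x) * S3"]
        c_pos elim by (simp add: norm_mult)
    also have "\<dots> \<le> n * (2 * e' * x) + (c * x) * (e' * (2 + ln (1 / t))) + K * t powr (1 - \<eta>) * x"
      using n1 n2 n3 c_pos elim by (intro add_mono mult_left_mono) auto
    also have "\<dots> = (e' * (L - 1) + K * t powr (1 - \<eta>)) * x"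
      by (simp add: L_def algebra_simps)
    also have "\<dots> < e * x"
    proof (rule mult_strict_right_mono)
      have "e' * (L - 1) \<le> e' * L" using e' by simp
      also have "e' * L = e / 2" using L by (simp add: e'_def)
      finally show "e' * (L - 1) + K * t powr (1 - \<eta>) < e" using t(3) by linarith
    qed (use elim in auto)
    finally have "norm (S2 - of_real (c * x) * S3 + S1) < e * x" .
    moreover have "(\<Sum>g\<in>le x. f g * of_real (count_G N (x / nm g))) / of_real x - of_real c * (\<Sum>g\<in>le x. f g / of_real (nm g))
      = (S2 - of_real (c * x) * S3 + S1) / of_real x"
      unfolding eq[symmetric] using elim by (simp add: diff_divide_distrib)
    ultimately show ?case using elim by (simp add: norm_divide pos_divide_less_eq)
  qed
qed

text \<open>Partial sums at \<open>s = 1\<close> of the inverse zeta function with the Euler factors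
  of norm at most \<open>y\<close> removed.\<close>

definition mr :: "real \<Rightarrow> real \<Rightarrow> complex" where
  "mr y x = (\<Sum>g\<in>le x \<inter> rough y. moebius g / of_real (nm g))"

lemma mr_eq: "mr y x = (\<Sum>g\<in>le x. restr (rough y) moebius g / of_real (nm g))"
  unfolding mr_def sum.inter_restrict[OF finite_le'] by (intro sum.cong refl) (simp add: restr_def)

lemma sum_moebius_rough_count:
  "(\<Sum>g\<in>le x. restr (rough y) moebius g * of_real (count_G N (x / nm g))) = of_real (real (card (le x \<inter> smooth {p. N p \<le> y})))"
proof -
  have "(\<Sum>g\<in>le x. restr (rough y) moebius g * of_real (count_G N (x / nm g)))
      = (\<Sum>h\<in>le x. \<Sum>k\<in>le (x / nm h). restr (rough y) moebius h)"
    by (simp add: count_G_eq mult.commute)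
  also have "\<dots> = (\<Sum>g\<in>le x. \<Sum>h | h \<subseteq># g. restr (rough y) moebius h)"
    by (rule sum_divisors_swap[symmetric])
  also have "\<dots> = (\<Sum>g\<in>le x. if g \<in> smooth {p. N p \<le> y} then 1 else 0)"
    unfolding restr_def sum_moebius_rough by (intro sum.cong) (auto simp: smooth_def)
  also have "\<dots> = of_real (real (card (le x \<inter> smooth {p. N p \<le> y})))"
    by (simp add: sum.If_cases)
  finally show ?thesis .
qed

text \<open>Independence of \<open>y\<close> is essential, since later \<open>y\<close> runs through
  all prime norms below that of the smallest prime of \<open>h\<close>. The bound comes from the
  count of smooth elements, at most \<open>B * x\<close>, and the error sum with cut at
  \<open>x\<close>.\<close>

lemma norm_mr_le: "norm (mr y x) \<le> (B + C * powsum_const) / c"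
proof (cases "x \<ge> 1")
  case False
  thus ?thesis using c_pos B_ge_1 C_nonneg powsum_const_pos by (simp add: mr_def le_less_1 add_nonneg_nonneg)
next
  case True
  let ?f = "restr (rough y) moebius"
  have f: "norm (?f g) \<le> 1" for g by (rule norm_restr_le) (rule norm_moebius_le_1)
  have "of_real (c * x) * mr y x = (\<Sum>g\<in>le x. ?f g * of_real (count_G N (x / nm g)))
      - (\<Sum>g\<in>le x. ?f g * of_real (count_G N (x / nm g) - c * (x / nm g)))"
    unfolding mr_eq by (simp add: sum_distrib_left flip: sum_subtractf) (intro sum.cong refl, simp add: algebra_simps)
  also have "norm \<dots> \<le> B * x + C * powsum_const * (x / x) powr \<eta> * x"
  proof (rule order_trans[OF norm_triangle_ineq4], rule add_mono)
    have "real (card (le x \<inter> smooth {p. N p \<le> y})) \<le> count_G N x"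
      unfolding count_G_eq by (intro of_nat_mono card_mono) auto
    thus "norm (\<Sum>g\<in>le x. ?f g * of_real (count_G N (x / nm g))) \<le> B * x"
      unfolding sum_moebius_rough_count using count_G_le[of x] True by simp
    show "norm (\<Sum>g\<in>le x. ?f g * of_real (count_G N (x / nm g) - c * (x / nm g))) \<le> C * powsum_const * (x / x) powr \<eta> * x"
      by (rule sum_count_diff_le[OF f]) (use True in auto)
  qed
  also have "\<dots> = (B + C * powsum_const) * x" using True by (simp add: algebra_simps)
  finally have "(c * norm (mr y x)) * x \<le> (B + C * powsum_const) * x"
    using True c_pos by (simp add: norm_mult mult_ac)
  hence "c * norm (mr y x) \<le> B + C * powsum_const" using True by (subst (asm) mult_le_cancel_right_pos) auto
  thus ?thesis using c_pos by (simp add: field_simps)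
qed

text \<open>By Axer's theorem \<open>c * mr y x\<close> differs by o(1) from the proportion of
  smooth elements, which itself tends to 0.\<close>

lemma mr_tendsto_0: "(mr y \<longlongrightarrow> 0) at_top"
proof -
  let ?f = "restr (rough y) moebius"
  have "((\<lambda>x. summ ?f x / of_real x) \<longlongrightarrow> 0) at_top"
    unfolding rough_eq_avoid by (rule summ_moebius_avoid_tendsto_0) simp
  from axer[OF norm_restr_le[OF norm_moebius_le_1] this]
  have 1: "((\<lambda>x. of_real (real (card (le x \<inter> smooth {p. N p \<le> y}))) / of_real x - of_real c * mr y x) \<longlongrightarrow> 0) at_top"
    unfolding sum_moebius_rough_count mr_eq .
  have 2: "((\<lambda>x. complex_of_real (real (card (le x \<inter> smooth {p. N p \<le> y})) / x)) \<longlongrightarrow> of_real 0) at_top"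
    by (rule tendsto_of_real[OF card_smooth_tendsto_0])
  have "((\<lambda>x. (complex_of_real (real (card (le x \<inter> smooth {p. N p \<le> y})) / x)
      - (of_real (real (card (le x \<inter> smooth {p. N p \<le> y}))) / of_real x - of_real c * mr y x)) / of_real c) \<longlongrightarrow> (of_real 0 - 0) / of_real c) at_top"
    using c_pos by (intro tendsto_intros 1 2) auto
  thus ?thesis using c_pos by simp
qed

subsection \<open>Distinguishable elements and Mertens bounds\<close>

text \<open>Replaces the minimum and the definite description by a condition on one prime
  \<open>Q\<close>. \<open>Q\<close> may divide \<open>g\<close> repeatedly; only other primes have
  to be strictly larger in norm.\<close>

lemma mem_DS_iff:
  "g \<in> DS N S - {{#}} \<longleftrightarrow> (\<exists>Q\<in>S. Q \<in># g \<and> (\<forall>p\<in>#g. p \<noteq> Q \<longrightarrow> N Q < N p))"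
proof
  assume g: "g \<in> DS N S - {{#}}"
  hence d: "distinguishable N g" and P: "P_min N g \<in> S" by (auto simp: DS_def)
  hence ne: "g \<noteq> {#}" and ex: "\<exists>!p. p \<in># g \<and> N p = N_minus N g" by (auto simp: distinguishable_def)
  have Q: "P_min N g \<in># g \<and> N (P_min N g) = N_minus N g"
    unfolding P_min_def by (rule theI'[OF ex])
  have "N (P_min N g) < N p" if "p \<in># g" "p \<noteq> P_min N g" for p
  proof -
    have "N_minus N g \<le> N p" unfolding N_minus_def using that by (intro Min_le) auto
    moreover have "N p \<noteq> N_minus N g" using ex Q that by blast
    ultimately show ?thesis using Q by simp
  qed
  thus "\<exists>Q\<in>S. Q \<in># g \<and> (\<forall>p\<in>#g. p \<noteq> Q \<longrightarrow> N Q < N p)" using Q P by blast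
next
  assume "\<exists>Q\<in>S. Q \<in># g \<and> (\<forall>p\<in>#g. p \<noteq> Q \<longrightarrow> N Q < N p)"
  then obtain Q where Q: "Q \<in> S" "Q \<in># g" "\<And>p. p \<in># g \<Longrightarrow> p \<noteq> Q \<Longrightarrow> N Q < N p" by blast
  have "N_minus N g = N Q"
    unfolding N_minus_def using Q(2,3) by (intro Min_eqI) (auto intro: less_imp_le)
  hence uniq: "p = Q" if "p \<in># g \<and> N p = N_minus N g" for p using that Q(3)[of p] by auto
  have "distinguishable N g"
    unfolding distinguishable_def using Q(2) \<open>N_minus N g = N Q\<close> uniq by (intro conjI ex1I[of _ Q]) auto
  moreover have "P_min N g = Q"
    unfolding P_min_def using Q(2) \<open>N_minus N g = N Q\<close> uniq by (intro the_equality) auto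
  ultimately show "g \<in> DS N S - {{#}}" using Q by (auto simp: DS_def)
qed

text \<open>Elements with unique smallest prime \<open>Q\<close> occurring once. Where
  \<open>moebius\<close> is nonzero this agrees with having \<open>Q\<close> as
  \<open>P_min\<close>, so \<open>DS N S\<close> can be replaced by a disjoint union of shifted
  rough sets.\<close>

definition lead :: "'p \<Rightarrow> 'p multiset set" where "lead Q = add_mset Q ` rough (N Q)"

lemma lead_unique: "g \<in> lead Q \<Longrightarrow> g \<in> lead Q' \<Longrightarrow> Q = Q'"
proof (rule ccontr)
  assume g: "g \<in> lead Q" "g \<in> lead Q'" "Q \<noteq> Q'"
  obtain h where h: "g = add_mset Q h" "h \<in> rough (N Q)" using g(1) by (auto simp: lead_def)
  obtain h' where h': "g = add_mset Q' h'" "h' \<in> rough (N Q')" using g(2) by (auto simp: lead_def)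
  have "Q' \<in># add_mset Q h" using h h' by (metis union_single_eq_member add_mset_add_single)
  hence "Q' \<in># h" using g(3) by auto
  hence "N Q < N Q'" using h by (auto simp: rough_def)
  moreover have "Q \<in># add_mset Q' h'" using h h' by (metis union_single_eq_member add_mset_add_single)
  hence "Q \<in># h'" using g(3) by auto
  hence "N Q' < N Q" using h' by (auto simp: rough_def)
  ultimately show False by simp
qed

lemma moebius_lead: "h \<in> rough (N Q) \<Longrightarrow> moebius (add_mset Q h) = - moebius h"
  by (auto simp: moebius_add_mset rough_def)

lemma mem_lead_iff:
  assumes "moebius g \<noteq> 0"
  shows "g \<in> lead Q \<longleftrightarrow> Q \<in># g \<and> (\<forall>p\<in>#g. p \<noteq> Q \<longrightarrow> N Q < N p)"
proof
  assume "Q \<in># g \<and> (\<forall>p\<in>#g. p \<noteq> Q \<longrightarrow> N Q < N p)"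
  then obtain h where h: "g = add_mset Q h" "\<And>p. p \<in># g \<Longrightarrow> p \<noteq> Q \<Longrightarrow> N Q < N p"
    by (auto dest!: multi_member_split)
  have "Q \<notin># h" using assms by (auto simp: h(1) moebius_add_mset)
  hence "h \<in> rough (N Q)" using h unfolding rough_def by fastforce
  thus "g \<in> lead Q" using h by (auto simp: lead_def)
qed (auto simp: lead_def rough_def)

lemma mem_DS_iff_lead:
  "moebius g \<noteq> 0 \<Longrightarrow> g \<in> DS N S - {{#}} \<longleftrightarrow> g \<in> (\<Union>Q\<in>S. lead Q)"
  using mem_DS_iff[of g S] mem_lead_iff[of g] by blast

lemma sum_lead:
  fixes f :: "'p multiset \<Rightarrow> 'b::comm_monoid_add"
  shows "(\<Sum>g\<in>le x \<inter> (\<Union>Q\<in>S. lead Q). f g) = (\<Sum>Q | Q \<in> S \<and> N Q \<le> x. \<Sum>h\<in>le (x / N Q) \<inter> rough (N Q). f (add_mset Q h))"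
proof -
  let ?I = "{Q. Q \<in> S \<and> N Q \<le> x}"
  have fin: "finite ?I" by (rule finite_subset[OF _ finite_primes_le[of x]]) auto
  have eq: "le x \<inter> (\<Union>Q\<in>S. lead Q) = (\<Union>Q\<in>?I. add_mset Q ` (le (x / N Q) \<inter> rough (N Q)))"
  proof (intro equalityI subsetI)
    fix g assume "g \<in> le x \<inter> (\<Union>Q\<in>S. lead Q)"
    then obtain Q h where g: "Q \<in> S" "g = add_mset Q h" "h \<in> rough (N Q)" "nm g \<le> x" by (auto simp: lead_def)
    moreover have "N Q \<le> nm g" by (rule N_le_nm) (simp add: g(2))
    hence "N Q \<le> x" using g(4) by linarith
    moreover have "nm h \<le> x / N Q" using g by (simp add: field_simps)
    ultimately show "g \<in> (\<Union>Q\<in>?I. add_mset Q ` (le (x / N Q) \<inter> rough (N Q)))" by auto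
  qed (auto simp: lead_def field_simps)
  show ?thesis unfolding eq
  proof (subst sum.UNION_disjoint[OF fin])
    show "\<forall>Q\<in>?I. \<forall>Q'\<in>?I. Q \<noteq> Q' \<longrightarrow> add_mset Q ` (le (x / N Q) \<inter> rough (N Q)) \<inter> add_mset Q' ` (le (x / N Q') \<inter> rough (N Q')) = {}"
    proof (intro ballI impI)
      fix Q Q' :: 'p assume "Q \<noteq> Q'"
      moreover have "add_mset R ` (le (x / N R) \<inter> rough (N R)) \<subseteq> lead R" for R by (auto simp: lead_def)
      ultimately show "add_mset Q ` (le (x / N Q) \<inter> rough (N Q)) \<inter> add_mset Q' ` (le (x / N Q') \<inter> rough (N Q')) = {}"
        using lead_unique by blast
    qed
    show "(\<Sum>Q\<in>?I. sum f (add_mset Q ` (le (x / N Q) \<inter> rough (N Q)))) = (\<Sum>Q\<in>?I. \<Sum>h\<in>le (x / N Q) \<inter> rough (N Q). f (add_mset Q h))"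
      by (rule sum.cong[OF refl], subst sum.reindex) (auto simp: inj_on_def)
  qed auto
qed

lemma summ_moebius_lead_finite:
  "(\<Sum>g\<in>le x \<inter> (\<Union>Q\<in>{Q \<in> S. N Q \<le> y}. lead Q). moebius g)
     = - (\<Sum>Q | Q \<in> S \<and> N Q \<le> y. summ (restr (rough (N Q)) moebius) (x / N Q))"
proof -
  have "(\<Sum>g\<in>le x \<inter> (\<Union>Q\<in>{Q \<in> S. N Q \<le> y}. lead Q). moebius g)
     = (\<Sum>Q | Q \<in> {Q \<in> S. N Q \<le> y} \<and> N Q \<le> x. \<Sum>h\<in>le (x / N Q) \<inter> rough (N Q). moebius (add_mset Q h))"
    by (rule sum_lead)
  also have "\<dots> = (\<Sum>Q | Q \<in> {Q \<in> S. N Q \<le> y} \<and> N Q \<le> x. - summ (restr (rough (N Q)) moebius) (x / N Q))"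
    by (intro sum.cong refl) (simp add: summ_restr moebius_lead sum_negf)
  \<comment> \<open>For \<open>N Q > x\<close> the sum up to \<open>x / N Q\<close> is empty, so the
    range can be made independent of \<open>x\<close>.\<close>
  also have "\<dots> = (\<Sum>Q | Q \<in> S \<and> N Q \<le> y. - summ (restr (rough (N Q)) moebius) (x / N Q))"
  proof (rule sum.mono_neutral_left)
    show "finite {Q. Q \<in> S \<and> N Q \<le> y}" by (rule finite_subset[OF _ finite_primes_le[of y]]) auto
    show "\<forall>Q\<in>{Q. Q \<in> S \<and> N Q \<le> y} - {Q. Q \<in> {Q \<in> S. N Q \<le> y} \<and> N Q \<le> x}. - summ (restr (rough (N Q)) moebius) (x / N Q) = 0"
    proof
      fix Q assume "Q \<in> {Q. Q \<in> S \<and> N Q \<le> y} - {Q. Q \<in> {Q \<in> S. N Q \<le> y} \<and> N Q \<le> x}"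
      hence "x / N Q < 1" by auto
      thus "- summ (restr (rough (N Q)) moebius) (x / N Q) = 0" by (simp add: summ_def le_less_1)
    qed
  qed auto
  finally show ?thesis by (simp add: sum_negf)
qed

text \<open>Smallest primes above \<open>y\<close> occur only in \<open>y\<close>-rough elements, of
  which there are at most \<open>e / 2 * x\<close>; smallest primes up to \<open>y\<close> give
  finitely many sums over rough elements, each o(x).\<close>

lemma summ_moebius_DS_tendsto_0:
  "((\<lambda>x. summ (restr (DS N S - {{#}}) moebius) x / of_real x) \<longlongrightarrow> 0) at_top"
proof (rule tendstoI)
  fix e :: real assume e: "e > 0"
  obtain y where y: "y \<ge> 1" "eventually (\<lambda>x. real (card (le x \<inter> rough y)) \<le> e / 2 * x) at_top"
    using card_rough_eventually_le[of "e / 2"] e by auto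
  let ?A = "\<Union>Q\<in>{Q \<in> S. N Q \<le> y}. lead Q" and ?B = "\<Union>Q\<in>{Q \<in> S. N Q > y}. lead Q"
  have split: "summ (restr (DS N S - {{#}}) moebius) x = (\<Sum>g\<in>le x \<inter> ?A. moebius g) + (\<Sum>g\<in>le x \<inter> ?B. moebius g)" for x
  proof -
    have "summ (restr (DS N S - {{#}}) moebius) x = (\<Sum>g\<in>(le x \<inter> ?A) \<union> (le x \<inter> ?B). moebius g)"
      unfolding summ_restr
    proof (rule sum.mono_neutral_cong)
      show "moebius g = 0" if "g \<in> le x \<inter> (DS N S - {{#}}) - (le x \<inter> ?A \<union> le x \<inter> ?B)" for g
        using that mem_DS_iff_lead[of g S] by (auto simp: not_less[symmetric] simp del: not_less)
      show "moebius g = 0" if "g \<in> (le x \<inter> ?A \<union> le x \<inter> ?B) - (le x \<inter> (DS N S - {{#}}))" for g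
        using that mem_DS_iff_lead[of g S] by auto
    qed auto
    also have "\<dots> = (\<Sum>g\<in>le x \<inter> ?A. moebius g) + (\<Sum>g\<in>le x \<inter> ?B. moebius g)"
    proof (rule sum.union_disjoint)
      show "le x \<inter> ?A \<inter> (le x \<inter> ?B) = {}" using lead_unique by fastforce
    qed auto
    finally show ?thesis .
  qed
  have Brough: "?B \<subseteq> rough y" by (fastforce simp: lead_def rough_def)
  have "((\<lambda>x. - (\<Sum>Q | Q \<in> S \<and> N Q \<le> y. summ (restr (rough (N Q)) moebius) (x / N Q) / of_real (x / N Q) / of_real (N Q))) \<longlongrightarrow> - (\<Sum>Q | Q \<in> S \<and> N Q \<le> y. 0 / of_real (N Q))) at_top"
  proof (intro tendsto_intros)
    fix Q
    have "((\<lambda>x. summ (restr (rough (N Q)) moebius) x / of_real x) \<longlongrightarrow> 0) at_top"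
      unfolding rough_eq_avoid by (rule summ_moebius_avoid_tendsto_0) simp
    thus "((\<lambda>x. summ (restr (rough (N Q)) moebius) (x / N Q) / of_real (x / N Q)) \<longlongrightarrow> 0) at_top"
      by (rule filterlim_compose) (rule filterlim_divide_const_at_top, simp)
  qed auto
  hence "((\<lambda>x. (\<Sum>g\<in>le x \<inter> ?A. moebius g) / of_real x) \<longlongrightarrow> 0) at_top"
    unfolding summ_moebius_lead_finite by (simp add: sum_divide_distrib)
  hence "eventually (\<lambda>x. norm ((\<Sum>g\<in>le x \<inter> ?A. moebius g) / of_real x) < e / 2) at_top"
    using e by (auto dest!: tendstoD[of _ _ _ "e / 2"])
  thus "eventually (\<lambda>x. dist (summ (restr (DS N S - {{#}}) moebius) x / of_real x) 0 < e) at_top"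
    using y(2) eventually_gt_at_top[of 0]
  proof eventually_elim
    case (elim x)
    have "norm (\<Sum>g\<in>le x \<inter> ?B. moebius g) \<le> (\<Sum>g\<in>le x \<inter> ?B. 1)"
      by (rule sum_norm_le) (rule norm_moebius_le_1)
    also have "\<dots> = real (card (le x \<inter> ?B))" by simp
    also have "\<dots> \<le> real (card (le x \<inter> rough y))" using Brough by (intro of_nat_mono card_mono) auto
    also have "\<dots> \<le> e / 2 * x" using elim by simp
    finally have "norm ((\<Sum>g\<in>le x \<inter> ?B. moebius g) / of_real x) \<le> e / 2" using elim by (simp add: norm_divide pos_divide_le_eq)
    thus ?case using elim norm_triangle_ineq[of "(\<Sum>g\<in>le x \<inter> ?A. moebius g) / of_real x" "(\<Sum>g\<in>le x \<inter> ?B. moebius g) / of_real x"]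
      unfolding split dist_norm add_divide_distrib diff_0_right by linarith
  qed
qed

section \<open>Upper bounds of Mertens type for sums over primes\<close>

lemma ln_N_pos [simp]: "ln (N p) > 0" using N_gt_1[of p] by simp

lemma ln_nm_eq: "ln (nm g) = (\<Sum>p\<in>set_mset g. real (count g p) * ln (N p))"
proof (induction g)
  case (add q g)
  have "(\<Sum>p\<in>set_mset (add_mset q g). real (count (add_mset q g) p) * ln (N p))
      = (\<Sum>p\<in>insert q (set_mset g). real (count g p) * ln (N p) + (if p = q then ln (N p) else 0))"
    by (rule sum.cong) (auto simp: algebra_simps)
  also have "\<dots> = (\<Sum>p\<in>insert q (set_mset g). real (count g p) * ln (N p)) + ln (N q)"
    by (simp add: sum.distrib sum.delta)
  also have "(\<Sum>p\<in>insert q (set_mset g). real (count g p) * ln (N p)) = (\<Sum>p\<in>set_mset g. real (count g p) * ln (N p))"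
    by (rule sum.mono_neutral_right) (auto simp: not_in_iff)
  finally show ?case using add by (simp add: ln_mult)
qed simp

lemma card_le_member: "card {g. g \<in> le x \<and> p \<in># g} = card (le (x / N p))"
proof -
  have "{g. g \<in> le x \<and> p \<in># g} = add_mset p ` le (x / N p)"
    by (auto simp: field_simps dest!: multi_member_split)
  thus ?thesis by (simp add: card_image inj_on_def)
qed

text \<open>Chebyshev's argument: for \<open>g\<close> up to \<open>x\<close> the logarithms of its
  distinct primes add up to at most \<open>ln x\<close>. Exchanging the summations weights
  \<open>ln (N p)\<close> by \<open>count_G N (x / N p)\<close>, which is at least
  \<open>k * x / N p\<close>.\<close>

lemma mertens_upper: "\<exists>K>0. \<forall>x\<ge>1. (\<Sum>p | N p \<le> x. ln (N p) / N p) \<le> K * ln x"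
proof -
  obtain k where k: "k > 0" "\<And>x. x \<ge> 1 \<Longrightarrow> k * x \<le> count_G N x" using count_G_lower by blast
  have "(\<Sum>p | N p \<le> x. ln (N p) / N p) \<le> B / k * ln x" if x: "x \<ge> 1" for x
  proof -
    have "(k * x) * (\<Sum>p | N p \<le> x. ln (N p) / N p) = (\<Sum>p | N p \<le> x. ln (N p) * (k * (x / N p)))"
      by (simp add: sum_distrib_left field_simps)
    also have "\<dots> \<le> (\<Sum>p | N p \<le> x. ln (N p) * count_G N (x / N p))"
      by (intro sum_mono mult_left_mono k) (auto simp: less_imp_le)
    also have "\<dots> = (\<Sum>p | N p \<le> x. \<Sum>g | g \<in> le x \<and> p \<in># g. ln (N p))"
      unfolding count_G_eq by (simp only: sum_constant card_le_member mult.commute)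
    also have "\<dots> = (\<Sum>g\<in>le x. \<Sum>p | p \<in> {p. N p \<le> x} \<and> p \<in># g. ln (N p))"
      by (rule sum.swap_restrict[symmetric]) auto
    also have "\<dots> \<le> (\<Sum>g\<in>le x. ln x)"
    proof (rule sum_mono)
      fix g assume g: "g \<in> le x"
      have "(\<Sum>p | p \<in> {p. N p \<le> x} \<and> p \<in># g. ln (N p)) \<le> (\<Sum>p\<in>set_mset g. real (count g p) * ln (N p))"
      proof (rule order_trans[OF sum_mono[of _ _ "\<lambda>p. real (count g p) * ln (N p)"] sum_mono2])
        fix p assume "p \<in> {p. p \<in> {p. N p \<le> x} \<and> p \<in># g}"
        hence "count g p > 0" by simp
        hence "1 * ln (N p) \<le> real (count g p) * ln (N p)" by (intro mult_right_mono) (auto simp: less_imp_le)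
        thus "ln (N p) \<le> real (count g p) * ln (N p)" by simp
      qed (auto simp: less_imp_le)
      also have "\<dots> = ln (nm g)" by (rule ln_nm_eq[symmetric])
      also have "\<dots> \<le> ln x" using g x by (subst ln_le_cancel_iff) auto
      finally show "(\<Sum>p | p \<in> {p. N p \<le> x} \<and> p \<in># g. ln (N p)) \<le> ln x" .
    qed
    also have "\<dots> = count_G N x * ln x" by (simp add: count_G_eq)
    also have "\<dots> \<le> (B * x) * ln x" using x by (intro mult_right_mono count_G_le) auto
    finally have "x * (k * (\<Sum>p | N p \<le> x. ln (N p) / N p)) \<le> x * (B * ln x)" by (simp only: mult_ac)
    hence "k * (\<Sum>p | N p \<le> x. ln (N p) / N p) \<le> B * ln x" using x by simp
    thus ?thesis using k by (simp add: field_simps)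
  qed
  moreover have "B / k > 0" using k B_ge_1 by simp
  ultimately show ?thesis by blast
qed

text \<open>Primes between \<open>exp t\<close> and \<open>exp (2 * t)\<close> satisfy
  \<open>1 \<le> ln (N p) / t\<close>, so by the Mertens bound they contribute at most
  \<open>2 * K1\<close>. Reaching \<open>x\<close> takes about \<open>log 2 (ln x)\<close> doublings
  of \<open>t\<close>. The \<open>max 1\<close> serves small \<open>x\<close>.\<close>

lemma sum_inverse_primes_le:
  "\<exists>K\<ge>1. \<forall>x. (\<Sum>p | N p \<le> x. 1 / N p) \<le> K * max 1 (ln (ln x))"
proof -
  obtain K1 where K1: "K1 > 0" "\<And>x. x \<ge> 1 \<Longrightarrow> (\<Sum>p | N p \<le> x. ln (N p) / N p) \<le> K1 * ln x"
    using mertens_upper by blast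
  define S where "S = (\<lambda>x. \<Sum>p | N p \<le> x. 1 / N p)"
  have S_mono: "S x \<le> S y" if "x \<le> y" for x y
    unfolding S_def using that by (intro sum_mono2) (auto simp: less_imp_le)
  have S0: "S x \<ge> 0" for x unfolding S_def by (intro sum_nonneg) (auto simp: less_imp_le)
  have step: "S (exp (2 * t)) \<le> S (exp t) + 2 * K1" if t: "t > 0" for t
  proof -
    let ?D = "{p. N p \<le> exp (2 * t)} - {p. N p \<le> exp t}"
    have "(\<Sum>p\<in>?D. 1 / N p) \<le> (\<Sum>p\<in>?D. (1 / t) * (ln (N p) / N p))"
    proof (rule sum_mono)
      fix p assume "p \<in> ?D"
      hence "exp t < N p" by auto
      hence "t < ln (N p)" by (metis exp_less_cancel_iff exp_ln N_pos)
      hence "1 * (1 / N p) \<le> (ln (N p) / t) * (1 / N p)" using t by (intro mult_right_mono) (auto simp: less_imp_le)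
      thus "1 / N p \<le> (1 / t) * (ln (N p) / N p)" by simp
    qed
    also have "\<dots> = (1 / t) * (\<Sum>p\<in>?D. ln (N p) / N p)" by (simp add: sum_distrib_left)
    also have "\<dots> \<le> (1 / t) * (\<Sum>p | N p \<le> exp (2 * t). ln (N p) / N p)"
      using t by (intro mult_left_mono sum_mono2) (auto simp: less_imp_le intro!: divide_nonneg_pos)
    also have "\<dots> \<le> (1 / t) * (K1 * (2 * t))"
      using K1(2)[of "exp (2 * t)"] t by (intro mult_left_mono) auto
    also have "\<dots> = 2 * K1" using t by simp
    finally have "(\<Sum>p\<in>?D. 1 / N p) \<le> 2 * K1" .
    moreover have "S (exp (2 * t)) = (\<Sum>p\<in>?D. 1 / N p) + S (exp t)"
      unfolding S_def by (rule sum.subset_diff) (use t in \<open>auto intro: order_trans\<close>)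
    ultimately show ?thesis by linarith
  qed
  have iter: "S (exp (2 ^ n)) \<le> S (exp 1) + 2 * K1 * real n" for n
  proof (induction n)
    case (Suc n)
    thus ?case using step[of "2 ^ n"] by (simp add: algebra_simps)
  qed simp
  define K where "K = S (exp 1) + 2 * K1 * (1 + 1 / ln 2) + 1"
  have l2: "ln 2 > (0::real)" by simp
  have K_ge: "K \<ge> S (exp 1) + 2 * K1 * (1 + 1 / ln 2)" "K \<ge> 1"
    using S0[of "exp 1"] K1(1) l2 by (auto simp: K_def)
  have "S x \<le> K * max 1 (ln (ln x))" for x
  proof (cases "x \<le> exp 1")
    case True
    have "S x \<le> S (exp 1)" using True by (rule S_mono)
    also have "\<dots> \<le> K * 1" using K1(1) l2 by (simp add: K_def)
    also have "\<dots> \<le> K * max 1 (ln (ln x))" using K_ge by (intro mult_left_mono) auto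
    finally show ?thesis .
  next
    case False
    hence x: "x > exp 1" by simp
    have x0: "x > 0" using x by (meson exp_gt_zero less_trans)
    have lx: "ln x > 1" using x x0 by (metis exp_less_cancel_iff exp_ln)
    define r where "r = ln (ln x) / ln 2"
    have r0: "r > 0" using lx l2 by (simp add: r_def)
    define n where "n = nat \<lceil>r\<rceil>"
    have n: "r \<le> real n" "real n \<le> r + 1" using r0 unfolding n_def by linarith+
    have "ln x = 2 powr r" unfolding r_def powr_def using lx by simp
    also have "\<dots> \<le> 2 powr real n" using n by (intro powr_mono) auto
    also have "\<dots> = 2 ^ n" by (simp add: powr_realpow)
    finally have "x \<le> exp (2 ^ n)" using x0 by (metis exp_le_cancel_iff exp_ln)
    hence "S x \<le> S (exp (2 ^ n))" by (rule S_mono)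
    also have "\<dots> \<le> S (exp 1) + 2 * K1 * real n" by (rule iter)
    also have "\<dots> \<le> S (exp 1) + 2 * K1 * (r + 1)" using n K1 by simp
    also have "\<dots> \<le> S (exp 1) * max 1 (ln (ln x)) + 2 * K1 * ((1 + 1 / ln 2) * max 1 (ln (ln x)))"
    proof (intro add_mono mult_left_mono)
      have "r = ln (ln x) * (1 / ln 2)" by (simp add: r_def)
      also have "\<dots> \<le> max 1 (ln (ln x)) * (1 / ln 2)" using l2 by (intro mult_right_mono) auto
      finally show "r + 1 \<le> (1 + 1 / ln 2) * max 1 (ln (ln x))" by (simp add: algebra_simps)
      show "S (exp 1) \<le> S (exp 1) * max 1 (ln (ln x))" using mult_left_mono[of 1 "max 1 (ln (ln x))" "S (exp 1)"] S0 by simp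
    qed (use K1 in auto)
    also have "\<dots> = (S (exp 1) + 2 * K1 * (1 + 1 / ln 2)) * max 1 (ln (ln x))" by (simp add: algebra_simps)
    also have "\<dots> \<le> K * max 1 (ln (ln x))" using K_ge by (intro mult_right_mono) auto
    finally show ?thesis .
  qed
  thus ?thesis using K_ge unfolding S_def by blast
qed

subsection \<open>Pairs of a smooth element and a prime\<close>

text \<open>The inserted 1 gives the identity a value below every prime norm.\<close>

definition Nplus :: "'p multiset \<Rightarrow> real" where "Nplus m = Max (insert 1 (N ` set_mset m))"

lemma Nplus_le_iff: "Nplus m \<le> y \<longleftrightarrow> 1 \<le> y \<and> (\<forall>p\<in>#m. N p \<le> y)"
  unfolding Nplus_def by (subst Max_le_iff) auto

lemma Nplus_ge_1: "Nplus m \<ge> 1" unfolding Nplus_def by (intro Max_ge) auto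

lemma N_le_Nplus: "p \<in># m \<Longrightarrow> N p \<le> Nplus m" unfolding Nplus_def by (intro Max_ge) auto

lemma Nplus_le_N_iff: "Nplus m \<le> N P \<longleftrightarrow> m \<in> smooth {p. N p \<le> N P}"
  unfolding Nplus_le_iff smooth_def using N_gt_1[of P] by auto

text \<open>The cofactors \<open>m\<close> for which the range of norms from \<open>Nplus m\<close>
  to \<open>x / nm m\<close>, available to a largest prime, is nonempty.\<close>

definition V :: "real \<Rightarrow> 'p multiset set" where "V x = {m. nm m * Nplus m \<le> x}"

lemma V_subset_le: "V x \<subseteq> le x"
proof
  fix m assume "m \<in> V x"
  moreover have "nm m * 1 \<le> nm m * Nplus m" by (intro mult_left_mono Nplus_ge_1 nm_nonneg)
  ultimately show "m \<in> le x" unfolding V_def mem_le mem_Collect_eq by linarith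
qed

lemma finite_V [simp]: "finite (V x)"
  by (rule finite_subset[OF V_subset_le finite_le'])

definition Pr :: "real \<Rightarrow> 'p set" where "Pr x = {p. N p \<le> x}"

lemma mem_Pr [simp]: "p \<in> Pr x \<longleftrightarrow> N p \<le> x" by (simp add: Pr_def)

lemma finite_Pr [simp]: "finite (Pr x)" by (simp add: Pr_def)

lemma card_Pr_le: "x \<ge> 0 \<Longrightarrow> real (card (Pr x)) \<le> B * x"
  using card_primes_le[of x] count_G_le[of x] unfolding Pr_def by linarith

text \<open>Removing one copy of \<open>q\<close> at a time turns the multiplicity sum into a
  geometric series in \<open>1 / N q\<close>; the induction divides \<open>z\<close> by
  \<open>N q\<close> until it is below 1.\<close>

lemma sum_count_prime_le:
  assumes "z \<ge> 0"
  shows "(\<Sum>m\<in>le z. real (count m q)) \<le> B * z / (N q - 1)"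
proof -
  have main: "(\<Sum>m\<in>le z. real (count m q)) \<le> B * z / (N q - 1)" if "z \<ge> 0" "z < N q ^ n" for n z
    using that
  proof (induction n arbitrary: z)
    case 0
    thus ?case using N_gt_1[of q] B_ge_1 by (simp add: le_less_1)
  next
    case (Suc n)
    have q: "N q - 1 > 0" using N_gt_1[of q] by simp
    have "(\<Sum>m\<in>le z \<inter> UNIV. real (count m q)) = (\<Sum>m\<in>le z \<inter> (UNIV \<inter> {g. q \<notin># g}). real (count m q))
       + (\<Sum>h\<in>le (z / N q) \<inter> UNIV. real (count (add_mset q h) q))"
      by (rule sum_split_prime) simp
    also have "(\<Sum>m\<in>le z \<inter> (UNIV \<inter> {g. q \<notin># g}). real (count m q)) = 0"
      by (rule sum.neutral) (auto simp: not_in_iff)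
    also have "(\<Sum>h\<in>le (z / N q) \<inter> UNIV. real (count (add_mset q h) q)) = count_G N (z / N q) + (\<Sum>h\<in>le (z / N q). real (count h q))"
      by (simp add: sum.distrib count_G_eq)
    finally have "(\<Sum>m\<in>le z. real (count m q)) = count_G N (z / N q) + (\<Sum>h\<in>le (z / N q). real (count h q))"
      by simp
    also have "\<dots> \<le> B * (z / N q) + B * (z / N q) / (N q - 1)"
      using Suc.prems by (intro add_mono count_G_le Suc.IH) (auto simp: field_simps intro: divide_nonneg_pos)
    also have "\<dots> = B * z / (N q - 1)"
    proof -
      have "a / b + a / b / (b - 1) = a / (b - 1)" if "b > 1" for a b :: real using that by (simp add: field_simps)
      from this[of "N q" "B * z"] show ?thesis using N_gt_1[of q] by simp
    qed
    finally show ?case .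
  qed
  obtain n where "z < N q ^ n" using real_arch_pow[of "N q" z] N_gt_1[of q] by auto
  thus ?thesis using main[of z n] assms by blast
qed

text \<open>Only finitely many primes have norm at most 2, so all norms are at least some
  \<open>q > 1\<close>, and \<open>q / (q - 1)\<close> works.\<close>

lemma inverse_N_minus_1_le: "\<exists>k>0. \<forall>p. 1 / (N p - 1) \<le> k / N p"
proof -
  define q where "q = Min (insert 2 (N ` Pr 2))"
  have q1: "q > 1" unfolding q_def using N_gt_1 by (subst Min_gr_iff) auto
  have qN: "q \<le> N p" for p
  proof (cases "N p \<le> 2")
    case True
    thus ?thesis unfolding q_def by (intro Min_le) auto
  next
    case False
    have "q \<le> 2" unfolding q_def by (intro Min_le) auto
    thus ?thesis using False by simp
  qed
  have "1 / (N p - 1) \<le> (q / (q - 1)) / N p" for p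
    using q1 qN[of p] N_gt_1[of p] by (simp add: field_simps)
  moreover have "q / (q - 1) > 0" using q1 by simp
  ultimately show ?thesis by blast
qed

text \<open>For \<open>N q \<le> N p\<close> the inner sum is a Mertens sum, and its bound
  \<open>K1 * ln (N p)\<close> feeds a second one. For \<open>N p < N q\<close> there are at most
  \<open>B * N q\<close> choices of \<open>p\<close>, which cancels the extra factor
  \<open>1 / N q\<close>.\<close>

lemma sum_pairs_max_le:
  assumes K1: "K1 > 0" "\<And>x. x \<ge> 1 \<Longrightarrow> (\<Sum>p | N p \<le> x. ln (N p) / N p) \<le> K1 * ln x" and s: "s \<ge> 1"
  shows "(\<Sum>p\<in>Pr s. \<Sum>q\<in>Pr s. ln (N q) / N q * (1 / max (N p) (N q))) \<le> (K1 + B) * (K1 * ln s)"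
proof -
  have "(\<Sum>p\<in>Pr s. \<Sum>q\<in>Pr s. ln (N q) / N q * (1 / max (N p) (N q)))
     = (\<Sum>p\<in>Pr s. \<Sum>q\<in>Pr s. if N q \<le> N p then (1 / N p) * (ln (N q) / N q) else 0)
     + (\<Sum>p\<in>Pr s. \<Sum>q\<in>Pr s. if N q \<le> N p then 0 else (ln (N q) / N q) * (1 / N q))"
    unfolding sum.distrib[symmetric] by (intro sum.cong refl) (auto simp: max_def)
  also have "(\<Sum>p\<in>Pr s. \<Sum>q\<in>Pr s. if N q \<le> N p then (1 / N p) * (ln (N q) / N q) else 0) \<le> (\<Sum>p\<in>Pr s. K1 * (ln (N p) / N p))"
  proof (rule sum_mono)
    fix p assume p: "p \<in> Pr s"
    have "(\<Sum>q\<in>Pr s. if N q \<le> N p then (1 / N p) * (ln (N q) / N q) else 0) = (\<Sum>q\<in>Pr s \<inter> {q. N q \<le> N p}. (1 / N p) * (ln (N q) / N q))"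
      by (subst sum.inter_restrict) auto
    also have "Pr s \<inter> {q. N q \<le> N p} = {q. N q \<le> N p}" using p by auto
    also have "(\<Sum>q | N q \<le> N p. (1 / N p) * (ln (N q) / N q)) = (1 / N p) * (\<Sum>q | N q \<le> N p. ln (N q) / N q)"
      by (simp add: sum_distrib_left)
    also have "\<dots> \<le> (1 / N p) * (K1 * ln (N p))"
      using N_gt_1[of p] by (intro mult_left_mono K1) (auto simp: less_imp_le)
    finally show "(\<Sum>q\<in>Pr s. if N q \<le> N p then (1 / N p) * (ln (N q) / N q) else 0) \<le> K1 * (ln (N p) / N p)" by simp
  qed
  also have "(\<Sum>p\<in>Pr s. \<Sum>q\<in>Pr s. if N q \<le> N p then 0 else (ln (N q) / N q) * (1 / N q))
     = (\<Sum>q\<in>Pr s. \<Sum>p\<in>Pr s. if N q \<le> N p then 0 else (ln (N q) / N q) * (1 / N q))"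
    by (rule sum.swap)
  also have "\<dots> \<le> (\<Sum>q\<in>Pr s. B * (ln (N q) / N q))"
  proof (rule sum_mono)
    fix q assume "q \<in> Pr s"
    have "(\<Sum>p\<in>Pr s. if N q \<le> N p then 0 else (ln (N q) / N q) * (1 / N q))
       = (\<Sum>p\<in>Pr s \<inter> - {p. N q \<le> N p}. (ln (N q) / N q) * (1 / N q))"
      by (subst sum.If_cases) auto
    also have "\<dots> \<le> (\<Sum>p\<in>Pr (N q). (ln (N q) / N q) * (1 / N q))"
      by (intro sum_mono2) (auto simp: less_imp_le intro!: divide_nonneg_pos mult_nonneg_nonneg)
    also have "\<dots> = real (card (Pr (N q))) * ((ln (N q) / N q) * (1 / N q))" by simp
    also have "\<dots> \<le> (B * N q) * ((ln (N q) / N q) * (1 / N q))"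
      by (intro mult_right_mono card_Pr_le mult_nonneg_nonneg divide_nonneg_pos) (auto simp: less_imp_le)
    also have "\<dots> = B * (ln (N q) / N q)" by simp
    finally show "(\<Sum>p\<in>Pr s. if N q \<le> N p then 0 else (ln (N q) / N q) * (1 / N q)) \<le> B * (ln (N q) / N q)" .
  qed
  finally have "(\<Sum>p\<in>Pr s. \<Sum>q\<in>Pr s. ln (N q) / N q * (1 / max (N p) (N q)))
      \<le> (\<Sum>p\<in>Pr s. K1 * (ln (N p) / N p)) + (\<Sum>q\<in>Pr s. B * (ln (N q) / N q))" by simp
  also have "\<dots> = (K1 + B) * (\<Sum>p\<in>Pr s. ln (N p) / N p)"
    by (simp only: sum_distrib_left distrib_right sum.distrib)
  also have "\<dots> \<le> (K1 + B) * (K1 * ln s)"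
    using K1(2)[OF s] K1(1) B_ge_1 unfolding Pr_def by (intro mult_left_mono) auto
  finally show ?thesis .
qed

text \<open>Comparing \<open>ln (nm m)\<close> with the sum of \<open>ln q\<close> over the prime powers dividing \<open>m\<close>
  shows that smooth \<open>m\<close> are rare enough to gain the factor \<open>ln x\<close>.\<close>

lemma sum_V_large_le:
  "\<exists>K\<ge>0. \<forall>x\<ge>2. (\<Sum>m\<in>V x - le (sqrt x). real (card (Pr (sqrt x) \<inter> Pr (x / nm m)))) \<le> K * x"
proof -
  obtain k where k: "k > 0" "\<And>p. 1 / (N p - 1) \<le> k / N p" using inverse_N_minus_1_le by blast
  obtain K1 where K1: "K1 > 0" "\<And>x. x \<ge> 1 \<Longrightarrow> (\<Sum>p | N p \<le> x. ln (N p) / N p) \<le> K1 * ln x"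
    using mertens_upper by blast
  define K where "K = B * k * (K1 + B) * K1"
  have K0: "K \<ge> 0" using k K1 B_ge_1 by (simp add: K_def)
  have "(\<Sum>m\<in>V x - le (sqrt x). real (card (Pr (sqrt x) \<inter> Pr (x / nm m)))) \<le> K * x" if x: "x \<ge> 2" for x
  proof -
    define s where "s = sqrt x"
    have s: "s \<ge> 1" "s * s = x" using x by (auto simp: s_def)
    have lns: "ln s > 0" using x by (simp add: s_def ln_sqrt)
    define t where "t = (\<lambda>m q. real (count m q) * ln (N q))"
    have t0: "t m q \<ge> 0" for m q by (auto simp: t_def less_imp_le)
    \<comment> \<open>If \<open>q\<close> divides \<open>m\<close> in \<open>V x\<close>, then
      \<open>N q * N q \<le> nm m * Nplus m \<le> x\<close>, so all primes of \<open>m\<close> have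
      norm at most \<open>sqrt x\<close>.\<close>
    have sub: "set_mset m \<subseteq> Pr s \<and> (\<forall>q\<in>#m. nm m * N q \<le> x)" if m: "m \<in> V x" for m
    proof -
      have "nm m * N q \<le> x" if "q \<in># m" for q
        using mult_left_mono[OF N_le_Nplus[OF that] nm_nonneg[of m]] m unfolding V_def mem_Collect_eq by linarith
      moreover have "N q \<le> s" if "q \<in># m" for q
      proof -
        have "N q * N q \<le> nm m * N q" using N_le_nm[OF that] by (intro mult_right_mono) (auto simp: less_imp_le)
        hence "N q * N q \<le> x" using calculation[OF that] by linarith
        thus ?thesis unfolding s_def by (intro real_le_rsqrt) (simp add: power2_eq_square)
      qed
      ultimately show ?thesis by auto
    qed
    \<comment> \<open>Outside \<open>le s\<close> one has \<open>ln s \<le> ln (nm m)\<close>.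
      Expanding \<open>ln (nm m)\<close> over primes gives a sum over \<open>p\<close>,
      \<open>q\<close> and \<open>m\<close>, and the final bound contains a factor
      \<open>ln s\<close> that cancels.\<close>
    have "ln s * (\<Sum>m\<in>V x - le s. real (card (Pr s \<inter> Pr (x / nm m))))
       = (\<Sum>m\<in>V x - le s. \<Sum>p\<in>Pr s \<inter> Pr (x / nm m). ln s)"
      by (simp add: sum_distrib_left mult.commute)
    also have "\<dots> \<le> (\<Sum>m\<in>V x - le s. \<Sum>p\<in>Pr s \<inter> Pr (x / nm m). ln (nm m))"
      by (intro sum_mono) (use s in \<open>auto intro!: ln_mono\<close>)
    also have "\<dots> \<le> (\<Sum>m\<in>V x. \<Sum>p\<in>Pr s \<inter> Pr (x / nm m). ln (nm m))"
      by (intro sum_mono2) (auto intro!: sum_nonneg)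
    also have "\<dots> = (\<Sum>m\<in>V x. \<Sum>p\<in>Pr s. \<Sum>q\<in>Pr s. if max (N p) (N q) * nm m \<le> x then t m q else 0)"
    proof (rule sum.cong[OF refl])
      fix m assume m: "m \<in> V x"
      have ln: "ln (nm m) = (\<Sum>q\<in>Pr s. if N q * nm m \<le> x then t m q else 0)"
        unfolding ln_nm_eq t_def
        by (rule sum.mono_neutral_cong_left) (use sub[OF m] in \<open>auto simp: not_in_iff mult.commute\<close>)
      have "(\<Sum>p\<in>Pr s \<inter> Pr (x / nm m). ln (nm m)) = (\<Sum>p\<in>Pr s. if N p * nm m \<le> x then ln (nm m) else 0)"
        by (subst sum.inter_restrict) (auto simp: field_simps intro!: sum.cong)
      also have "\<dots> = (\<Sum>p\<in>Pr s. \<Sum>q\<in>Pr s. if max (N p) (N q) * nm m \<le> x then t m q else 0)"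
      proof (rule sum.cong[OF refl])
        fix p
        have mx: "max (N p) (N q) * nm m \<le> x \<longleftrightarrow> N p * nm m \<le> x \<and> N q * nm m \<le> x" for q
        proof (cases "N p \<le> N q")
          case True
          hence "N p * nm m \<le> N q * nm m" by (intro mult_right_mono) auto
          thus ?thesis using True unfolding max_def by (simp only: if_True) linarith
        next
          case False
          hence "N q * nm m \<le> N p * nm m" by (intro mult_right_mono) auto
          thus ?thesis using False unfolding max_def by (simp only: if_False) linarith
        qed
        show "(if N p * nm m \<le> x then ln (nm m) else 0) = (\<Sum>q\<in>Pr s. if max (N p) (N q) * nm m \<le> x then t m q else 0)"
          unfolding mx ln by (auto intro!: sum.cong)
      qed
      finally show "(\<Sum>p\<in>Pr s \<inter> Pr (x / nm m). ln (nm m)) = (\<Sum>p\<in>Pr s. \<Sum>q\<in>Pr s. if max (N p) (N q) * nm m \<le> x then t m q else 0)" .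
    qed
    also have "\<dots> = (\<Sum>p\<in>Pr s. \<Sum>m\<in>V x. \<Sum>q\<in>Pr s. if max (N p) (N q) * nm m \<le> x then t m q else 0)"
      by (rule sum.swap)
    also have "\<dots> = (\<Sum>p\<in>Pr s. \<Sum>q\<in>Pr s. \<Sum>m\<in>V x. if max (N p) (N q) * nm m \<le> x then t m q else 0)"
      by (intro sum.cong refl sum.swap)
    also have "\<dots> \<le> (\<Sum>p\<in>Pr s. \<Sum>q\<in>Pr s. (B * x * k) * (ln (N q) / N q * (1 / max (N p) (N q))))"
    proof (intro sum_mono)
      fix p q
      define M where "M = max (N p) (N q)"
      have M: "M > 0" using N_pos[of p] by (simp add: M_def less_max_iff_disj)
      have "(\<Sum>m\<in>V x. if M * nm m \<le> x then t m q else 0) = (\<Sum>m\<in>V x \<inter> {m. M * nm m \<le> x}. t m q)"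
        by (subst sum.inter_restrict) auto
      also have "\<dots> \<le> (\<Sum>m\<in>le (x / M). t m q)"
        using M t0 by (intro sum_mono2) (auto simp: field_simps)
      also have "\<dots> = ln (N q) * (\<Sum>m\<in>le (x / M). real (count m q))"
        by (simp add: t_def sum_distrib_left mult.commute)
      also have "\<dots> \<le> ln (N q) * (B * (x / M) / (N q - 1))"
        using M x by (intro mult_left_mono sum_count_prime_le) (auto simp: less_imp_le)
      also have "\<dots> = (ln (N q) * (B * (x / M))) * (1 / (N q - 1))" by simp
      also have "\<dots> \<le> (ln (N q) * (B * (x / M))) * (k / N q)"
        using M x B_ge_1 by (intro mult_left_mono k) (auto simp: less_imp_le)
      also have "\<dots> = (B * x * k) * (ln (N q) / N q * (1 / M))" by (simp add: field_simps)
      finally show "(\<Sum>m\<in>V x. if max (N p) (N q) * nm m \<le> x then t m q else 0) \<le> (B * x * k) * (ln (N q) / N q * (1 / max (N p) (N q)))"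
        by (simp add: M_def)
    qed
    also have "\<dots> = (B * x * k) * (\<Sum>p\<in>Pr s. \<Sum>q\<in>Pr s. ln (N q) / N q * (1 / max (N p) (N q)))"
      by (simp only: sum_distrib_left)
    also have "\<dots> \<le> (B * x * k) * ((K1 + B) * (K1 * ln s))"
      using x k B_ge_1 by (intro mult_left_mono sum_pairs_max_le[OF K1 s(1)]) auto
    also have "\<dots> = ln s * (K * x)" by (simp add: K_def)
    finally show ?thesis using lns unfolding s_def by (simp only: mult_le_cancel_left_pos)
  qed
  thus ?thesis using K0 by blast
qed

text \<open>Three ranges. Primes above \<open>sqrt x\<close> are handled by the Mertens bound, as
  \<open>ln (N p) \<ge> ln x / 2\<close> there; elements and primes both up to \<open>sqrt x\<close>
  give at most \<open>B * B * x\<close> pairs; elements above \<open>sqrt x\<close> with primes up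
  to \<open>sqrt x\<close> are the smooth case already settled.\<close>

lemma sum_V_prime_count_le: "\<exists>K\<ge>0. \<forall>x\<ge>2. (\<Sum>m\<in>V x. real (card (Pr (x / nm m)))) \<le> K * x"
proof -
  obtain K1 where K1: "K1 > 0" "\<And>x. x \<ge> 1 \<Longrightarrow> (\<Sum>p | N p \<le> x. ln (N p) / N p) \<le> K1 * ln x"
    using mertens_upper by blast
  obtain K2 where K2: "K2 \<ge> 0" "\<And>x. x \<ge> 2 \<Longrightarrow> (\<Sum>m\<in>V x - le (sqrt x). real (card (Pr (sqrt x) \<inter> Pr (x / nm m)))) \<le> K2 * x"
    using sum_V_large_le by blast
  define K where "K = B * (2 * K1) + B * B + K2"
  have "(\<Sum>m\<in>V x. real (card (Pr (x / nm m)))) \<le> K * x" if x: "x \<ge> 2" for x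
  proof -
    define s where "s = sqrt x"
    have s: "s \<ge> 1" "s * s = x" using x by (auto simp: s_def)
    have lns: "ln s > 0" "ln x = 2 * ln s" using x by (auto simp: s_def ln_sqrt)
    define b where "b = (\<lambda>m. real (card (Pr s \<inter> Pr (x / nm m))))"
    have b0: "b m \<ge> 0" for m by (simp add: b_def)
    have "(\<Sum>m\<in>V x. real (card (Pr (x / nm m)))) \<le> (\<Sum>m\<in>V x. real (card (Pr (x / nm m) - Pr s)) + b m)"
    proof (rule sum_mono)
      fix m
      have "card (Pr (x / nm m)) = card (Pr (x / nm m) - Pr s) + card (Pr (x / nm m) \<inter> Pr s)"
        by (subst card_Diff_subset_Int) (auto simp: card_mono)
      thus "real (card (Pr (x / nm m))) \<le> real (card (Pr (x / nm m) - Pr s)) + b m" by (simp add: b_def Int_commute)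
    qed
    also have "\<dots> = (\<Sum>m\<in>V x. real (card (Pr (x / nm m) - Pr s))) + (\<Sum>m\<in>V x. b m)" by (rule sum.distrib)
    also have "(\<Sum>m\<in>V x. real (card (Pr (x / nm m) - Pr s))) \<le> B * (2 * K1) * x"
    proof -
      have "(\<Sum>m\<in>V x. real (card (Pr (x / nm m) - Pr s))) \<le> (\<Sum>m\<in>le x. real (card (Pr (x / nm m) - Pr s)))"
        by (intro sum_mono2 V_subset_le) auto
      also have "\<dots> = (\<Sum>m\<in>le x. \<Sum>p | p \<in> Pr x - Pr s \<and> nm m * N p \<le> x. 1)"
      proof (rule sum.cong[OF refl])
        fix m
        have "N p \<le> x" if "nm m * N p \<le> x" for p
        proof -
          have "1 * N p \<le> nm m * N p" by (intro mult_right_mono nm_ge_1) (auto simp: less_imp_le)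
          thus ?thesis using that by linarith
        qed
        hence "{p. p \<in> Pr x - Pr s \<and> nm m * N p \<le> x} = Pr (x / nm m) - Pr s" by (auto simp: field_simps)
        thus "real (card (Pr (x / nm m) - Pr s)) = (\<Sum>p | p \<in> Pr x - Pr s \<and> nm m * N p \<le> x. 1)" by simp
      qed
      also have "\<dots> = (\<Sum>p\<in>Pr x - Pr s. \<Sum>m | m \<in> le x \<and> nm m * N p \<le> x. 1)"
        by (rule sum.swap_restrict) auto
      also have "\<dots> \<le> (\<Sum>p\<in>Pr x - Pr s. (B * x / ln s) * (ln (N p) / N p))"
      proof (rule sum_mono)
        fix p assume p: "p \<in> Pr x - Pr s"
        have "(\<Sum>m | m \<in> le x \<and> nm m * N p \<le> x. 1::real) = real (card {m. m \<in> le x \<and> nm m * N p \<le> x})" by simp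
        also have "\<dots> \<le> count_G N (x / N p)"
          unfolding count_G_eq by (intro of_nat_mono card_mono) (auto simp: field_simps)
        also have "\<dots> \<le> B * (x / N p)" using x by (intro count_G_le) (auto intro: divide_nonneg_pos)
        also have "\<dots> = (B * (x / N p)) * 1" by simp
        also have "\<dots> \<le> (B * (x / N p)) * (ln (N p) / ln s)"
        proof (rule mult_left_mono)
          have "ln s \<le> ln (N p)" using p s by (intro ln_mono) auto
          thus "1 \<le> ln (N p) / ln s" using lns by simp
        qed (use x B_ge_1 in \<open>auto intro!: divide_nonneg_pos\<close>)
        also have "(B * (x / N p)) * (ln (N p) / ln s) = (B * x / ln s) * (ln (N p) / N p)" by (simp add: mult.commute)
        finally show "(\<Sum>m | m \<in> le x \<and> nm m * N p \<le> x. 1) \<le> (B * x / ln s) * (ln (N p) / N p)" .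
      qed
      also have "\<dots> = (B * x / ln s) * (\<Sum>p\<in>Pr x - Pr s. ln (N p) / N p)" by (simp only: sum_distrib_left)
      also have "\<dots> \<le> (B * x / ln s) * (\<Sum>p\<in>Pr x. ln (N p) / N p)"
        using x B_ge_1 lns by (intro mult_left_mono sum_mono2) (auto simp: less_imp_le intro!: divide_nonneg_pos)
      also have "\<dots> \<le> (B * x / ln s) * (K1 * ln x)"
        using x B_ge_1 lns K1(2)[of x] unfolding Pr_def by (intro mult_left_mono) auto
      also have "\<dots> = B * (2 * K1) * x" using lns by simp
      finally show ?thesis .
    qed
    also have "(\<Sum>m\<in>V x. b m) = (\<Sum>m\<in>V x \<inter> le s. b m) + (\<Sum>m\<in>V x - le s. b m)"
      by (rule sum.Int_Diff) simp
    also have "(\<Sum>m\<in>V x \<inter> le s. b m) \<le> (\<Sum>m\<in>le s. B * s)"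
    proof (rule order_trans[OF sum_mono2 sum_mono])
      fix m
      have "b m \<le> real (card (Pr s))" unfolding b_def by (intro of_nat_mono card_mono) auto
      thus "b m \<le> B * s" using card_Pr_le[of s] s by linarith
    qed (use b0 in auto)
    also have "\<dots> = count_G N s * (B * s)" by (simp add: count_G_eq)
    also have "\<dots> \<le> (B * s) * (B * s)" using s B_ge_1 by (intro mult_right_mono count_G_le) auto
    also have "\<dots> = B * B * x" using s(2) by (simp add: algebra_simps)
    also have "(\<Sum>m\<in>V x - le s. b m) \<le> K2 * x" using K2(2)[OF x] by (simp add: b_def s_def)
    finally show ?thesis by (simp add: K_def algebra_simps)
  qed
  moreover have "K \<ge> 0" using K1 K2 B_ge_1 by (simp add: K_def)
  ultimately show ?thesis by blast
qed

text \<open>Elements of \<open>V x\<close> either have all primes of norm at most \<open>T\<close>,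
  a set of density 0, or a prime above \<open>T\<close>, which forces
  \<open>nm m \<le> x / T\<close>.\<close>

lemma card_V_tendsto_0: "((\<lambda>x. real (card (V x)) / x) \<longlongrightarrow> 0) at_top"
proof (rule tendstoI)
  fix e :: real assume e: "e > 0"
  define T where "T = 2 * B / e"
  have T: "T > 0" using e B_ge_1 by (simp add: T_def)
  have "eventually (\<lambda>x. real (card (le x \<inter> smooth {p. N p \<le> T})) / x < e / 2) at_top"
    using e by (intro order_tendstoD(2)[OF card_smooth_tendsto_0]) auto
  thus "eventually (\<lambda>x. dist (real (card (V x)) / x) 0 < e) at_top"
    using eventually_gt_at_top[of 0]
  proof eventually_elim
    case (elim x)
    have "V x \<subseteq> (le x \<inter> smooth {p. N p \<le> T}) \<union> le (x / T)"
    proof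
      fix m assume m: "m \<in> V x"
      show "m \<in> (le x \<inter> smooth {p. N p \<le> T}) \<union> le (x / T)"
      proof (cases "\<forall>p\<in>#m. N p \<le> T")
        case False
        then obtain p where p: "p \<in># m" "N p > T" by (auto simp: not_le)
        have "nm m * T \<le> nm m * Nplus m" using N_le_Nplus[OF p(1)] p(2) by (intro mult_left_mono) auto
        hence "nm m * T \<le> x" using m unfolding V_def mem_Collect_eq by linarith
        thus ?thesis using T by (simp add: field_simps)
      qed (use m V_subset_le[of x] in \<open>auto simp: smooth_def\<close>)
    qed
    hence "card (V x) \<le> card (le x \<inter> smooth {p. N p \<le> T}) + card (le (x / T))"
      by (intro order_trans[OF card_mono card_Un_le]) auto
    hence "real (card (V x)) \<le> real (card (le x \<inter> smooth {p. N p \<le> T})) + count_G N (x / T)"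
      unfolding count_G_eq by linarith
    also have "count_G N (x / T) \<le> B * (x / T)" using T elim by (intro count_G_le) auto
    also have "B * (x / T) = e / 2 * x" using B_ge_1 e by (simp add: T_def)
    finally have "real (card (V x)) / x \<le> real (card (le x \<inter> smooth {p. N p \<le> T})) / x + e / 2"
      using elim by (simp add: field_simps)
    moreover have "real (card (V x)) / x \<ge> 0" using elim by simp
    ultimately show ?case using elim unfolding dist_real_def diff_0_right by linarith
  qed
qed

subsection \<open>Largest primes in a set of given density\<close>

text \<open>The jump of the counting function at \<open>t\<close> has no main term: comparing
  \<open>t\<close> with a slightly smaller \<open>s\<close> leaves two error terms and
  \<open>c * (t - s)\<close>, which is arbitrarily small.\<close>

lemma card_primes_norm_eq_le:
  assumes t: "t > 1"
  shows "real (card {q. N q = t}) \<le> 2 * C * t powr \<eta>"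
proof (rule field_le_epsilon)
  fix e :: real assume e: "e > 0"
  define s where "s = max 1 (t - e / c)"
  have s: "s \<ge> 1" "s < t" "t - s \<le> e / c" using t e c_pos by (auto simp: s_def)
  have "(\<lambda>q. {#q#}) ` {q. N q = t} \<subseteq> le t - le s" using s by auto
  hence "card ((\<lambda>q. {#q#}) ` {q. N q = t}) \<le> card (le t - le s)" by (intro card_mono) auto
  moreover have "card ((\<lambda>q. {#q#}) ` {q. N q = t}) = card {q. N q = t}"
    by (rule card_image) (auto simp: inj_on_def)
  moreover have "card (le t - le s) = card (le t) - card (le s)"
    by (rule card_Diff_subset) (use s in auto)
  moreover have "card (le s) \<le> card (le t)" by (rule card_mono) (use s in auto)
  ultimately have "real (card {q. N q = t}) \<le> count_G N t - count_G N s" unfolding count_G_eq by linarith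
  also have "\<dots> \<le> c * (t - s) + C * t powr \<eta> + C * s powr \<eta>"
    using count_approx[of t] count_approx[of s] s t unfolding right_diff_distrib by linarith
  also have "C * s powr \<eta> \<le> C * t powr \<eta>"
    using s eta_pos C_nonneg by (intro mult_left_mono powr_mono2) auto
  also have "c * (t - s) \<le> c * (e / c)" using s c_pos by (intro mult_left_mono) auto
  also have "c * (e / c) = e" using c_pos by simp
  finally show "real (card {q. N q = t}) \<le> 2 * C * t powr \<eta> + e" by simp
qed

definition tied :: "'p \<Rightarrow> real \<Rightarrow> 'p multiset set" where
  "tied P x = {m \<in> le (x / N P). Nplus m = N P}"

lemma finite_tied [simp]: "finite (tied P x)"
  by (rule finite_subset[OF _ finite_le'[of "x / N P"]]) (auto simp: tied_def)

text \<open>An element of \<open>tied P x\<close> contains some \<open>q\<close> with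
  \<open>N q = N P\<close>; removing it leaves a smooth element of norm at most
  \<open>x / (N P)\<^sup>2\<close>.\<close>

lemma card_tied_le:
  "card (tied P x) \<le> card {q. N q = N P} * card (le (x / (N P)\<^sup>2) \<inter> smooth {p. N p \<le> N P})"
proof -
  let ?A = "{q. N q = N P}" and ?B = "le (x / (N P)\<^sup>2) \<inter> smooth {p. N p \<le> N P}"
  have fin: "finite ?A" by (rule finite_subset[OF _ finite_Pr[of "N P"]]) auto
  have "tied P x \<subseteq> (\<lambda>(q, k). add_mset q k) ` (?A \<times> ?B)"
  proof
    fix m assume m: "m \<in> tied P x"
    hence "Nplus m = N P" by (simp add: tied_def)
    moreover have "Nplus m \<in> insert 1 (N ` set_mset m)" unfolding Nplus_def by (rule Max_in) auto
    ultimately obtain q where q: "q \<in># m" "N q = N P" using N_gt_1[of P] by auto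
    then obtain k where k: "m = add_mset q k" by (auto dest: multi_member_split)
    have "m \<in> smooth {p. N p \<le> N P}" using \<open>Nplus m = N P\<close> Nplus_le_N_iff[of m P] by simp
    hence "k \<in> smooth {p. N p \<le> N P}" by (simp add: k smooth_def)
    moreover have "nm k \<le> x / (N P)\<^sup>2" using m q k by (simp add: tied_def field_simps power2_eq_square)
    ultimately show "m \<in> (\<lambda>(q, k). add_mset q k) ` (?A \<times> ?B)" using q k by force
  qed
  hence "card (tied P x) \<le> card (?A \<times> ?B)" using fin by (intro surj_card_le) auto
  thus ?thesis by (simp add: card_cartesian_product)
qed

definition ties :: "real \<Rightarrow> real" where "ties x = (\<Sum>P\<in>Pr x. real (card (tied P x)))"

text \<open>A subseries, indexed by the primes, of the absolutely convergent zeta series with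
  exponent \<open>2 - \<eta> > 1\<close>.\<close>

lemma summable_primes_powr: "(\<lambda>p. N p powr (\<eta> - 2)) summable_on UNIV"
proof -
  define z where "z = complex_of_real (1 - \<eta>)"
  have "(\<lambda>g. norm (dterm z g)) summable_on range (\<lambda>p. {#p#})"
    by (rule summable_on_subset_banach[OF dterm_abs_summable]) (use eta_less_1 in \<open>auto simp: z_def\<close>)
  hence "((\<lambda>g. norm (dterm z g)) \<circ> (\<lambda>p. {#p#})) summable_on UNIV"
    by (subst (asm) summable_on_reindex) (auto simp: inj_on_def)
  thus ?thesis by (simp add: norm_dterm_powr z_def o_def algebra_simps)
qed

text \<open>For each fixed \<open>P\<close> the ties are o(x) because smooth elements have density
  0. The factor \<open>N P powr \<eta>\<close> for equal norms against \<open>(N P)\<^sup>2\<close>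
  from the two large primes gives a summable majorant.\<close>

lemma ties_tendsto_0: "((\<lambda>x. ties x / x) \<longlongrightarrow> 0) at_top"
proof -
  let ?g = "\<lambda>p. 2 * C * B * N p powr (\<eta> - 2)"
  have bound: "real (card (tied P x)) / x \<le> ?g P" if "x > 0" for P x
  proof -
    have "real (card (le (x / (N P)\<^sup>2) \<inter> smooth {p. N p \<le> N P})) \<le> count_G N (x / (N P)\<^sup>2)"
      unfolding count_G_eq by (intro of_nat_mono card_mono) auto
    also have "\<dots> \<le> B * (x / (N P)\<^sup>2)" by (rule count_G_le) (use that in auto)
    finally have 1: "real (card (le (x / (N P)\<^sup>2) \<inter> smooth {p. N p \<le> N P})) \<le> B * (x / (N P)\<^sup>2)" .
    have "real (card (tied P x)) \<le> real (card {q. N q = N P}) * real (card (le (x / (N P)\<^sup>2) \<inter> smooth {p. N p \<le> N P}))"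
      using card_tied_le[of P x] by (metis of_nat_le_iff of_nat_mult)
    also have "\<dots> \<le> (2 * C * N P powr \<eta>) * (B * (x / (N P)\<^sup>2))"
      using C_nonneg by (intro mult_mono 1 card_primes_norm_eq_le N_gt_1) auto
    also have "\<dots> = ?g P * x"
      using powr_diff[of "N P" \<eta> 2] by (simp add: powr_numeral less_imp_le)
    finally show ?thesis using that by (simp add: field_simps)
  qed
  \<comment> \<open>The majorant is available only for positive \<open>x\<close>, so the index set
    is emptied otherwise.\<close>
  have "((\<lambda>x. \<Sum>P\<in>(if x > 0 then Pr x else {}). real (card (tied P x)) / x) \<longlongrightarrow> infsum (\<lambda>_. 0) (UNIV :: 'p set)) at_top"
  proof (rule tendsto_sum_dominated[where g = ?g])
    show "?g summable_on UNIV" by (intro summable_on_cmult_right summable_primes_powr)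
    show "norm (real (card (tied P x)) / x) \<le> ?g P" if "P \<in> (if x > 0 then Pr x else {})" for x P
      using that bound[of x P] by (auto split: if_splits)
    show "norm (0::real) \<le> ?g P" for P using C_nonneg B_ge_1 by simp
    fix P
    define n where "n = real (card {q. N q = N P})"
    have "((\<lambda>x. n * (real (card (le (x / (N P)\<^sup>2) \<inter> smooth {p. N p \<le> N P})) / (x / (N P)\<^sup>2)) / (N P)\<^sup>2) \<longlongrightarrow> n * 0 / (N P)\<^sup>2) at_top"
      by (intro tendsto_intros filterlim_compose[OF card_smooth_tendsto_0] filterlim_divide_const_at_top) auto
    hence lim: "((\<lambda>x. n * real (card (le (x / (N P)\<^sup>2) \<inter> smooth {p. N p \<le> N P})) / x) \<longlongrightarrow> 0) at_top"
      by simp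
    show "((\<lambda>x. if P \<in> (if x > 0 then Pr x else {}) then real (card (tied P x)) / x else 0) \<longlongrightarrow> 0) at_top"
    proof (rule Lim_null_comparison[OF _ lim])
      show "eventually (\<lambda>x. norm (if P \<in> (if x > 0 then Pr x else {}) then real (card (tied P x)) / x else 0)
        \<le> n * real (card (le (x / (N P)\<^sup>2) \<inter> smooth {p. N p \<le> N P})) / x) at_top"
        using eventually_gt_at_top[of 0]
      proof eventually_elim
        case (elim x)
        have "real (card (tied P x)) \<le> n * real (card (le (x / (N P)\<^sup>2) \<inter> smooth {p. N p \<le> N P}))"
          unfolding n_def using card_tied_le[of P x] by (metis of_nat_le_iff of_nat_mult)
        moreover have "n \<ge> 0" by (simp add: n_def)
        ultimately show ?case using elim by (auto intro!: divide_right_mono)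
      qed
    qed
  qed auto
  hence "((\<lambda>x. \<Sum>P\<in>(if x > 0 then Pr x else {}). real (card (tied P x)) / x) \<longlongrightarrow> 0) at_top" by simp
  moreover have "eventually (\<lambda>x. (\<Sum>P\<in>(if x > 0 then Pr x else {}). real (card (tied P x)) / x) = ties x / x) at_top"
    using eventually_gt_at_top[of 0] by eventually_elim (simp add: ties_def sum_divide_distrib)
  ultimately show ?thesis by (rule Lim_transform_eventually)
qed

text \<open>\<open>weak_count S x\<close> counts factorisations \<open>g = P m\<close> with \<open>P \<in> S\<close> of maximal norm in \<open>g\<close>;
  in \<open>strict_count\<close> no prime of \<open>m\<close> has the same norm as \<open>P\<close>.\<close>

definition weak_count :: "'p set \<Rightarrow> real \<Rightarrow> real" where
  "weak_count S x = (\<Sum>P\<in>S \<inter> Pr x. real (card {m \<in> le (x / N P). Nplus m \<le> N P}))"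

definition strict_count :: "'p set \<Rightarrow> real \<Rightarrow> real" where
  "strict_count S x = (\<Sum>P\<in>S \<inter> Pr x. real (card {m \<in> le (x / N P). Nplus m < N P}))"

lemma finite_le_Collect [simp]: "finite {m. nm m \<le> y \<and> Q m}"
  by (rule finite_subset[OF _ finite_le'[of y]]) auto

lemma weak_count_bounds: "strict_count S x \<le> weak_count S x" "weak_count S x \<le> strict_count S x + ties x"
proof -
  have eq: "card {m \<in> le (x / N P). Nplus m \<le> N P} = card {m \<in> le (x / N P). Nplus m < N P} + card (tied P x)" for P
  proof -
    have "{m \<in> le (x / N P). Nplus m \<le> N P} = {m \<in> le (x / N P). Nplus m < N P} \<union> tied P x" by (auto simp: tied_def)
    moreover have "card ({m \<in> le (x / N P). Nplus m < N P} \<union> tied P x) = card {m \<in> le (x / N P). Nplus m < N P} + card (tied P x)"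
      by (rule card_Un_disjoint) (auto simp: tied_def)
    ultimately show ?thesis by (simp only:)
  qed
  have "weak_count S x = strict_count S x + (\<Sum>P\<in>S \<inter> Pr x. real (card (tied P x)))"
    unfolding weak_count_def strict_count_def eq by (simp add: sum.distrib)
  moreover have "(\<Sum>P\<in>S \<inter> Pr x. real (card (tied P x))) \<le> ties x"
    unfolding ties_def by (intro sum_mono2) auto
  moreover have "(\<Sum>P\<in>S \<inter> Pr x. real (card (tied P x))) \<ge> 0" by (intro sum_nonneg) auto
  ultimately show "strict_count S x \<le> weak_count S x" "weak_count S x \<le> strict_count S x + ties x" by linarith+
qed

text \<open>In a strict pair \<open>P\<close> is the only prime of maximal norm in the product and
  occurs in it once, so the product determines the pair.\<close>

lemma strict_count_UNIV_le: "strict_count UNIV x \<le> count_G N x"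
proof -
  let ?S = "Sigma (Pr x) (\<lambda>P. {m \<in> le (x / N P). Nplus m < N P})"
  have "inj_on (\<lambda>(P, m). add_mset P m) ?S"
  proof (rule inj_onI, clarify)
    fix P m P' m' assume *: "m \<in> le (x / N P)" "Nplus m < N P" "m' \<in> le (x / N P')" "Nplus m' < N P'" "add_mset P m = add_mset P' m'"
    have "P = P'"
    proof (rule ccontr)
      assume ne: "P \<noteq> P'"
      have "P' \<in># add_mset P m" "P \<in># add_mset P' m'"
        using *(5) by (metis union_single_eq_member add_mset_add_single)+
      hence "P' \<in># m" "P \<in># m'" using ne by auto
      thus False using N_le_Nplus[of P' m] N_le_Nplus[of P m'] * by linarith
    qed
    thus "P = P' \<and> m = m'" using * by simp
  qed
  hence "card ?S = card ((\<lambda>(P, m). add_mset P m) ` ?S)" by (rule card_image[symmetric])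
  also have "\<dots> \<le> card (le x)" by (rule card_mono) (auto simp: field_simps)
  finally have "card ?S \<le> card (le x)" .
  moreover have "card ?S = (\<Sum>P\<in>Pr x. card {m \<in> le (x / N P). Nplus m < N P})" by (rule card_SigmaI) auto
  ultimately show ?thesis unfolding strict_count_def count_G_eq by (simp flip: of_nat_sum)
qed

text \<open>Every element except the identity has at least one prime of maximal norm; the 1 accounts
  for the identity.\<close>

lemma weak_count_UNIV_ge: "count_G N x - 1 \<le> weak_count UNIV x"
proof -
  let ?S = "Sigma (Pr x) (\<lambda>P. {m \<in> le (x / N P). Nplus m \<le> N P})"
  have "le x - {{#}} \<subseteq> (\<lambda>(P, m). add_mset P m) ` ?S"
  proof
    fix g assume g: "g \<in> le x - {{#}}"
    hence "Max (N ` set_mset g) \<in> N ` set_mset g" by (intro Max_in) auto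
    then obtain P where P: "P \<in># g" "Max (N ` set_mset g) = N P" by auto
    then obtain m where m: "g = add_mset P m" by (auto dest: multi_member_split)
    have "N p \<le> N P" if "p \<in># m" for p using that m unfolding P(2)[symmetric] by (intro Max_ge) auto
    hence "Nplus m \<le> N P" unfolding Nplus_le_iff using N_gt_1[of P] by auto
    moreover have "N P \<le> nm g" by (rule N_le_nm[OF P(1)])
    hence "N P \<le> x" using g by simp
    moreover have "nm m \<le> x / N P" using g m by (simp add: field_simps)
    ultimately show "g \<in> (\<lambda>(P, m). add_mset P m) ` ?S" using m by force
  qed
  hence "card (le x - {{#}}) \<le> card ?S" by (intro surj_card_le) auto
  also have "card ?S = (\<Sum>P\<in>Pr x. card {m \<in> le (x / N P). Nplus m \<le> N P})" by (rule card_SigmaI) auto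
  finally have "real (card (le x - {{#}})) \<le> weak_count UNIV x"
    unfolding weak_count_def by (simp flip: of_nat_sum)
  moreover have "card (le x) \<le> card (le x - {{#}}) + 1"
    by (cases "{#} \<in> le x") (auto simp: card_Diff_singleton_if)
  ultimately show ?thesis unfolding count_G_eq by linarith
qed

lemma strict_count_UNIV_tendsto: "((\<lambda>x. strict_count UNIV x / x) \<longlongrightarrow> c) at_top"
proof (rule tendsto_sandwich)
  show "eventually (\<lambda>x. count_G N x / x - 1 / x - ties x / x \<le> strict_count UNIV x / x) at_top"
    using eventually_gt_at_top[of 0]
  proof eventually_elim
    case (elim x)
    have "count_G N x - 1 - ties x \<le> strict_count UNIV x"
      using weak_count_UNIV_ge[of x] weak_count_bounds(2)[of UNIV x] by linarith
    thus ?case using elim by (simp add: divide_right_mono flip: diff_divide_distrib)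
  qed
  show "eventually (\<lambda>x. strict_count UNIV x / x \<le> count_G N x / x) at_top"
    using eventually_gt_at_top[of 0] by eventually_elim (simp add: divide_right_mono strict_count_UNIV_le)
  have "((\<lambda>x::real. 1 / x) \<longlongrightarrow> 0) at_top" by real_asymp
  from tendsto_diff[OF tendsto_diff[OF count_G_over_tendsto this] ties_tendsto_0]
  show "((\<lambda>x. count_G N x / x - 1 / x - ties x / x) \<longlongrightarrow> c) at_top" by simp
qed (rule count_G_over_tendsto)

section \<open>Transfer of the density to largest primes\<close>

lemma prime_count_eq: "prime_count N S x = real (card (S \<inter> Pr x))"
  unfolding prime_count_def Pr_def by (simp add: Int_def)

text \<open>Summing over the cofactor first: for given \<open>m\<close> the admissible
  \<open>P\<close> are the primes of \<open>S\<close> with norm above \<open>Nplus m\<close> and at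
  most \<open>x / nm m\<close>. This makes \<open>strict_count\<close> linear in the prime counting
  function.\<close>

lemma strict_count_eq_sum_V:
  "strict_count S x = (\<Sum>m\<in>V x. prime_count N S (x / nm m) - prime_count N S (Nplus m))"
proof -
  have "strict_count S x = (\<Sum>P\<in>S \<inter> Pr x. \<Sum>m | m \<in> V x \<and> nm m * N P \<le> x \<and> Nplus m < N P. 1)"
    unfolding strict_count_def
  proof (rule sum.cong[OF refl])
    fix P
    have "m \<in> V x" if "nm m * N P \<le> x" "Nplus m < N P" for m
    proof -
      have "nm m * Nplus m \<le> nm m * N P" using that by (intro mult_left_mono) auto
      thus ?thesis using that unfolding V_def mem_Collect_eq by linarith
    qed
    hence "{m \<in> le (x / N P). Nplus m < N P} = {m. m \<in> V x \<and> nm m * N P \<le> x \<and> Nplus m < N P}"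
      by (auto simp: field_simps)
    thus "real (card {m \<in> le (x / N P). Nplus m < N P}) = (\<Sum>m | m \<in> V x \<and> nm m * N P \<le> x \<and> Nplus m < N P. 1)"
      by simp
  qed
  also have "\<dots> = (\<Sum>m\<in>V x. \<Sum>P | P \<in> S \<inter> Pr x \<and> nm m * N P \<le> x \<and> Nplus m < N P. 1)"
    by (rule sum.swap_restrict) auto
  also have "\<dots> = (\<Sum>m\<in>V x. prime_count N S (x / nm m) - prime_count N S (Nplus m))"
  proof (rule sum.cong[OF refl])
    fix m assume m: "m \<in> V x"
    have "N p \<le> x" if "nm m * N p \<le> x" for p
    proof -
      have "1 * N p \<le> nm m * N p" by (intro mult_right_mono nm_ge_1) (auto simp: less_imp_le)
      thus ?thesis using that by linarith
    qed
    hence "{P. P \<in> S \<inter> Pr x \<and> nm m * N P \<le> x \<and> Nplus m < N P} = S \<inter> Pr (x / nm m) - S \<inter> Pr (Nplus m)"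
      by (auto simp: field_simps)
    moreover have "Nplus m \<le> x / nm m" using m by (simp add: V_def field_simps)
    hence sub: "S \<inter> Pr (Nplus m) \<subseteq> S \<inter> Pr (x / nm m)" by (auto intro: order_trans)
    ultimately show "(\<Sum>P | P \<in> S \<inter> Pr x \<and> nm m * N P \<le> x \<and> Nplus m < N P. 1) = prime_count N S (x / nm m) - prime_count N S (Nplus m)"
      by (simp add: prime_count_eq card_Diff_subset of_nat_diff card_mono)
  qed
  finally show ?thesis .
qed

text \<open>Small arguments, where the limit says nothing, are absorbed by an additive constant.
  This matters because \<open>x / nm m\<close> and \<open>Nplus m\<close> may be small even for
  large \<open>x\<close>.\<close>

lemma prime_count_density_bound:
  assumes S: "has_natural_density N S \<delta>" and e: "e > 0"
  shows "\<exists>K\<ge>0. \<forall>t. \<bar>prime_count N S t - \<delta> * prime_count N UNIV t\<bar> \<le> e * prime_count N UNIV t + K"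
proof -
  have "eventually (\<lambda>t. dist (prime_count N S t / prime_count N UNIV t) \<delta> < e) at_top"
    using S e unfolding has_natural_density_def by (rule tendstoD)
  then obtain T where T: "\<And>t. t \<ge> T \<Longrightarrow> \<bar>prime_count N S t / prime_count N UNIV t - \<delta>\<bar> < e"
    by (auto simp: eventually_at_top_linorder dist_real_def)
  define K where "K = (1 + \<bar>\<delta>\<bar>) * prime_count N UNIV T"
  have p0: "prime_count N S t \<ge> 0" for S t by (simp add: prime_count_def)
  have le: "prime_count N S t \<le> prime_count N UNIV t" for t
    unfolding prime_count_eq by (intro of_nat_mono card_mono) auto
  have "\<bar>prime_count N S t - \<delta> * prime_count N UNIV t\<bar> \<le> e * prime_count N UNIV t + K" for t
  proof (cases "t \<ge> T")
    case True
    show ?thesis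
    \<comment> \<open>With no primes up to \<open>t\<close> the quotient is 0 by convention and
      carries no information, but then both counts vanish.\<close>
    proof (cases "prime_count N UNIV t = 0")
      case True
      thus ?thesis using le[of t] p0[of S t] p0[of UNIV T] by (simp add: K_def)
    next
      case False
      hence pos: "prime_count N UNIV t > 0" using p0[of UNIV t] by simp
      have "\<bar>prime_count N S t - \<delta> * prime_count N UNIV t\<bar> = \<bar>prime_count N S t / prime_count N UNIV t - \<delta>\<bar> * prime_count N UNIV t"
        using pos by (simp add: field_simps flip: abs_mult_pos)
      also have "\<dots> \<le> e * prime_count N UNIV t" using T[OF True] pos by (intro mult_right_mono) auto
      also have "\<dots> \<le> e * prime_count N UNIV t + K" using p0[of UNIV T] by (simp add: K_def)
      finally show ?thesis .
    qed
  next
    case False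
    have mono: "prime_count N UNIV t \<le> prime_count N UNIV T"
      unfolding prime_count_eq using False by (intro of_nat_mono card_mono) auto
    have "\<bar>prime_count N S t - \<delta> * prime_count N UNIV t\<bar> \<le> prime_count N S t + \<bar>\<delta>\<bar> * prime_count N UNIV t"
      using p0[of S t] p0[of UNIV t] abs_triangle_ineq4[of "prime_count N S t" "\<delta> * prime_count N UNIV t"] by (simp add: abs_mult)
    also have "\<dots> \<le> (1 + \<bar>\<delta>\<bar>) * prime_count N UNIV t" using le[of t] by (simp add: algebra_simps)
    also have "\<dots> \<le> K" unfolding K_def using mono by (intro mult_left_mono) auto
    also have "\<dots> \<le> e * prime_count N UNIV t + K" using e p0[of UNIV t] by simp
    finally show ?thesis .
  qed
  moreover have "K \<ge> 0" using p0[of UNIV T] by (simp add: K_def)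
  ultimately show ?thesis by blast
qed

text \<open>Replacing one count by \<open>\<delta>\<close> times the other costs a part proportional
  to \<open>e1\<close>, summed over \<open>V x\<close> to \<open>O(e1 * x)\<close>, and a constant
  for each \<open>m\<close>, summed to o(x) because \<open>V x\<close> has density 0. The total for
  \<open>UNIV\<close> is already known.\<close>

lemma strict_count_tendsto:
  assumes S: "has_natural_density N S \<delta>"
  shows "((\<lambda>x. strict_count S x / x) \<longlongrightarrow> \<delta> * c) at_top"
proof -
  obtain K where K: "K \<ge> 0" "\<And>x. x \<ge> 2 \<Longrightarrow> (\<Sum>m\<in>V x. real (card (Pr (x / nm m)))) \<le> K * x"
    using sum_V_prime_count_le by blast
  have "((\<lambda>x. (strict_count S x - \<delta> * strict_count UNIV x) / x) \<longlongrightarrow> 0) at_top"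
  proof (rule tendstoI)
    fix e :: real assume e: "e > 0"
    define e1 where "e1 = e / (4 * (K + 1))"
    have e1: "e1 > 0" using e K by (simp add: e1_def)
    obtain K0 where K0: "K0 \<ge> 0" "\<And>t. \<bar>prime_count N S t - \<delta> * prime_count N UNIV t\<bar> \<le> e1 * prime_count N UNIV t + K0"
      using prime_count_density_bound[OF S e1] by blast
    have "((\<lambda>x. 2 * K0 * (real (card (V x)) / x)) \<longlongrightarrow> 2 * K0 * 0) at_top" by (intro tendsto_intros card_V_tendsto_0)
    hence "eventually (\<lambda>x. 2 * K0 * (real (card (V x)) / x) < e / 2) at_top" using e by (intro order_tendstoD(2)) auto
    thus "eventually (\<lambda>x. dist ((strict_count S x - \<delta> * strict_count UNIV x) / x) 0 < e) at_top"
      using eventually_ge_at_top[of 2]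
    proof eventually_elim
      case (elim x)
      define E where "E = (\<lambda>t. prime_count N S t - \<delta> * prime_count N UNIV t)"
      have "strict_count S x - \<delta> * strict_count UNIV x = (\<Sum>m\<in>V x. E (x / nm m) - E (Nplus m))"
        unfolding strict_count_eq_sum_V E_def sum_distrib_left sum_subtractf[symmetric]
        by (intro sum.cong refl) (simp add: algebra_simps)
      also have "\<bar>\<dots>\<bar> \<le> (\<Sum>m\<in>V x. 2 * e1 * real (card (Pr (x / nm m))) + 2 * K0)"
      proof (rule order_trans[OF sum_abs sum_mono])
        fix m assume m: "m \<in> V x"
        have "Nplus m \<le> x / nm m" using m by (simp add: V_def field_simps)
        hence "prime_count N UNIV (Nplus m) \<le> prime_count N UNIV (x / nm m)"
          unfolding prime_count_eq by (intro of_nat_mono card_mono) (auto intro: order_trans)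
        hence "e1 * prime_count N UNIV (Nplus m) \<le> e1 * prime_count N UNIV (x / nm m)" using e1 by simp
        hence "\<bar>E (x / nm m) - E (Nplus m)\<bar> \<le> 2 * (e1 * prime_count N UNIV (x / nm m)) + 2 * K0"
          using K0(2)[of "x / nm m"] K0(2)[of "Nplus m"] unfolding E_def by linarith
        thus "\<bar>E (x / nm m) - E (Nplus m)\<bar> \<le> 2 * e1 * real (card (Pr (x / nm m))) + 2 * K0"
          by (simp add: prime_count_eq)
      qed
      also have "\<dots> = 2 * e1 * (\<Sum>m\<in>V x. real (card (Pr (x / nm m)))) + 2 * K0 * real (card (V x))"
        by (simp add: sum.distrib sum_distrib_left)
      also have "\<dots> \<le> 2 * e1 * (K * x) + 2 * K0 * real (card (V x))"
        using K(2)[OF elim(2)] e1 by (intro add_right_mono mult_left_mono) auto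
      finally have "\<bar>strict_count S x - \<delta> * strict_count UNIV x\<bar> / x \<le> (2 * e1 * (K * x) + 2 * K0 * real (card (V x))) / x"
        using elim by (intro divide_right_mono) auto
      also have "\<dots> = 2 * e1 * K + 2 * K0 * (real (card (V x)) / x)" using elim by (simp add: add_divide_distrib)
      also have "2 * e1 * K \<le> e / 2"
      proof -
        have "2 * e1 * K \<le> 2 * e1 * (K + 1)" using e1 by simp
        also have "\<dots> = e / 2"
        proof -
          have "2 * (e / (4 * a)) * a = e / 2" if "a \<noteq> 0" for a using that by simp
          from this[of "K + 1"] show ?thesis using K unfolding e1_def by simp
        qed
        finally show ?thesis .
      qed
      finally have "\<bar>strict_count S x - \<delta> * strict_count UNIV x\<bar> / x < e" using elim by linarith
      thus ?case using elim by (simp add: abs_divide)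
    qed
  qed
  from tendsto_add[OF this tendsto_mult_left[OF strict_count_UNIV_tendsto, of \<delta>]]
  show ?thesis by (simp add: diff_divide_distrib)
qed

lemma weak_count_tendsto:
  assumes S: "has_natural_density N S \<delta>"
  shows "((\<lambda>x. weak_count S x / x) \<longlongrightarrow> \<delta> * c) at_top"
proof (rule tendsto_sandwich[OF _ _ strict_count_tendsto[OF S]])
  show "eventually (\<lambda>x. strict_count S x / x \<le> weak_count S x / x) at_top"
    using eventually_gt_at_top[of 0] by eventually_elim (simp add: divide_right_mono weak_count_bounds)
  show "eventually (\<lambda>x. weak_count S x / x \<le> strict_count S x / x + ties x / x) at_top"
    using eventually_gt_at_top[of 0]
    by eventually_elim (simp add: divide_right_mono weak_count_bounds flip: add_divide_distrib)
  show "((\<lambda>x. strict_count S x / x + ties x / x) \<longlongrightarrow> \<delta> * c) at_top"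
    using tendsto_add[OF strict_count_tendsto[OF S] ties_tendsto_0] by simp
qed

text \<open>Alladi's duality between smallest and largest primes, summed over \<open>le x\<close>.\<close>

lemma sum_moebius_DS_count:
  "(\<Sum>g\<in>le x. restr (DS N S - {{#}}) moebius g * of_real (count_G N (x / nm g))) = - of_real (weak_count S x)"
proof -
  have "(\<Sum>g\<in>le x. restr (DS N S - {{#}}) moebius g * of_real (count_G N (x / nm g)))
      = (\<Sum>g\<in>le x \<inter> (\<Union>Q\<in>S. lead Q). moebius g * of_real (count_G N (x / nm g)))"
  proof (rule sum.mono_neutral_cong_right)
    show "\<forall>g\<in>le x - le x \<inter> (\<Union>Q\<in>S. lead Q). restr (DS N S - {{#}}) moebius g * of_real (count_G N (x / nm g)) = 0"
      using mem_DS_iff_lead[of _ S] by (auto simp: restr_def)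
    fix g assume "g \<in> le x \<inter> (\<Union>Q\<in>S. lead Q)"
    thus "restr (DS N S - {{#}}) moebius g * of_real (count_G N (x / nm g)) = moebius g * of_real (count_G N (x / nm g))"
      using mem_DS_iff_lead[of g S] by (cases "moebius g = 0") (auto simp: restr_def)
  qed auto
  also have "\<dots> = (\<Sum>Q | Q \<in> S \<and> N Q \<le> x. \<Sum>h\<in>le (x / N Q) \<inter> rough (N Q). moebius (add_mset Q h) * of_real (count_G N (x / nm (add_mset Q h))))"
    by (rule sum_lead)
  also have "\<dots> = (\<Sum>Q | Q \<in> S \<and> N Q \<le> x. - of_real (real (card {m \<in> le (x / N Q). Nplus m \<le> N Q})))"
  proof (rule sum.cong[OF refl])
    fix Q
    have "(\<Sum>h\<in>le (x / N Q) \<inter> rough (N Q). moebius (add_mset Q h) * of_real (count_G N (x / nm (add_mset Q h))))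
       = - (\<Sum>h\<in>le (x / N Q) \<inter> rough (N Q). moebius h * of_real (count_G N (x / N Q / nm h)))"
      unfolding sum_negf[symmetric] by (intro sum.cong refl) (simp add: moebius_lead)
    also have "(\<Sum>h\<in>le (x / N Q) \<inter> rough (N Q). moebius h * of_real (count_G N (x / N Q / nm h)))
       = (\<Sum>h\<in>le (x / N Q). restr (rough (N Q)) moebius h * of_real (count_G N (x / N Q / nm h)))"
      unfolding sum.inter_restrict[OF finite_le'] by (intro sum.cong refl) (simp add: restr_def)
    also have "\<dots> = of_real (real (card (le (x / N Q) \<inter> smooth {p. N p \<le> N Q})))" by (rule sum_moebius_rough_count)
    also have "le (x / N Q) \<inter> smooth {p. N p \<le> N Q} = {m \<in> le (x / N Q). Nplus m \<le> N Q}"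
      by (auto simp: Nplus_le_N_iff)
    finally show "(\<Sum>h\<in>le (x / N Q) \<inter> rough (N Q). moebius (add_mset Q h) * of_real (count_G N (x / nm (add_mset Q h))))
      = - of_real (real (card {m \<in> le (x / N Q). Nplus m \<le> N Q}))" .
  qed
  also have "\<dots> = - of_real (weak_count S x)"
  proof -
    have "{Q. Q \<in> S \<and> N Q \<le> x} = S \<inter> Pr x" by auto
    thus ?thesis by (simp add: weak_count_def sum_negf)
  qed
  finally show ?thesis .
qed

lemma sum_moebius_DS_tendsto:
  assumes S: "has_natural_density N S \<delta>"
  shows "((\<lambda>x. \<Sum>g\<in>le x \<inter> (DS N S - {{#}}). moebius g / of_real (nm g)) \<longlongrightarrow> - of_real \<delta>) at_top"
proof -
  let ?f = "restr (DS N S - {{#}}) moebius"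
  have "norm (?f g) \<le> 1" for g by (rule norm_restr_le) (rule norm_moebius_le_1)
  from axer[OF this summ_moebius_DS_tendsto_0]
  have 1: "((\<lambda>x. - of_real (weak_count S x) / of_real x - of_real c * (\<Sum>g\<in>le x. ?f g / of_real (nm g))) \<longlongrightarrow> 0) at_top"
    unfolding sum_moebius_DS_count .
  have 2: "((\<lambda>x. complex_of_real (weak_count S x / x)) \<longlongrightarrow> of_real (\<delta> * c)) at_top"
    by (rule tendsto_of_real[OF weak_count_tendsto[OF S]])
  have "((\<lambda>x. - ((- of_real (weak_count S x) / of_real x - of_real c * (\<Sum>g\<in>le x. ?f g / of_real (nm g)))
      + complex_of_real (weak_count S x / x)) / of_real c) \<longlongrightarrow> - (0 + of_real (\<delta> * c)) / of_real c) at_top"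
    using c_pos by (intro tendsto_intros 1 2) auto
  moreover have "- ((- of_real (weak_count S x) / of_real x - of_real c * (\<Sum>g\<in>le x. ?f g / of_real (nm g)))
      + complex_of_real (weak_count S x / x)) / of_real c = (\<Sum>g\<in>le x. ?f g / of_real (nm g))" for x
    using c_pos by simp
  moreover have "(\<Sum>g\<in>le x. ?f g / of_real (nm g)) = (\<Sum>g\<in>le x \<inter> (DS N S - {{#}}). moebius g / of_real (nm g))" for x
    unfolding sum.inter_restrict[OF finite_le'] by (intro sum.cong refl) (simp add: restr_def)
  ultimately show ?thesis using c_pos by simp
qed

subsection \<open>Convolution with a function supported on distinguishable elements\<close>

text \<open>The coefficient of \<open>a h / nm h\<close> after writing \<open>g = h + k\<close> in
  the sum of \<open>dconv moebius a\<close>. The condition is on \<open>h + k\<close>, as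
  \<open>k\<close> itself need not be distinguishable.\<close>

definition cofactor_sum :: "'p set \<Rightarrow> 'p multiset \<Rightarrow> real \<Rightarrow> complex" where
  "cofactor_sum S h z = (\<Sum>k\<in>le z. if h + k \<in> DS N S - {{#}} then moebius k / of_real (nm k) else 0)"

text \<open>The smallest prime of \<open>h + k\<close> either remains \<open>P\<close>, with
  \<open>k\<close> rough beyond \<open>P\<close> or having \<open>P\<close> as its own smallest
  prime, or it is a smaller prime of \<open>k\<close>.\<close>

lemma mem_DS_plus_iff:
  assumes P: "P \<in> S" "P \<in># h" "\<And>p. p \<in># h \<Longrightarrow> p \<noteq> P \<Longrightarrow> N P < N p" and k: "moebius k \<noteq> 0"
  shows "h + k \<in> DS N S - {{#}} \<longleftrightarrow> k \<in> rough (N P) \<union> (\<Union>Q\<in>insert P {Q \<in> S. N Q < N P}. lead Q)"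
proof
  assume "h + k \<in> DS N S - {{#}}"
  then obtain Q where Q: "Q \<in> S" "Q \<in># h + k" "\<And>p. p \<in># h + k \<Longrightarrow> p \<noteq> Q \<Longrightarrow> N Q < N p"
    unfolding mem_DS_iff by blast
  show "k \<in> rough (N P) \<union> (\<Union>Q\<in>insert P {Q \<in> S. N Q < N P}. lead Q)"
  proof (cases "Q = P")
    case True
    show ?thesis
    proof (cases "P \<in># k")
      case True
      hence "k \<in> lead P" unfolding mem_lead_iff[OF k] using Q \<open>Q = P\<close> by auto
      thus ?thesis by blast
    next
      case False
      have "N P < N p" if "p \<in># k" for p using Q(3)[of p] that False \<open>Q = P\<close> by auto
      thus ?thesis by (auto simp: rough_def)
    qed
  next
    case False
    hence less: "N Q < N P" using Q(3)[of P] P by auto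
    have "Q \<notin># h" using P(3)[of Q] less False by auto
    hence "k \<in> lead Q" unfolding mem_lead_iff[OF k] using Q by auto
    thus ?thesis using Q(1) less by blast
  qed
next
  assume "k \<in> rough (N P) \<union> (\<Union>Q\<in>insert P {Q \<in> S. N Q < N P}. lead Q)"
  then consider "k \<in> rough (N P)" | "k \<in> lead P" | Q where "Q \<in> S" "N Q < N P" "k \<in> lead Q" by blast
  thus "h + k \<in> DS N S - {{#}}"
  proof cases
    case 1
    thus ?thesis unfolding mem_DS_iff using P by (intro bexI[of _ P]) (auto simp: rough_def)
  next
    case 2
    thus ?thesis unfolding mem_DS_iff mem_lead_iff[OF k] using P by (intro bexI[of _ P]) auto
  next
    case 3
    have "N Q < N p" if "p \<in># h" for p using P(3)[of p] that 3(2) by (cases "p = P") auto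
    thus ?thesis unfolding mem_DS_iff using 3 mem_lead_iff[OF k, of Q] by (intro bexI[of _ Q]) auto
  qed
qed

lemma cofactor_sum_eq:
  assumes P: "P \<in> S" "P \<in># h" "\<And>p. p \<in># h \<Longrightarrow> p \<noteq> P \<Longrightarrow> N P < N p"
  shows "cofactor_sum S h z = mr (N P) z - (\<Sum>Q\<in>insert P {Q \<in> S. N Q < N P}. mr (N Q) (z / N Q) / of_real (N Q))"
proof -
  let ?I = "insert P {Q \<in> S. N Q < N P}"
  have fin: "finite ?I" by (rule finite_subset[OF _ finite_Pr[of "N P"]]) auto
  let ?L = "\<Union>Q\<in>?I. lead Q"
  have dis: "rough (N P) \<inter> ?L = {}" by (fastforce simp: rough_def lead_def)
  have "cofactor_sum S h z = (\<Sum>k\<in>(le z \<inter> rough (N P)) \<union> (le z \<inter> ?L). moebius k / of_real (nm k))"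
    unfolding cofactor_sum_def
  proof (rule sum.mono_neutral_cong_right)
    show "\<forall>k\<in>le z - ((le z \<inter> rough (N P)) \<union> (le z \<inter> ?L)). (if h + k \<in> DS N S - {{#}} then moebius k / of_real (nm k) else 0) = 0"
    proof
      fix k assume "k \<in> le z - ((le z \<inter> rough (N P)) \<union> (le z \<inter> ?L))"
      hence "k \<notin> rough (N P) \<union> ?L" by blast
      thus "(if h + k \<in> DS N S - {{#}} then moebius k / of_real (nm k) else 0) = 0"
        using mem_DS_plus_iff[OF P, of k] by (cases "moebius k = 0") auto
    qed
    fix k assume "k \<in> (le z \<inter> rough (N P)) \<union> (le z \<inter> ?L)"
    hence "k \<in> rough (N P) \<union> ?L" by blast
    thus "(if h + k \<in> DS N S - {{#}} then moebius k / of_real (nm k) else 0) = moebius k / of_real (nm k)"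
      using mem_DS_plus_iff[OF P, of k] by (cases "moebius k = 0") auto
  qed auto
  also have "\<dots> = mr (N P) z + (\<Sum>k\<in>le z \<inter> ?L. moebius k / of_real (nm k))"
    unfolding mr_def by (rule sum.union_disjoint) (use dis in auto)
  also have "(\<Sum>k\<in>le z \<inter> ?L. moebius k / of_real (nm k))
     = (\<Sum>Q | Q \<in> ?I \<and> N Q \<le> z. \<Sum>k\<in>le (z / N Q) \<inter> rough (N Q). moebius (add_mset Q k) / of_real (nm (add_mset Q k)))"
    by (rule sum_lead)
  also have "\<dots> = (\<Sum>Q | Q \<in> ?I \<and> N Q \<le> z. - (mr (N Q) (z / N Q) / of_real (N Q)))"
    unfolding mr_def sum_divide_distrib sum_negf[symmetric]
    by (intro sum.cong refl) (simp add: moebius_lead mult.commute)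
  also have "\<dots> = (\<Sum>Q\<in>?I. - (mr (N Q) (z / N Q) / of_real (N Q)))"
  proof (rule sum.mono_neutral_left[OF fin])
    show "\<forall>Q\<in>?I - {Q. Q \<in> ?I \<and> N Q \<le> z}. - (mr (N Q) (z / N Q) / of_real (N Q)) = 0"
    proof
      fix Q assume "Q \<in> ?I - {Q. Q \<in> ?I \<and> N Q \<le> z}"
      hence "z / N Q < 1" by auto
      thus "- (mr (N Q) (z / N Q) / of_real (N Q)) = 0" by (simp add: mr_def le_less_1)
    qed
  qed auto
  finally show ?thesis by (simp add: sum_negf)
qed

lemma cofactor_sum_tendsto_0:
  assumes "h \<in> DS N S - {{#}}"
  shows "(cofactor_sum S h \<longlongrightarrow> 0) at_top"
proof -
  obtain P where P: "P \<in> S" "P \<in># h" "\<And>p. p \<in># h \<Longrightarrow> p \<noteq> P \<Longrightarrow> N P < N p"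
    using assms unfolding mem_DS_iff by blast
  have "((\<lambda>z. mr (N P) z - (\<Sum>Q\<in>insert P {Q \<in> S. N Q < N P}. mr (N Q) (z / N Q) / of_real (N Q)))
     \<longlongrightarrow> 0 - (\<Sum>Q\<in>insert P {Q \<in> S. N Q < N P}. 0 / of_real (N Q))) at_top"
    by (intro tendsto_intros mr_tendsto_0 filterlim_compose[OF mr_tendsto_0] filterlim_divide_const_at_top) auto
  moreover have "cofactor_sum S h = (\<lambda>z. mr (N P) z - (\<Sum>Q\<in>insert P {Q \<in> S. N Q < N P}. mr (N Q) (z / N Q) / of_real (N Q)))"
    by (rule ext) (rule cofactor_sum_eq[OF P])
  ultimately show ?thesis by simp
qed

lemma norm_cofactor_sum_le:
  "\<exists>K\<ge>0. \<forall>S z. \<forall>h\<in>DS N S - {{#}}. norm (cofactor_sum S h z) \<le> K * max 1 (ln (ln (nm h)))"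
proof -
  obtain K1 where K1: "K1 \<ge> 1" "\<And>x. (\<Sum>p | N p \<le> x. 1 / N p) \<le> K1 * max 1 (ln (ln x))"
    using sum_inverse_primes_le by blast
  define M where "M = (B + C * powsum_const) / c"
  have M: "M \<ge> 0" using order_trans[OF norm_ge_zero norm_mr_le[of 1 1]] by (simp add: M_def)
  have mrM: "norm (mr y x) \<le> M" for y x unfolding M_def by (rule norm_mr_le)
  have "norm (cofactor_sum S h z) \<le> (M * (1 + K1)) * max 1 (ln (ln (nm h)))" if h: "h \<in> DS N S - {{#}}" for S h z
  proof -
    obtain P where P: "P \<in> S" "P \<in># h" "\<And>p. p \<in># h \<Longrightarrow> p \<noteq> P \<Longrightarrow> N P < N p"
      using h unfolding mem_DS_iff by blast
    let ?I = "insert P {Q \<in> S. N Q < N P}"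
    have "norm (\<Sum>Q\<in>?I. mr (N Q) (z / N Q) / of_real (N Q)) \<le> (\<Sum>Q\<in>?I. M * (1 / N Q))"
    proof (rule sum_norm_le)
      fix Q
      have "norm (mr (N Q) (z / N Q)) / N Q \<le> M / N Q" by (intro divide_right_mono mrM) (simp add: less_imp_le)
      thus "norm (mr (N Q) (z / N Q) / of_real (N Q)) \<le> M * (1 / N Q)" by (simp add: norm_divide less_imp_le)
    qed
    also have "\<dots> \<le> (\<Sum>Q | N Q \<le> nm h. M * (1 / N Q))"
      using M N_le_nm[OF P(2)] by (intro sum_mono2) (auto simp: less_imp_le)
    also have "\<dots> = M * (\<Sum>Q | N Q \<le> nm h. 1 / N Q)" by (simp only: sum_distrib_left)
    also have "\<dots> \<le> M * (K1 * max 1 (ln (ln (nm h))))" by (intro mult_left_mono K1 M)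
    finally have 1: "norm (\<Sum>Q\<in>?I. mr (N Q) (z / N Q) / of_real (N Q)) \<le> M * (K1 * max 1 (ln (ln (nm h))))" .
    have eq: "cofactor_sum S h z = mr (N P) z - (\<Sum>Q\<in>?I. mr (N Q) (z / N Q) / of_real (N Q))"
      by (rule cofactor_sum_eq[OF P])
    have "norm (cofactor_sum S h z) \<le> M + M * (K1 * max 1 (ln (ln (nm h))))"
      unfolding eq by (rule order_trans[OF norm_triangle_ineq4]) (intro add_mono mrM 1)
    moreover have "M \<le> M * max 1 (ln (ln (nm h)))" using mult_left_mono[of 1 "max 1 (ln (ln (nm h)))" M] M by simp
    moreover have "(M * (1 + K1)) * max 1 (ln (ln (nm h))) = M * max 1 (ln (ln (nm h))) + M * (K1 * max 1 (ln (ln (nm h))))"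
      by (simp only: distrib_left distrib_right mult_1_right mult.assoc)
    ultimately show ?thesis by linarith
  qed
  moreover have "M * (1 + K1) \<ge> 0" using M K1 by simp
  ultimately show ?thesis by blast
qed

lemma sum_dconv_eq:
  "(\<Sum>g\<in>le x \<inter> (DS N S - {{#}}). dconv moebius a g / of_real (nm g))
    = (\<Sum>h\<in>le x. a h / of_real (nm h) * cofactor_sum S h (x / nm h))"
proof -
  define F where "F = (\<lambda>h k. if h + k \<in> DS N S - {{#}} then a h / of_real (nm h) * (moebius k / of_real (nm k)) else 0)"
  have "(\<Sum>g\<in>le x \<inter> (DS N S - {{#}}). dconv moebius a g / of_real (nm g)) = (\<Sum>g\<in>le x. \<Sum>h | h \<subseteq># g. F h (g - h))"
    unfolding sum.inter_restrict[OF finite_le']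
  proof (rule sum.cong[OF refl])
    fix g
    \<comment> \<open>Divisor and cofactor are exchanged: \<open>dconv\<close> is indexed by the
      argument of \<open>moebius\<close>, the sum to be formed by that of \<open>a\<close>.\<close>
    have "(\<Sum>h | h \<subseteq># g. F h (g - h)) = (\<Sum>k | k \<subseteq># g. F (g - k) k)"
      by (rule sum.reindex_bij_witness[of _ "\<lambda>k. g - k" "\<lambda>h. g - h"]) (auto simp: subset_mset.diff_diff_right)
    also have "\<dots> = (\<Sum>k | k \<subseteq># g. if g \<in> DS N S - {{#}} then moebius k * a (g - k) / of_real (nm g) else 0)"
    proof (rule sum.cong[OF refl])
      fix k assume "k \<in> {k. k \<subseteq># g}"
      hence "g = (g - k) + k" by simp
      hence "nm g = nm (g - k) * nm k" by (metis gnorm_plus)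
      thus "F (g - k) k = (if g \<in> DS N S - {{#}} then moebius k * a (g - k) / of_real (nm g) else 0)"
        using \<open>g = (g - k) + k\<close> unfolding F_def by (simp add: mult.commute)
    qed
    finally show "(if g \<in> DS N S - {{#}} then dconv moebius a g / of_real (nm g) else 0) = (\<Sum>h | h \<subseteq># g. F h (g - h))"
      by (cases "g \<in> DS N S - {{#}}") (auto simp: dconv_def sum_divide_distrib)
  qed
  also have "\<dots> = (\<Sum>h\<in>le x. \<Sum>k\<in>le (x / nm h). F h k)" by (rule sum_divisors_swap)
  also have "\<dots> = (\<Sum>h\<in>le x. a h / of_real (nm h) * cofactor_sum S h (x / nm h))"
    unfolding cofactor_sum_def sum_distrib_left F_def by (intro sum.cong refl) auto
  finally show ?thesis .
qed

text \<open>The hypothesis concerns the weight \<open>ln (ln (nm g))\<close>, which is negative for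
  norms below \<open>exp 1\<close>. Beyond \<open>exp (exp 1)\<close> it exceeds 1, so the terms are
  nonnegative and \<open>max 1\<close> is inert; finitely many elements remain.\<close>

lemma summable_max_ln_ln:
  fixes a :: "'p multiset \<Rightarrow> complex"
  assumes supp: "\<And>g. g \<notin> DS N S \<Longrightarrow> a g = 0"
    and lim: "((\<lambda>x. \<Sum>g \<in> {g \<in> DS N S. 2 \<le> nm g \<and> nm g \<le> x}. norm (a g) / nm g * ln (ln (nm g))) \<longlongrightarrow> L) at_top"
  shows "(\<lambda>g. norm (a g) / nm g * max 1 (ln (ln (nm g)))) summable_on UNIV"
proof (rule nonneg_bdd_above_summable_on)
  define w where "w = (\<lambda>g. norm (a g) / nm g)"
  have w0: "w g \<ge> 0" for g by (simp add: w_def)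
  define D where "D = (\<lambda>x. {g \<in> DS N S. 2 \<le> nm g \<and> nm g \<le> x})"
  have finD: "finite (D x)" for x by (rule finite_subset[OF _ finite_le'[of x]]) (auto simp: D_def)
  define T where "T = (\<lambda>x. \<Sum>g\<in>D x. w g * ln (ln (nm g)))"
  define y where "y = exp (exp (1::real))"
  have y2: "y \<ge> 2" using exp_ge_add_one_self[of "exp 1"] exp_ge_add_one_self[of "1::real"] unfolding y_def by linarith
  have "(T \<longlongrightarrow> L) at_top" using lim unfolding T_def w_def D_def .
  hence "eventually (\<lambda>x. T x < L + 1) at_top" by (rule order_tendstoD) simp
  then obtain X where X: "\<And>x. x \<ge> X \<Longrightarrow> T x < L + 1" by (auto simp: eventually_at_top_linorder)
  define K where "K = (\<Sum>g\<in>le y. w g * max 1 (ln (ln (nm g)))) + (L + 1 - T y)"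
  have "sum (\<lambda>g. w g * max 1 (ln (ln (nm g)))) F \<le> K" if F: "finite F" for F
  proof -
    obtain n where n: "F \<subseteq> le n" using finite_subset_le[OF F] by blast
    define x where "x = max n (max X y)"
    have x: "x \<ge> n" "x \<ge> X" "x \<ge> y" by (auto simp: x_def)
    have "sum (\<lambda>g. w g * max 1 (ln (ln (nm g)))) F \<le> (\<Sum>g\<in>le x. w g * max 1 (ln (ln (nm g))))"
      using n x w0 by (intro sum_mono2) (auto intro!: mult_nonneg_nonneg)
    also have "\<dots> = (\<Sum>g\<in>le x - le y. w g * max 1 (ln (ln (nm g)))) + (\<Sum>g\<in>le y. w g * max 1 (ln (ln (nm g))))"
      by (rule sum.subset_diff) (use x in auto)
    also have "(\<Sum>g\<in>le x - le y. w g * max 1 (ln (ln (nm g)))) = (\<Sum>g\<in>D x - D y. w g * ln (ln (nm g)))"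
    proof (rule sum.mono_neutral_cong_right)
      show "D x - D y \<subseteq> le x - le y" by (auto simp: D_def)
      show "\<forall>g\<in>le x - le y - (D x - D y). w g * max 1 (ln (ln (nm g))) = 0"
        using y2 supp by (force simp: D_def w_def)
      fix g assume "g \<in> D x - D y"
      hence "nm g > y" by (auto simp: D_def)
      hence "ln (nm g) > exp 1" unfolding y_def by (metis exp_less_cancel_iff exp_ln nm_pos)
      moreover have "exp 1 > (0::real)" by simp
      ultimately have "ln (ln (nm g)) > 1" by (metis exp_less_cancel_iff exp_ln less_trans)
      thus "w g * max 1 (ln (ln (nm g))) = w g * ln (ln (nm g))" by (simp add: max_def)
    qed auto
    also have "(\<Sum>g\<in>D x - D y. w g * ln (ln (nm g))) = T x - T y"
      unfolding T_def by (rule sum_diff) (use x finD in \<open>auto simp: D_def\<close>)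
    also have "T x \<le> L + 1" using X[OF x(2)] by simp
    finally show ?thesis by (simp add: K_def)
  qed
  thus "bdd_above (sum (\<lambda>g. norm (a g) / nm g * max 1 (ln (ln (nm g)))) ` {F. F \<subseteq> UNIV \<and> finite F})"
    unfolding w_def by (intro bdd_aboveI2[of _ _ K]) auto
qed auto

theorem sum_dconv_DS_tendsto:
  fixes a :: "'p multiset \<Rightarrow> complex"
  assumes S: "has_natural_density N S \<delta>"
    and supp: "\<And>g. g \<notin> DS N S \<Longrightarrow> a g = 0" and a1: "a {#} = 1"
    and lim: "((\<lambda>x. \<Sum>g \<in> {g \<in> DS N S. 2 \<le> nm g \<and> nm g \<le> x}. norm (a g) / nm g * ln (ln (nm g))) \<longlongrightarrow> L) at_top"
  shows "((\<lambda>x. \<Sum>g\<in>le x \<inter> (DS N S - {{#}}). dconv moebius a g / of_real (nm g)) \<longlongrightarrow> - of_real \<delta>) at_top"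
proof -
  obtain K where K: "K \<ge> 0" "\<And>S z h. h \<in> DS N S - {{#}} \<Longrightarrow> norm (cofactor_sum S h z) \<le> K * max 1 (ln (ln (nm h)))"
    using norm_cofactor_sum_le by blast
  let ?w = "\<lambda>h. norm (a h) / nm h * max 1 (ln (ln (nm h)))"
  let ?t = "\<lambda>x h. a h / of_real (nm h) * cofactor_sum S h (x / nm h)"
  \<comment> \<open>The identity is split off because its cofactor sum is the pure Moebius sum,
    which tends to \<open>- \<delta>\<close> and supplies the whole limit.\<close>
  have "((\<lambda>x. \<Sum>h\<in>le x - {{#}}. ?t x h) \<longlongrightarrow> infsum (\<lambda>_. 0) (UNIV :: 'p multiset set)) at_top"
  proof (rule tendsto_sum_dominated[where g = "\<lambda>h. K * ?w h"])
    show "(\<lambda>h. K * ?w h) summable_on UNIV"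
      by (intro summable_on_cmult_right summable_max_ln_ln[OF supp lim])
    show "norm (0::complex) \<le> K * ?w h" for h using K by (simp add: mult_nonneg_nonneg)
    show "norm (?t x h) \<le> K * ?w h" if "h \<in> le x - {{#}}" for x h
    proof (cases "h \<in> DS N S")
      case True
      hence "norm (a h) / nm h * norm (cofactor_sum S h (x / nm h)) \<le> norm (a h) / nm h * (K * max 1 (ln (ln (nm h))))"
        using that by (intro mult_left_mono K) auto
      thus ?thesis by (simp add: norm_mult norm_divide mult_ac)
    qed (simp add: supp)
    fix h
    show "((\<lambda>x. if h \<in> le x - {{#}} then ?t x h else 0) \<longlongrightarrow> 0) at_top"
    proof (cases "h \<in> DS N S - {{#}}")
      case True
      have "((\<lambda>x. ?t x h) \<longlongrightarrow> a h / of_real (nm h) * 0) at_top"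
        by (intro tendsto_intros filterlim_compose[OF cofactor_sum_tendsto_0[OF True]] filterlim_divide_const_at_top) auto
      moreover have "eventually (\<lambda>x. ?t x h = (if h \<in> le x - {{#}} then ?t x h else 0)) at_top"
        using eventually_ge_at_top[of "nm h"] by eventually_elim (use True in auto)
      ultimately show ?thesis using Lim_transform_eventually by fastforce
    next
      case False
      hence "(\<lambda>x. if h \<in> le x - {{#}} then ?t x h else 0) = (\<lambda>x. 0)" using supp[of h] by auto
      thus ?thesis by simp
    qed
  qed auto
  hence 1: "((\<lambda>x. \<Sum>h\<in>le x - {{#}}. ?t x h) \<longlongrightarrow> 0) at_top" by simp
  from tendsto_add[OF sum_moebius_DS_tendsto[OF S] this]
  have "((\<lambda>x. (\<Sum>g\<in>le x \<inter> (DS N S - {{#}}). moebius g / of_real (nm g)) + (\<Sum>h\<in>le x - {{#}}. ?t x h)) \<longlongrightarrow> - of_real \<delta>) at_top"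
    by simp
  moreover have "eventually (\<lambda>x. (\<Sum>g\<in>le x \<inter> (DS N S - {{#}}). moebius g / of_real (nm g)) + (\<Sum>h\<in>le x - {{#}}. ?t x h)
     = (\<Sum>g\<in>le x \<inter> (DS N S - {{#}}). dconv moebius a g / of_real (nm g))) at_top"
    using eventually_ge_at_top[of 1]
  proof eventually_elim
    case (elim x)
    have "(\<Sum>h\<in>le x. ?t x h) = ?t x {#} + (\<Sum>h\<in>le x - {{#}}. ?t x h)"
      by (rule sum.remove) (use elim in auto)
    moreover have "?t x {#} = (\<Sum>g\<in>le x \<inter> (DS N S - {{#}}). moebius g / of_real (nm g))"
      unfolding cofactor_sum_def sum.inter_restrict[OF finite_le'] by (simp add: a1)
    ultimately show ?case by (simp only: sum_dconv_eq)
  qed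
  ultimately show ?thesis by (rule Lim_transform_eventually)
qed

end

text \<open>For \<open>1 \<le> x < X\<close> the difference of count and main term is at most
  \<open>K\<close>, and \<open>x powr \<eta> \<ge> 1\<close> lets \<open>K\<close> be added to the
  Landau constant.\<close>

lemma axiom_A_semigroupI:
  assumes N: "arith_semigroup N" and A: "axiom_A N"
  obtains c \<eta> C where "axiom_A_semigroup N c \<eta> C"
proof -
  obtain c \<eta> where c: "c > 0" "0 < \<eta>" "\<eta> < 1" and O: "(\<lambda>x. count_G N x - c * x) \<in> O(\<lambda>x. x powr \<eta>)"
    using A unfolding axiom_A_def by blast
  have fin: "finite {g. gnorm N g \<le> x}" for x using N by (simp add: arith_semigroup_def)
  obtain C0 where C0: "C0 > 0" "eventually (\<lambda>x. norm (count_G N x - c * x) \<le> C0 * norm (x powr \<eta>)) at_top"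
    using O by (elim landau_o.bigE) auto
  then obtain X where X: "\<And>x. x \<ge> X \<Longrightarrow> \<bar>count_G N x - c * x\<bar> \<le> C0 * x powr \<eta>"
    by (auto simp: eventually_at_top_linorder)
  define Y where "Y = c * \<bar>X\<bar>"
  define K where "K = count_G N X + Y"
  have K0: "K \<ge> 0" using c by (simp add: K_def Y_def count_G_def)
  have "\<bar>count_G N x - c * x\<bar> \<le> (C0 + K) * x powr \<eta>" if x: "x \<ge> 1" for x
  proof (cases "x \<ge> X")
    case True
    have "C0 * x powr \<eta> \<le> (C0 + K) * x powr \<eta>" using K0 by (intro mult_right_mono) auto
    thus ?thesis using X[OF True] by linarith
  next
    case False
    have "count_G N x \<le> count_G N X"
      unfolding count_G_def using False by (intro of_nat_mono card_mono fin) auto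
    moreover have "count_G N x \<ge> 0" by (simp add: count_G_def)
    moreover have "0 \<le> c * x" "c * x \<le> Y" unfolding Y_def using False x c by (auto intro!: mult_left_mono)
    moreover have "count_G N X \<ge> 0" by (simp add: count_G_def)
    ultimately have "\<bar>count_G N x - c * x\<bar> \<le> K * 1" unfolding K_def mult_1_right by (intro abs_leI) linarith+
    also have "\<dots> \<le> (C0 + K) * x powr \<eta>"
      using K0 C0 x c by (intro mult_mono ge_one_powr_ge_zero) auto
    finally show ?thesis .
  qed
  hence "axiom_A_semigroup N c \<eta> (C0 + K)"
    using N c fin by unfold_locales (auto simp: arith_semigroup_def)
  thus ?thesis by (rule that)
qed

theorem theorem1p1:
  fixes N :: "'p \<Rightarrow> real" and S :: "'p set" and \<delta> :: real
    and a :: "'p multiset \<Rightarrow> complex"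
  assumes "arith_semigroup N"
    and "axiom_A N"
    and "has_natural_density N S \<delta>"
    and "\<forall>g. g \<notin> DS N S \<longrightarrow> a g = 0"
    and "a {#} = 1"
    and "\<exists>L. ((\<lambda>x. \<Sum>g \<in> {g \<in> DS N S. 2 \<le> gnorm N g \<and> gnorm N g \<le> x}.
                 norm (a g) / gnorm N g * ln (ln (gnorm N g))) \<longlongrightarrow> L) at_top"
  shows "((\<lambda>x. \<Sum>g \<in> {g \<in> DS N S. g \<noteq> {#} \<and> gnorm N g \<le> x}.
              dconv moebius a g / of_real (gnorm N g)) \<longlongrightarrow> - of_real \<delta>) at_top \<and>
         ((\<lambda>x. \<Sum>g \<in> {g \<in> DS N S. g \<noteq> {#} \<and> gnorm N g \<le> x}.
              moebius g / of_real (gnorm N g)) \<longlongrightarrow> - of_real \<delta>) at_top"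
proof -
  obtain c \<eta> C where "axiom_A_semigroup N c \<eta> C"
    using axiom_A_semigroupI[OF assms(1,2)] by blast
  then interpret axiom_A_semigroup N c \<eta> C .
  obtain L where L: "((\<lambda>x. \<Sum>g \<in> {g \<in> DS N S. 2 \<le> gnorm N g \<and> gnorm N g \<le> x}.
                 norm (a g) / gnorm N g * ln (ln (gnorm N g))) \<longlongrightarrow> L) at_top"
    using assms(6) by blast
  have eq: "{g \<in> DS N S. g \<noteq> {#} \<and> gnorm N g \<le> x} = le x \<inter> (DS N S - {{#}})" for x
    by auto
  \<comment> \<open>The second limit is not obtained by choosing \<open>a\<close>; it was
    established first and provides the contribution of the identity to the first limit.\<close>
  show ?thesis unfolding eq
    using sum_dconv_DS_tendsto[OF assms(3) _ assms(5) L] sum_moebius_DS_tendsto[OF assms(3)] assms(4)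
    by blast
qed

end
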